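(* Let $G$ be a finite group whose order $|G|$ is not square-free. Then there exist subgroups $H, J \subset G$ such that the groups $\operatorname{Ext}^l_{A(G)}(\mathbb{Z}_H, \mathbb{Z}_J)$, $l \geq 1$, have unbounded rank; that is, for every integer $C$ there is an $l \geq 1$ such that the rank of the finite abelian group $\operatorname{Ext}^l_{A(G)}(\mathbb{Z}_H, \mathbb{Z}_J)$ is greater than $C$.
   Context: For a finite group $G$, the Burnside ring $A(G)$ is the Grothendieck ring of the commutative semi-ring of isomorphism classes of finite $G$-sets, with addition given by disjoint union and multiplication by cartesian product; $[X]$ denotes the class of a finite $G$-set $X$. For a subgroup $H \subset G$, the mark homomorphism $\pi_H : A(G) \to \mathbb{Z}$ is the ring homomorphism determined by $\pi_H([X]) = |X^H|$, where $X^H$ is the set of $H$-fixed points of the finite $G$-set $X$. $\mathbb{Z}_H$ denotes the $A(G)$-module with underlying abelian group $\mathbb{Z}$ and action $a\cdot n = \pi_H(a)n$. For $l \geq 1$ the groups $\operatorname{Ext}^l_{A(G)}(\mathbb{Z}_H,\mathbb{Z}_J)$ are finite; the rank of a finite abelian group is its minimal number of generators. *)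

theory Defs
  imports
    "HOL-Algebra.Group_Action"
    "HOL-Algebra.Module"
    "HOL-Algebra.Generated_Groups"
    "HOL-Algebra.IntRing"
    "HOL-Computational_Algebra.Squarefree"
begin

section \<open>Finite G-sets\<close>

type_synonym ('g, 'x) gset = "'x set \<times> ('g \<Rightarrow> 'x \<Rightarrow> 'x)"

definition finite_gset :: "('g, 'k) monoid_scheme \<Rightarrow> ('g, 'x) gset \<Rightarrow> bool" where
  "finite_gset G X \<longleftrightarrow> finite (fst X) \<and> group_action G (fst X) (snd X)"

definition gset_iso :: "('g, 'k) monoid_scheme \<Rightarrow> ('g, 'x) gset \<Rightarrow> ('g, 'y) gset \<Rightarrow> bool" where
  "gset_iso G X Y \<longleftrightarrow> (\<exists>f. bij_betw f (fst X) (fst Y) \<and>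
     (\<forall>g\<in>carrier G. \<forall>x\<in>fst X. f (snd X g x) = snd Y g (f x)))"

definition gset_sum :: "('g, 'x) gset \<Rightarrow> ('g, 'y) gset \<Rightarrow> ('g, 'x + 'y) gset" where
  "gset_sum X Y = (Sum_Type.Plus (fst X) (fst Y), \<lambda>g. \<lambda>z\<in>Sum_Type.Plus (fst X) (fst Y). map_sum (snd X g) (snd Y g) z)"

definition gset_prod :: "('g, 'x) gset \<Rightarrow> ('g, 'y) gset \<Rightarrow> ('g, 'x \<times> 'y) gset" where
  "gset_prod X Y = (fst X \<times> fst Y, \<lambda>g. \<lambda>z\<in>fst X \<times> fst Y. map_prod (snd X g) (snd Y g) z)"

definition gset_empty :: "('g, nat) gset" where
  "gset_empty = ({}, \<lambda>g. \<lambda>x\<in>{}. x)"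

definition gset_point :: "('g, nat) gset" where
  "gset_point = ({0}, \<lambda>g. \<lambda>x\<in>{0}. x)"

definition fixed_points :: "'g set \<Rightarrow> ('g, 'x) gset \<Rightarrow> 'x set" where
  "fixed_points H X = {x \<in> fst X. \<forall>h\<in>H. snd X h x = x}"

text \<open>
  Every finite G-set, over whatever type, is isomorphic to one whose points are natural
  numbers.  An isomorphism class is represented by the set of its members over \<^typ>\<open>nat\<close>.
\<close>

definition gset_class :: "('g, 'k) monoid_scheme \<Rightarrow> ('g, 'x) gset \<Rightarrow> ('g, nat) gset set" where
  "gset_class G X = {Y. finite_gset G Y \<and> gset_iso G X Y}"

definition gset_semiring :: "('g, 'k) monoid_scheme \<Rightarrow> ('g, nat) gset set ring" where
  "gset_semiring G =
    \<lparr>carrier = {gset_class G X | X :: ('g, nat) gset. finite_gset G X},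
     monoid.mult = (\<lambda>A B. \<Union>X\<in>A. \<Union>Y\<in>B. gset_class G (gset_prod X Y)),
     one = gset_class G gset_point,
     zero = gset_class G gset_empty,
     add = (\<lambda>A B. \<Union>X\<in>A. \<Union>Y\<in>B. gset_class G (gset_sum X Y))\<rparr>"


section \<open>Grothendieck rings and the Burnside ring\<close>

text \<open>The pair \<open>(a, b)\<close> stands for the formal difference of \<open>a\<close> and \<open>b\<close>.\<close>

definition grothendieck_rel :: "('s, 'k) ring_scheme \<Rightarrow> (('s \<times> 's) \<times> ('s \<times> 's)) set" where
  "grothendieck_rel S = {((a, b), (c, d)).
     a \<in> carrier S \<and> b \<in> carrier S \<and> c \<in> carrier S \<and> d \<in> carrier S \<and>
     (\<exists>k\<in>carrier S. (a \<oplus>\<^bsub>S\<^esub> d) \<oplus>\<^bsub>S\<^esub> k = (c \<oplus>\<^bsub>S\<^esub> b) \<oplus>\<^bsub>S\<^esub> k)}"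

definition grothendieck_class :: "('s, 'k) ring_scheme \<Rightarrow> 's \<times> 's \<Rightarrow> ('s \<times> 's) set" where
  "grothendieck_class S p = grothendieck_rel S `` {p}"

definition grothendieck_ring :: "('s, 'k) ring_scheme \<Rightarrow> ('s \<times> 's) set ring" where
  "grothendieck_ring S =
    \<lparr>carrier = (carrier S \<times> carrier S) // grothendieck_rel S,
     monoid.mult = (\<lambda>P Q. \<Union>(a, b)\<in>P. \<Union>(c, d)\<in>Q. grothendieck_class S
       (a \<otimes>\<^bsub>S\<^esub> c \<oplus>\<^bsub>S\<^esub> b \<otimes>\<^bsub>S\<^esub> d, a \<otimes>\<^bsub>S\<^esub> d \<oplus>\<^bsub>S\<^esub> b \<otimes>\<^bsub>S\<^esub> c)),
     one = grothendieck_class S (\<one>\<^bsub>S\<^esub>, \<zero>\<^bsub>S\<^esub>),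
     zero = grothendieck_class S (\<zero>\<^bsub>S\<^esub>, \<zero>\<^bsub>S\<^esub>),
     add = (\<lambda>P Q. \<Union>(a, b)\<in>P. \<Union>(c, d)\<in>Q. grothendieck_class S (a \<oplus>\<^bsub>S\<^esub> c, b \<oplus>\<^bsub>S\<^esub> d))\<rparr>"

definition burnside_ring ::
  "('g, 'k) monoid_scheme \<Rightarrow> (('g, nat) gset set \<times> ('g, nat) gset set) set ring" where
  "burnside_ring G = grothendieck_ring (gset_semiring G)"

definition burnside_class ::
  "('g, 'k) monoid_scheme \<Rightarrow> ('g, 'x) gset \<Rightarrow> (('g, nat) gset set \<times> ('g, nat) gset set) set" where
  "burnside_class G X = grothendieck_class (gset_semiring G) (gset_class G X, \<zero>\<^bsub>gset_semiring G\<^esub>)"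

text \<open>The number of fixed points of any member of an isomorphism class of G-sets, extended
  additively to formal differences of classes.\<close>

definition class_mark :: "'g set \<Rightarrow> ('g, nat) gset set \<Rightarrow> int" where
  "class_mark H A = the_elem ((\<lambda>X. int (card (fixed_points H X))) ` A)"

definition mark :: "'g set \<Rightarrow> (('g, nat) gset set \<times> ('g, nat) gset set) set \<Rightarrow> int" where
  "mark H P = the_elem ((\<lambda>(A, B). class_mark H A - class_mark H B) ` P)"

definition mark_module ::
  "'g set \<Rightarrow> ((('g, nat) gset set \<times> ('g, nat) gset set) set, int) module" where
  "mark_module H =
    \<lparr>carrier = UNIV, monoid.mult = (*), one = 1, zero = 0, add = (+), smult = (\<lambda>a n. mark H a * n)\<rparr>"


section \<open>Ext groups\<close>

definition module_hom ::
  "('r, 'k) ring_scheme \<Rightarrow> ('r, 'm, 'p) module_scheme \<Rightarrow> ('r, 'n, 'q) module_scheme \<Rightarrow> ('m \<Rightarrow> 'n) set"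
  where
  "module_hom R M N = {f \<in> carrier M \<rightarrow> carrier N.
     (\<forall>x\<in>carrier M. \<forall>y\<in>carrier M. f (x \<oplus>\<^bsub>M\<^esub> y) = f x \<oplus>\<^bsub>N\<^esub> f y) \<and>
     (\<forall>a\<in>carrier R. \<forall>x\<in>carrier M. f (a \<odot>\<^bsub>M\<^esub> x) = a \<odot>\<^bsub>N\<^esub> f x)}"

text \<open>The abelian group of homomorphisms between two modules, written multiplicatively.\<close>

definition Hom_group ::
  "('r, 'k) ring_scheme \<Rightarrow> ('r, 'm, 'p) module_scheme \<Rightarrow> ('r, 'n, 'q) module_scheme
    \<Rightarrow> ('m \<Rightarrow> 'n) monoid" where
  "Hom_group R M N =
    \<lparr>carrier = module_hom R M N \<inter> extensional (carrier M),
     monoid.mult = (\<lambda>f g. \<lambda>x\<in>carrier M. f x \<oplus>\<^bsub>N\<^esub> g x),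
     one = (\<lambda>x\<in>carrier M. \<zero>\<^bsub>N\<^esub>)\<rparr>"

text \<open>The free module with basis \<open>B\<close>.  The ring multiplication that the record type provides
  plays no role in modules.\<close>

definition free_module :: "('r, 'k) ring_scheme \<Rightarrow> 'i set \<Rightarrow> ('r, 'i \<Rightarrow> 'r) module" where
  "free_module R B =
    \<lparr>carrier = {f. range f \<subseteq> carrier R \<and> finite {i. f i \<noteq> \<zero>\<^bsub>R\<^esub>} \<and> {i. f i \<noteq> \<zero>\<^bsub>R\<^esub>} \<subseteq> B},
     monoid.mult = undefined, one = undefined,
     zero = (\<lambda>i. \<zero>\<^bsub>R\<^esub>),
     add = (\<lambda>f g i. f i \<oplus>\<^bsub>R\<^esub> g i),
     smult = (\<lambda>a f i. a \<otimes>\<^bsub>R\<^esub> f i)\<rparr>"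

text \<open>\<open>\<dots> \<rightarrow> F (B 2) \<rightarrow> F (B 1) \<rightarrow> F (B 0) \<rightarrow> M \<rightarrow> 0\<close> is exact, with maps \<open>\<dots>, d 1, d 0, \<epsilon>\<close>.\<close>

definition free_resolution ::
  "('r, 'k) ring_scheme \<Rightarrow> ('r, 'm, 'p) module_scheme \<Rightarrow> (nat \<Rightarrow> 'i set)
    \<Rightarrow> (nat \<Rightarrow> ('i \<Rightarrow> 'r) \<Rightarrow> ('i \<Rightarrow> 'r)) \<Rightarrow> (('i \<Rightarrow> 'r) \<Rightarrow> 'm) \<Rightarrow> bool" where
  "free_resolution R M B d \<epsilon> \<longleftrightarrow>
     \<epsilon> \<in> module_hom R (free_module R (B 0)) M \<and>
     (\<forall>n. d n \<in> module_hom R (free_module R (B (Suc n))) (free_module R (B n))) \<and>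
     \<epsilon> ` carrier (free_module R (B 0)) = carrier M \<and>
     d 0 ` carrier (free_module R (B 1)) = {x \<in> carrier (free_module R (B 0)). \<epsilon> x = \<zero>\<^bsub>M\<^esub>} \<and>
     (\<forall>n. d (Suc n) ` carrier (free_module R (B (Suc (Suc n)))) =
        {x \<in> carrier (free_module R (B (Suc n))). d n x = \<zero>\<^bsub>free_module R (B n)\<^esub>})"

definition cohomology ::
  "(nat \<Rightarrow> 'c monoid) \<Rightarrow> (nat \<Rightarrow> 'c \<Rightarrow> 'c) \<Rightarrow> nat \<Rightarrow> 'c set monoid" where
  "cohomology C \<delta> n =
     (C n)\<lparr>carrier := kernel (C n) (C (Suc n)) (\<delta> n)\<rparr> Mod
     (case n of 0 \<Rightarrow> {\<one>\<^bsub>C 0\<^esub>} | Suc k \<Rightarrow> \<delta> k ` carrier (C k))"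

definition Hom_cohomology ::
  "('r, 'k) ring_scheme \<Rightarrow> (nat \<Rightarrow> 'i set) \<Rightarrow> (nat \<Rightarrow> ('i \<Rightarrow> 'r) \<Rightarrow> ('i \<Rightarrow> 'r))
    \<Rightarrow> ('r, 'n, 'q) module_scheme \<Rightarrow> nat \<Rightarrow> (('i \<Rightarrow> 'r) \<Rightarrow> 'n) set monoid" where
  "Hom_cohomology R B d N =
     cohomology (\<lambda>n. Hom_group R (free_module R (B n)) N)
       (\<lambda>n f. compose (carrier (free_module R (B (Suc n)))) f (d n))"

text \<open>
  Ext is computed from a chosen free resolution.  The bases are subsets of the type below,
  which is large enough for every module \<open>M\<close> over \<open>R\<close> to have such a resolution: \<open>Elem m\<close> can
  name a generator mapping to \<open>m\<close>, and \<open>Syz [(r\<^sub>1, g\<^sub>1), \<dots>]\<close> a generator mapping to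
  \<open>r\<^sub>1 g\<^sub>1 + \<dots>\<close>.
\<close>

datatype ('r, 'm) generator = Elem 'm | Syz "('r \<times> ('r, 'm) generator) list"

definition Ext ::
  "('r, 'k) ring_scheme \<Rightarrow> ('r, 'm, 'p) module_scheme \<Rightarrow> ('r, 'n, 'q) module_scheme \<Rightarrow> nat
    \<Rightarrow> ((('r, 'm) generator \<Rightarrow> 'r) \<Rightarrow> 'n) set monoid" where
  "Ext R M N l = (let (B, d) = (SOME (B, d). \<exists>\<epsilon>. free_resolution R M B d \<epsilon>)
                  in Hom_cohomology R B d N l)"

definition group_rank :: "('a, 'k) monoid_scheme \<Rightarrow> nat" where
  "group_rank A = (LEAST n. \<exists>S. S \<subseteq> carrier A \<and> finite S \<and> card S = n \<and> generate A S = carrier A)"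

end

theory Submission
  imports "HOL-Algebra.Multiplicative_Group" "HOL-Algebra.Sylow" "HOL-Number_Theory.Totient"
    "HOL-Number_Theory.Cong" "HOL-Computational_Algebra.Primes" "HOL-Library.Nat_Bijection" Defs
begin

text \<open>
  Take \<open>H = J = P\<close>, a Sylow \<open>p\<close>-subgroup for a prime \<open>p\<close> with \<open>p\<^sup>2\<close> dividing \<open>order G = p\<^sup>n c\<close>, and let
  \<open>I\<close> be the kernel of the mark at \<open>P\<close>.  The additive functions \<open>\<pi>\<^sub>1 / p\<close> and \<open>(\<pi>\<^sub>C - \<pi>\<^sub>1) / p\<^sup>v\<close> on \<open>I\<close>,
  with \<open>C\<close> of order \<open>p\<close> and \<open>v\<close> maximal, take values divisible by \<open>p\<close> on \<open>I \<cdot> I\<close>; so each such \<open>g\<close> gives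
  the integral bar 2-cocycle \<open>(a, b) \<mapsto> g (a b) / p\<close>.  Cup products of these cocycles along words of length
  \<open>l\<close> yield \<open>2\<^sup>l\<close> classes in degree \<open>2 l\<close>.  Since \<open>n \<ge> 2\<close>, counting the generators of cyclic
  extensions shows that the function with value \<open>c p\<close> at the Sylow \<open>p\<close>-subgroups and \<open>0\<close> at all other subgroups
  is the vector of marks of some \<open>E\<close>, and \<open>f = c p - E\<close> acts on \<open>I\<close> as the integer \<open>c p\<close>.  Hence
  \<open>[f | b\<^sub>1 | f | b\<^sub>2 | \<dots>]\<close> is a cycle modulo \<open>p\<close> in the bar resolution, and with two suitable choices for
  each \<open>b\<^sub>i\<close> these cycles pair perfectly modulo \<open>p\<close> with the \<open>2\<^sup>l\<close> classes, so the rank in degree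
  \<open>2 l\<close> is at least \<open>2\<^sup>l\<close>.  The pairing is carried over to the given resolution by chain homotopy
  equivalence.
\<close>

section \<open>Free modules\<close>

text \<open>The coefficients are integers, so the cocycles have to be integral, whereas the chains
  on which they are evaluated need to be cycles only modulo \<open>p\<close>: then coboundaries take
  values divisible by \<open>p\<close>, and evaluation is a homomorphism from cohomology to the
  integers modulo \<open>p\<close>. Divisibility on \<open>I I\<close> comes from
  \<open>p\<close>-groups: an element of \<open>I\<close> is divisible by \<open>p\<close> at the
  trivial subgroup and at \<open>C\<close>, because its mark at \<open>P\<close> is 0. For the
  second function this is combined with
  \<open>st(C) - st(1) = (s(C) - s(1)) t(C) + s(1) (t(C) - t(1))\<close>. Maximality of
  \<open>v\<close> makes that function nonzero modulo \<open>p\<close>. The two functions are told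
  apart by \<open>f\<close> itself: as \<open>C\<close> has order \<open>p < p^n\<close>, it is no
  Sylow subgroup, so \<open>f\<close> has equal values \<open>c p\<close> at \<open>C\<close> and at
  the trivial subgroup. Thus \<open>f\<close> takes the value \<open>c\<close> under the first
  function and 0 under the second, and \<open>c\<close> is prime to \<open>p\<close>. Two features
  of the definitions shape the rest. \<open>Ext\<close> rests on an arbitrary choice of resolution,
  so nothing may depend on its shape; and \<open>group_rank\<close> is a \<open>LEAST\<close>,
  meaningful only once the cohomology is known to be finitely generated.\<close>

definition basis_vec :: "('r, 'k) ring_scheme \<Rightarrow> 'i \<Rightarrow> 'i \<Rightarrow> 'r" where
  "basis_vec R i = (\<lambda>j. if j = i then \<one>\<^bsub>R\<^esub> else \<zero>\<^bsub>R\<^esub>)"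

lemma module_homI:
  assumes "\<And>x. x \<in> carrier M \<Longrightarrow> f x \<in> carrier N"
    and "\<And>x y. x \<in> carrier M \<Longrightarrow> y \<in> carrier M \<Longrightarrow> f (x \<oplus>\<^bsub>M\<^esub> y) = f x \<oplus>\<^bsub>N\<^esub> f y"
    and "\<And>a x. a \<in> carrier R \<Longrightarrow> x \<in> carrier M \<Longrightarrow> f (a \<odot>\<^bsub>M\<^esub> x) = a \<odot>\<^bsub>N\<^esub> f x"
  shows "f \<in> module_hom R M N"
  using assms by (auto simp: module_hom_def)

lemma module_homD:
  assumes "f \<in> module_hom R M N"
  shows "x \<in> carrier M \<Longrightarrow> f x \<in> carrier N"
    and "x \<in> carrier M \<Longrightarrow> y \<in> carrier M \<Longrightarrow> f (x \<oplus>\<^bsub>M\<^esub> y) = f x \<oplus>\<^bsub>N\<^esub> f y"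
    and "a \<in> carrier R \<Longrightarrow> x \<in> carrier M \<Longrightarrow> f (a \<odot>\<^bsub>M\<^esub> x) = a \<odot>\<^bsub>N\<^esub> f x"
  using assms by (auto simp: module_hom_def)

lemma module_hom_zero:
  assumes "module R M" "module R N" "f \<in> module_hom R M N"
  shows "f \<zero>\<^bsub>M\<^esub> = \<zero>\<^bsub>N\<^esub>"
proof -
  interpret M: module R M by fact
  interpret N: module R N by fact
  have "f \<zero>\<^bsub>M\<^esub> \<oplus>\<^bsub>N\<^esub> f \<zero>\<^bsub>M\<^esub> = f \<zero>\<^bsub>M\<^esub>"
    by (metis M.zero_closed M.l_zero assms(3) module_homD(2))
  then show ?thesis
    using module_homD(1)[OF assms(3) M.zero_closed] N.add.r_cancel_one' by metis
qed

lemma module_hom_minus: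
  assumes "module R M" "module R N" "f \<in> module_hom R M N" "x \<in> carrier M" "y \<in> carrier M"
  shows "f (x \<ominus>\<^bsub>M\<^esub> y) = f x \<ominus>\<^bsub>N\<^esub> f y"
proof -
  interpret M: module R M by fact
  interpret N: module R N by fact
  note [simp] = assms(4,5) module_homD(1)[OF assms(3)]
  have "f (x \<ominus>\<^bsub>M\<^esub> y) \<oplus>\<^bsub>N\<^esub> f y = f x"
    using module_homD(2)[OF assms(3), of "x \<ominus>\<^bsub>M\<^esub> y" y]
    by (simp add: a_minus_def M.a_assoc M.l_neg)
  then show ?thesis
    by (metis N.add.inv_solve_right assms(4,5) a_minus_def M.minus_closed module_homD(1)[OF assms(3)])
qed

lemma module_hom_comp:
  assumes "f \<in> module_hom R L M" "g \<in> module_hom R M N"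
  shows "(\<lambda>x. g (f x)) \<in> module_hom R L N"
  using assms by (auto simp: module_hom_def Pi_iff)

lemma module_hom_sub:
  assumes "module R M" "module R N" "f \<in> module_hom R M N" "g \<in> module_hom R M N"
  shows "(\<lambda>x. f x \<ominus>\<^bsub>N\<^esub> g x) \<in> module_hom R M N"
proof -
  interpret M: module R M by fact
  interpret N: module R N by fact
  note f = module_homD[OF assms(3)] and g = module_homD[OF assms(4)]
  show ?thesis
  proof (rule module_homI)
    fix x y assume xy: "x \<in> carrier M" "y \<in> carrier M"
    show "f (x \<oplus>\<^bsub>M\<^esub> y) \<ominus>\<^bsub>N\<^esub> g (x \<oplus>\<^bsub>M\<^esub> y) = (f x \<ominus>\<^bsub>N\<^esub> g x) \<oplus>\<^bsub>N\<^esub> (f y \<ominus>\<^bsub>N\<^esub> g y)"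
      using xy by (simp add: f g a_minus_def N.minus_add N.a_ac)
  next
    fix a x assume "a \<in> carrier R" "x \<in> carrier M"
    then show "f (a \<odot>\<^bsub>M\<^esub> x) \<ominus>\<^bsub>N\<^esub> g (a \<odot>\<^bsub>M\<^esub> x) = a \<odot>\<^bsub>N\<^esub> (f x \<ominus>\<^bsub>N\<^esub> g x)"
      by (simp add: f g a_minus_def N.smult_r_distr N.smult_r_minus)
  qed (simp add: f g)
qed

lemma module_hom_id: "(\<lambda>x. x) \<in> module_hom R M M"
  by (simp add: module_hom_def)

context cring
begin

lemma carrier_free_module:
  "f \<in> carrier (free_module R B) \<longleftrightarrow>
    (\<forall>i. f i \<in> carrier R) \<and> finite {i. f i \<noteq> \<zero>} \<and> (\<forall>i. i \<notin> B \<longrightarrow> f i = \<zero>)"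
  by (auto simp: free_module_def)

lemma free_carrierD:
  assumes "f \<in> carrier (free_module R B)"
  shows "f i \<in> carrier R" and "finite {i. f i \<noteq> \<zero>}" and "f i \<noteq> \<zero> \<Longrightarrow> i \<in> B"
  using assms by (auto simp: carrier_free_module)

lemma free_module_simps:
  "\<zero>\<^bsub>free_module R B\<^esub> = (\<lambda>i. \<zero>)"
  "f \<oplus>\<^bsub>free_module R B\<^esub> g = (\<lambda>i. f i \<oplus> g i)"
  "a \<odot>\<^bsub>free_module R B\<^esub> f = (\<lambda>i. a \<otimes> f i)"
  by (simp_all add: free_module_def)

lemma free_add_closed:
  assumes "f \<in> carrier (free_module R B)" "g \<in> carrier (free_module R B)"
  shows "(\<lambda>i. f i \<oplus> g i) \<in> carrier (free_module R B)"
proof -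
  have "{i. f i \<oplus> g i \<noteq> \<zero>} \<subseteq> {i. f i \<noteq> \<zero>} \<union> {i. g i \<noteq> \<zero>}" by auto
  with assms show ?thesis
    by (auto simp: carrier_free_module intro: finite_subset[OF _ finite_UnI])
qed

lemma free_smult_closed:
  assumes "a \<in> carrier R" "f \<in> carrier (free_module R B)"
  shows "(\<lambda>i. a \<otimes> f i) \<in> carrier (free_module R B)"
proof -
  have "{i. a \<otimes> f i \<noteq> \<zero>} \<subseteq> {i. f i \<noteq> \<zero>}" using assms(1) by auto
  with assms show ?thesis
    by (auto simp: carrier_free_module intro: finite_subset)
qed

lemma free_module_module: "module R (free_module R B)"
proof (rule moduleI)
  show "abelian_group (free_module R B)"
  proof (rule abelian_groupI)
    fix x assume x: "x \<in> carrier (free_module R B)"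
    have "{i. \<ominus> x i \<noteq> \<zero>} = {i. x i \<noteq> \<zero>}" using x by (auto simp: carrier_free_module)
    then have "(\<lambda>i. \<ominus> x i) \<in> carrier (free_module R B)"
      using x by (auto simp: carrier_free_module)
    moreover have "(\<lambda>i. \<ominus> x i) \<oplus>\<^bsub>free_module R B\<^esub> x = \<zero>\<^bsub>free_module R B\<^esub>"
      using x by (auto simp: free_module_simps carrier_free_module l_neg)
    ultimately show "\<exists>y\<in>carrier (free_module R B). y \<oplus>\<^bsub>free_module R B\<^esub> x = \<zero>\<^bsub>free_module R B\<^esub>" by blast
  qed (auto simp: free_module_simps free_add_closed, auto simp: carrier_free_module a_ac)
qed (auto simp: free_module_simps free_smult_closed is_cring, auto simp: carrier_free_module l_distr r_distr m_assoc)

lemma free_minus: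
  assumes "f \<in> carrier (free_module R B)" "g \<in> carrier (free_module R B)"
  shows "f \<ominus>\<^bsub>free_module R B\<^esub> g = (\<lambda>i. f i \<ominus> g i)"
proof -
  interpret F: module R "free_module R B" by (rule free_module_module)
  have "{i. \<ominus> g i \<noteq> \<zero>} = {i. g i \<noteq> \<zero>}" using assms(2) by (auto simp: carrier_free_module)
  then have m: "(\<lambda>i. \<ominus> g i) \<in> carrier (free_module R B)"
    using assms(2) by (auto simp: carrier_free_module)
  have "\<ominus>\<^bsub>free_module R B\<^esub> g = (\<lambda>i. \<ominus> g i)"
    by (rule F.minus_equality) (use assms m in \<open>auto simp: free_module_simps carrier_free_module l_neg\<close>)
  then show ?thesis by (simp add: F.minus_eq free_module_simps minus_eq)
qed

lemma basis_vec_closed: "i \<in> B \<Longrightarrow> basis_vec R i \<in> carrier (free_module R B)"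
  by (auto simp: carrier_free_module basis_vec_def)

lemma free_induct [consumes 1, case_names zero add single]:
  assumes "z \<in> carrier (free_module R B)"
    and zero: "P (\<lambda>i. \<zero>)"
    and add: "\<And>x y. x \<in> carrier (free_module R B) \<Longrightarrow> y \<in> carrier (free_module R B) \<Longrightarrow> P x \<Longrightarrow> P y
      \<Longrightarrow> P (\<lambda>i. x i \<oplus> y i)"
    and single: "\<And>a i. a \<in> carrier R \<Longrightarrow> i \<in> B \<Longrightarrow> P (\<lambda>j. a \<otimes> basis_vec R i j)"
  shows "P z"
  using assms(1)
proof (induction "card {i. z i \<noteq> \<zero>}" arbitrary: z)
  case 0
  then have "z = (\<lambda>i. \<zero>)" by (auto simp: carrier_free_module)
  then show ?case using zero by simp
next
  case (Suc n)
  then have z: "\<And>i. z i \<in> carrier R" "finite {i. z i \<noteq> \<zero>}" "\<And>i. i \<notin> B \<Longrightarrow> z i = \<zero>"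
    by (auto simp: carrier_free_module)
  from Suc(2) obtain j where j: "z j \<noteq> \<zero>"
    by (metis (mono_tags, lifting) Collect_empty_eq Zero_not_Suc card.empty)
  then have jB: "j \<in> B" using z(3) by blast
  let ?z = "z(j := \<zero>)"
  have "{i. ?z i \<noteq> \<zero>} = {i. z i \<noteq> \<zero>} - {j}" by auto
  then have "card {i. ?z i \<noteq> \<zero>} = n" "?z \<in> carrier (free_module R B)"
    using Suc(2) z j by (auto simp: carrier_free_module)
  with Suc(1) have "P ?z" by simp
  moreover have "z = (\<lambda>i. ?z i \<oplus> z j \<otimes> basis_vec R j i)"
    using z(1) by (auto simp: basis_vec_def fun_eq_iff)
  ultimately show ?case
    using add[OF \<open>?z \<in> _\<close> free_smult_closed[OF z(1)[of j] basis_vec_closed[OF jB]]]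
      single[OF z(1) jB, of j] by metis
qed

lemma free_hom_eqI:
  assumes "module R N" "f \<in> module_hom R (free_module R B) N" "g \<in> module_hom R (free_module R B) N"
    and "\<And>i. i \<in> B \<Longrightarrow> f (basis_vec R i) = g (basis_vec R i)"
    and "z \<in> carrier (free_module R B)"
  shows "f z = g z"
  using assms(5)
proof (induction rule: free_induct)
  case zero
  show ?case using module_hom_zero[OF free_module_module assms(1,2)]
      module_hom_zero[OF free_module_module assms(1,3)] by (simp add: free_module_simps)
next
  case (add x y)
  then show ?case using module_homD(2)[OF assms(2), of x y] module_homD(2)[OF assms(3), of x y]
    by (simp add: free_module_simps)
next
  case (single a i)
  then show ?case using module_homD(3)[OF assms(2), of a "basis_vec R i"]
      module_homD(3)[OF assms(3), of a "basis_vec R i"] assms(4) basis_vec_closed[of i B]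
    by (simp add: free_module_simps)
qed

text \<open>Summing over the support of \<open>z\<close> keeps the sum finite even for an infinite
  basis, which the bases of an arbitrary resolution may be.\<close>

definition lin_ext :: "('a, 'n, 'q) module_scheme \<Rightarrow> ('i \<Rightarrow> 'n) \<Rightarrow> ('i \<Rightarrow> 'a) \<Rightarrow> 'n" where
  "lin_ext N F z = finsum N (\<lambda>i. z i \<odot>\<^bsub>N\<^esub> F i) {i. z i \<noteq> \<zero>}"

context
  fixes N :: "('a, 'n, 'q) module_scheme" and F :: "'i \<Rightarrow> 'n" and B :: "'i set"
  assumes N: "module R N" and F: "\<And>i. i \<in> B \<Longrightarrow> F i \<in> carrier N"
begin

interpretation N: module R N by (rule N)

text \<open>Passing to a common finite set \<open>T\<close> allows the sums for \<open>x\<close>,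
  \<open>y\<close> and \<open>x + y\<close> to be compared term by term, although cancellation may
  shrink the support.\<close>

lemma lin_ext_superset:
  assumes "z \<in> carrier (free_module R B)" "finite T" "{i. z i \<noteq> \<zero>} \<subseteq> T" "T \<subseteq> B"
  shows "lin_ext N F z = finsum N (\<lambda>i. z i \<odot>\<^bsub>N\<^esub> F i) T"
  unfolding lin_ext_def
proof (rule N.add.finprod_mono_neutral_cong_left[OF assms(2,3)])
  have Fi: "F i \<in> carrier N" if "i \<in> T" for i using F assms(4) that by blast
  show "(\<lambda>i. z i \<odot>\<^bsub>N\<^esub> F i) \<in> T \<rightarrow> carrier N"
    using free_carrierD(1)[OF assms(1)] Fi by simp
  show "z i \<odot>\<^bsub>N\<^esub> F i = \<zero>\<^bsub>N\<^esub>" if "i \<in> T - {i. z i \<noteq> \<zero>}" for i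
    using that Fi by simp
qed (rule refl)

lemma lin_ext_hom: "lin_ext N F \<in> module_hom R (free_module R B) N"
proof (rule module_homI)
  fix x assume x: "x \<in> carrier (free_module R B)"
  show "lin_ext N F x \<in> carrier N"
    unfolding lin_ext_def
  proof (rule N.finsum_closed, rule Pi_I)
    fix i assume "i \<in> {i. x i \<noteq> \<zero>}"
    then show "x i \<odot>\<^bsub>N\<^esub> F i \<in> carrier N"
      using free_carrierD(1,3)[OF x] F by simp
  qed
next
  fix x y assume xy: "x \<in> carrier (free_module R B)" "y \<in> carrier (free_module R B)"
  note x = free_carrierD[OF xy(1)] and y = free_carrierD[OF xy(2)]
  let ?T = "{i. x i \<noteq> \<zero>} \<union> {i. y i \<noteq> \<zero>}"
  have T: "finite ?T" "?T \<subseteq> B" "{i. x i \<oplus> y i \<noteq> \<zero>} \<subseteq> ?T"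
    using x(2,3) y(2,3) by auto
  have FT: "F i \<in> carrier N" if "i \<in> ?T" for i using F T(2) that by blast
  have "lin_ext N F (\<lambda>i. x i \<oplus> y i) = finsum N (\<lambda>i. (x i \<oplus> y i) \<odot>\<^bsub>N\<^esub> F i) ?T"
    by (rule lin_ext_superset[OF free_add_closed[OF xy] T(1,3,2)])
  also have "\<dots> = finsum N (\<lambda>i. x i \<odot>\<^bsub>N\<^esub> F i \<oplus>\<^bsub>N\<^esub> y i \<odot>\<^bsub>N\<^esub> F i) ?T"
    by (rule N.finsum_cong') (simp_all add: FT x(1) y(1) N.smult_l_distr Pi_def del: Un_iff)
  also have "\<dots> = finsum N (\<lambda>i. x i \<odot>\<^bsub>N\<^esub> F i) ?T \<oplus>\<^bsub>N\<^esub> finsum N (\<lambda>i. y i \<odot>\<^bsub>N\<^esub> F i) ?T"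
    by (rule N.finsum_addf) (simp_all add: FT x(1) y(1) Pi_def del: Un_iff)
  also have "\<dots> = lin_ext N F x \<oplus>\<^bsub>N\<^esub> lin_ext N F y"
    using lin_ext_superset[OF xy(1) T(1) _ T(2)] lin_ext_superset[OF xy(2) T(1) _ T(2)] by simp
  finally show "lin_ext N F (x \<oplus>\<^bsub>free_module R B\<^esub> y) = lin_ext N F x \<oplus>\<^bsub>N\<^esub> lin_ext N F y"
    by (simp only: free_module_simps)
next
  fix a x assume a: "a \<in> carrier R" and xc: "x \<in> carrier (free_module R B)"
  note x = free_carrierD[OF xc]
  let ?T = "{i. x i \<noteq> \<zero>}"
  have T: "{i. a \<otimes> x i \<noteq> \<zero>} \<subseteq> ?T" "?T \<subseteq> B"
    using a x(3) by auto
  have fs: "finsum N (\<lambda>i. (a \<otimes> x i) \<odot>\<^bsub>N\<^esub> F i) S = a \<odot>\<^bsub>N\<^esub> finsum N (\<lambda>i. x i \<odot>\<^bsub>N\<^esub> F i) S"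
    if "finite S" "S \<subseteq> B" for S
    using that
  proof (induction rule: finite_induct)
    case (insert s S)
    have FS: "F i \<in> carrier N" if "i \<in> S" for i using F insert.prems that by blast
    have "F s \<in> carrier N" using F insert.prems by blast
    then show ?case using insert a x(1) FS
      by (simp add: Pi_def N.smult_r_distr N.smult_assoc1)
  qed (simp add: a)
  have "lin_ext N F (\<lambda>i. a \<otimes> x i) = a \<odot>\<^bsub>N\<^esub> lin_ext N F x"
    using lin_ext_superset[OF free_smult_closed[OF a xc] x(2) T] fs[OF x(2) T(2)] by (simp add: lin_ext_def)
  then show "lin_ext N F (a \<odot>\<^bsub>free_module R B\<^esub> x) = a \<odot>\<^bsub>N\<^esub> lin_ext N F x"
    by (simp only: free_module_simps)
qed

lemma lin_ext_basis:
  assumes "i \<in> B"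
  shows "lin_ext N F (basis_vec R i) = F i"
proof -
  have "lin_ext N F (basis_vec R i) = finsum N (\<lambda>j. basis_vec R i j \<odot>\<^bsub>N\<^esub> F j) {i}"
    by (rule lin_ext_superset) (use assms basis_vec_closed in \<open>auto simp: basis_vec_def\<close>)
  then show ?thesis using F[OF assms] by (simp add: basis_vec_def)
qed

end

text \<open>Projectivity of free modules: preimages are chosen for the basis vectors and extended
  linearly.\<close>

lemma free_module_lift:
  assumes "module R N" "module R N'" "f \<in> module_hom R (free_module R B) N" "g \<in> module_hom R N' N"
    and "\<And>i. i \<in> B \<Longrightarrow> f (basis_vec R i) \<in> g ` carrier N'"
  obtains h where "h \<in> module_hom R (free_module R B) N'"
    and "\<And>z. z \<in> carrier (free_module R B) \<Longrightarrow> g (h z) = f z"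
proof -
  have "\<exists>F. \<forall>i\<in>B. F i \<in> carrier N' \<and> g (F i) = f (basis_vec R i)"
    using assms(5) by (intro bchoice) (metis imageE)
  then obtain F where F: "\<And>i. i \<in> B \<Longrightarrow> F i \<in> carrier N'" "\<And>i. i \<in> B \<Longrightarrow> g (F i) = f (basis_vec R i)"
    by blast
  have h: "lin_ext N' F \<in> module_hom R (free_module R B) N'"
    by (rule lin_ext_hom[OF assms(2) F(1)])
  show thesis
  proof (rule that[OF h])
    fix z assume "z \<in> carrier (free_module R B)"
    then show "g (lin_ext N' F z) = f z"
      by (rule free_hom_eqI[OF assms(1) module_hom_comp[OF h assms(4)] assms(3), rotated])
        (simp add: lin_ext_basis[OF assms(2) F(1)] F(2))
  qed
qed

section \<open>Comparison of free resolutions\<close>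

text \<open>Treating the augmentation as the differential below degree 0 gives exactness one formula
  in all degrees.\<close>

definition cycles where
  "cycles M B d \<epsilon> n = (case n of 0 \<Rightarrow> {x \<in> carrier (free_module R (B 0)). \<epsilon> x = \<zero>\<^bsub>M\<^esub>}
     | Suc k \<Rightarrow> {x \<in> carrier (free_module R (B n)). d k x = \<zero>\<^bsub>free_module R (B k)\<^esub>})"

lemma free_resolutionD:
  assumes "free_resolution R M B d \<epsilon>"
  shows "\<epsilon> \<in> module_hom R (free_module R (B 0)) M"
    and "d n \<in> module_hom R (free_module R (B (Suc n))) (free_module R (B n))"
    and "\<epsilon> ` carrier (free_module R (B 0)) = carrier M"
    and "d n ` carrier (free_module R (B (Suc n))) = cycles M B d \<epsilon> n"
  using assms unfolding free_resolution_def cycles_def by (auto split: nat.splits)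

lemma cycles_subset: "cycles M B d \<epsilon> n \<subseteq> carrier (free_module R (B n))"
  by (auto simp: cycles_def split: nat.splits)

lemma boundary_cycle:
  assumes "free_resolution R M B d \<epsilon>" "x \<in> carrier (free_module R (B (Suc n)))"
  shows "d n x \<in> cycles M B d \<epsilon> n"
  using free_resolutionD(4)[OF assms(1)] assms(2) by blast

lemma resolution_dd:
  assumes "free_resolution R M B d \<epsilon>" "x \<in> carrier (free_module R (B (Suc (Suc n))))"
  shows "d n (d (Suc n) x) = \<zero>\<^bsub>free_module R (B n)\<^esub>"
  using boundary_cycle[OF assms] by (simp add: cycles_def)

definition chain_map where
  "chain_map B d \<epsilon> B' d' \<epsilon>' \<phi> \<longleftrightarrow>
     (\<forall>n. \<phi> n \<in> module_hom R (free_module R (B n)) (free_module R (B' n))) \<and>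
     (\<forall>x\<in>carrier (free_module R (B 0)). \<epsilon>' (\<phi> 0 x) = \<epsilon> x) \<and>
     (\<forall>n. \<forall>x\<in>carrier (free_module R (B (Suc n))). d' n (\<phi> (Suc n) x) = \<phi> n (d n x))"

lemma comparison_exists:
  assumes M: "module R M" and res: "free_resolution R M B d \<epsilon>" and res': "free_resolution R M B' d' \<epsilon>'"
  obtains \<phi> where "chain_map B d \<epsilon> B' d' \<epsilon>' \<phi>"
proof -
  note r = free_resolutionD[OF res] and r' = free_resolutionD[OF res']
  \<comment> \<open>Preservation of cycles is carried through the recursion because cycles of the
    target are boundaries, which is what makes the next lift possible. The augmentation enters in
    degree 0 only.\<close>
  define P where "P = (\<lambda>n f. f \<in> module_hom R (free_module R (B n)) (free_module R (B' n)) \<and>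
    (\<forall>x\<in>cycles M B d \<epsilon> n. f x \<in> cycles M B' d' \<epsilon>' n) \<and>
    (n = 0 \<longrightarrow> (\<forall>x\<in>carrier (free_module R (B 0)). \<epsilon>' (f x) = \<epsilon> x)))"
  define Q where "Q = (\<lambda>n f g. \<forall>x\<in>carrier (free_module R (B (Suc n))). d' n (g x) = f (d n x))"
  have ex0: "\<exists>f. P 0 f"
  proof -
    obtain h where "h \<in> module_hom R (free_module R (B 0)) (free_module R (B' 0))"
      "\<And>z. z \<in> carrier (free_module R (B 0)) \<Longrightarrow> \<epsilon>' (h z) = \<epsilon> z"
      by (rule free_module_lift[OF M free_module_module r(1) r'(1)])
        (simp_all add: r'(3) module_homD(1)[OF r(1)] basis_vec_closed)
    then show ?thesis
      unfolding P_def by (intro exI[of _ h]) (auto simp: cycles_def dest: module_homD(1))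
  qed
  have step: "\<exists>g. P (Suc n) g \<and> Q n f g" if f: "P n f" for n f
  proof -
    have fh: "f \<in> module_hom R (free_module R (B n)) (free_module R (B' n))"
      and fc: "\<And>x. x \<in> cycles M B d \<epsilon> n \<Longrightarrow> f x \<in> cycles M B' d' \<epsilon>' n"
      using f by (auto simp: P_def)
    have im: "f (d n (basis_vec R i)) \<in> d' n ` carrier (free_module R (B' (Suc n)))" if "i \<in> B (Suc n)" for i
      using r'(4) fc boundary_cycle[OF res basis_vec_closed[OF that]] by simp
    obtain h where h: "h \<in> module_hom R (free_module R (B (Suc n))) (free_module R (B' (Suc n)))"
      "\<And>z. z \<in> carrier (free_module R (B (Suc n))) \<Longrightarrow> d' n (h z) = f (d n z)"
      using free_module_lift[OF free_module_module free_module_module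
            module_hom_comp[OF r(2) fh] r'(2) im] by blast
    have "f (\<zero>\<^bsub>free_module R (B n)\<^esub>) = \<zero>\<^bsub>free_module R (B' n)\<^esub>"
      by (rule module_hom_zero[OF free_module_module free_module_module fh])
    then have "P (Suc n) h \<and> Q n f h"
      unfolding P_def Q_def using h by (auto simp: cycles_def dest: module_homD(1))
    then show ?thesis by blast
  qed
  obtain \<phi> where \<phi>: "\<And>n. P n (\<phi> n)" "\<And>n. Q n (\<phi> n) (\<phi> (Suc n))"
    using dependent_nat_choice[of P Q, OF ex0 step] by blast
  have "chain_map B d \<epsilon> B' d' \<epsilon>' \<phi>"
    using \<phi> \<phi>(1)[of 0] unfolding chain_map_def P_def Q_def by auto
  then show thesis by (rule that)
qed

lemma chain_map_comp:
  assumes "chain_map B d \<epsilon> B' d' \<epsilon>' \<phi>" "chain_map B' d' \<epsilon>' B'' d'' \<epsilon>'' \<psi>"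
  shows "chain_map B d \<epsilon> B'' d'' \<epsilon>'' (\<lambda>n x. \<psi> n (\<phi> n x))"
proof -
  have "\<phi> n x \<in> carrier (free_module R (B' n))" if "x \<in> carrier (free_module R (B n))" for n x
    using assms(1) that module_homD(1)[of "\<phi> n"] unfolding chain_map_def by blast
  moreover have "(\<lambda>x. \<psi> n (\<phi> n x)) \<in> module_hom R (free_module R (B n)) (free_module R (B'' n))" for n
    using assms unfolding chain_map_def by (metis module_hom_comp)
  ultimately show ?thesis
    using assms unfolding chain_map_def by auto
qed

text \<open>The uniqueness half of the comparison theorem, for a lift of the identity: the defect
  left by the previous \<open>h\<close> is a cycle, hence a boundary, and freeness allows a linear
  choice of preimages.\<close>

lemma endo_homotopy:
  assumes M: "module R M" and res: "free_resolution R M B d \<epsilon>" and \<kappa>: "chain_map B d \<epsilon> B d \<epsilon> \<kappa>"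
  obtains h where "\<And>n. h n \<in> module_hom R (free_module R (B n)) (free_module R (B (Suc n)))"
    and "\<And>n x. x \<in> carrier (free_module R (B (Suc n))) \<Longrightarrow>
      d (Suc n) (h (Suc n) x) = \<kappa> (Suc n) x \<ominus>\<^bsub>free_module R (B (Suc n))\<^esub> x \<ominus>\<^bsub>free_module R (B (Suc n))\<^esub> h n (d n x)"
proof -
  note r = free_resolutionD[OF res]
  let ?F = "\<lambda>n. free_module R (B n)"
  have \<kappa>h: "\<kappa> n \<in> module_hom R (?F n) (?F n)" for n using \<kappa> by (simp add: chain_map_def)
  have \<kappa>0: "\<epsilon> (\<kappa> 0 x) = \<epsilon> x" if "x \<in> carrier (?F 0)" for x using \<kappa> that by (simp add: chain_map_def)
  have \<kappa>d: "d n (\<kappa> (Suc n) x) = \<kappa> n (d n x)" if "x \<in> carrier (?F (Suc n))" for n x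
    using \<kappa> that by (simp add: chain_map_def)
  \<comment> \<open>On cycles the term \<open>h (d x)\<close> vanishes, so only this shorter
    equation has to survive to the next degree, where it makes the defect a cycle.\<close>
  define P where "P = (\<lambda>n h. h \<in> module_hom R (?F n) (?F (Suc n)) \<and>
    (\<forall>x\<in>cycles M B d \<epsilon> n. d n (h x) = \<kappa> n x \<ominus>\<^bsub>?F n\<^esub> x))"
  define Q where "Q = (\<lambda>n h h'. \<forall>x\<in>carrier (?F (Suc n)).
      d (Suc n) (h' x) = \<kappa> (Suc n) x \<ominus>\<^bsub>?F (Suc n)\<^esub> x \<ominus>\<^bsub>?F (Suc n)\<^esub> h (d n x))"
  note mm = free_module_module
  have tid: "(\<lambda>x. \<kappa> n x \<ominus>\<^bsub>?F n\<^esub> x) \<in> module_hom R (?F n) (?F n)" for n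
    by (rule module_hom_sub[OF mm mm \<kappa>h module_hom_id])
  have ex0: "\<exists>h. P 0 h"
  proof -
    interpret M: module R M by (rule M)
    have "\<kappa> 0 (basis_vec R i) \<ominus>\<^bsub>?F 0\<^esub> basis_vec R i \<in> d 0 ` carrier (?F (Suc 0))" if "i \<in> B 0" for i
    proof -
      have b: "basis_vec R i \<in> carrier (?F 0)" using that by (rule basis_vec_closed)
      have "\<epsilon> (\<kappa> 0 (basis_vec R i) \<ominus>\<^bsub>?F 0\<^esub> basis_vec R i) = \<epsilon> (\<kappa> 0 (basis_vec R i)) \<ominus>\<^bsub>M\<^esub> \<epsilon> (basis_vec R i)"
        by (rule module_hom_minus[OF mm M r(1) module_homD(1)[OF \<kappa>h b] b])
      also have "\<dots> = \<zero>\<^bsub>M\<^esub>"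
        using \<kappa>0[OF b] module_homD(1)[OF r(1) b] by (simp add: M.minus_eq M.r_neg)
      finally show ?thesis unfolding r(4) using module_homD(1)[OF tid b] by (simp add: cycles_def)
    qed
    from free_module_lift[OF mm mm tid r(2) this]
    obtain h where h: "h \<in> module_hom R (?F 0) (?F (Suc 0))"
      "\<And>z. z \<in> carrier (?F 0) \<Longrightarrow> d 0 (h z) = \<kappa> 0 z \<ominus>\<^bsub>?F 0\<^esub> z" by blast
    then have "P 0 h" unfolding P_def using cycles_subset by blast
    then show ?thesis by blast
  qed
  have step: "\<exists>h'. P (Suc n) h' \<and> Q n h h'" if h: "P n h" for n h
  proof -
    interpret F: module R "?F (Suc n)" by (rule mm)
    interpret F0: module R "?F n" by (rule mm)
    have hh: "h \<in> module_hom R (?F n) (?F (Suc n))"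
      and hc: "\<And>x. x \<in> cycles M B d \<epsilon> n \<Longrightarrow> d n (h x) = \<kappa> n x \<ominus>\<^bsub>?F n\<^esub> x"
      using h by (auto simp: P_def)
    have t: "(\<lambda>x. \<kappa> (Suc n) x \<ominus>\<^bsub>?F (Suc n)\<^esub> x \<ominus>\<^bsub>?F (Suc n)\<^esub> h (d n x)) \<in> module_hom R (?F (Suc n)) (?F (Suc n))"
      by (rule module_hom_sub[OF mm mm tid module_hom_comp[OF r(2) hh]])
    have im: "\<kappa> (Suc n) (basis_vec R i) \<ominus>\<^bsub>?F (Suc n)\<^esub> basis_vec R i \<ominus>\<^bsub>?F (Suc n)\<^esub> h (d n (basis_vec R i))
        \<in> d (Suc n) ` carrier (?F (Suc (Suc n)))" if "i \<in> B (Suc n)" for i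
    proof -
      let ?b = "basis_vec R i"
      have b: "?b \<in> carrier (?F (Suc n))" using that by (rule basis_vec_closed)
      note c1 = module_homD(1)[OF \<kappa>h b] and c2 = module_homD(1)[OF hh module_homD(1)[OF r(2) b]]
        and c3 = module_homD(1)[OF tid b] and c4 = module_homD(1)[OF \<kappa>h module_homD(1)[OF r(2) b]]
        and c5 = module_homD(1)[OF r(2) b]
      have "d n (\<kappa> (Suc n) ?b \<ominus>\<^bsub>?F (Suc n)\<^esub> ?b \<ominus>\<^bsub>?F (Suc n)\<^esub> h (d n ?b))
          = (\<kappa> n (d n ?b) \<ominus>\<^bsub>?F n\<^esub> d n ?b) \<ominus>\<^bsub>?F n\<^esub> (\<kappa> n (d n ?b) \<ominus>\<^bsub>?F n\<^esub> d n ?b)"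
        by (simp add: module_hom_minus[OF mm mm r(2) c3 c2] module_hom_minus[OF mm mm r(2) c1 b]
            \<kappa>d[OF b] hc[OF boundary_cycle[OF res b]])
      also have "\<dots> = \<zero>\<^bsub>?F n\<^esub>"
        using c4 c5 by (simp add: F0.minus_eq F0.r_neg)
      finally show ?thesis unfolding r(4) using module_homD(1)[OF t b] by (simp add: cycles_def)
    qed
    obtain h' where h': "h' \<in> module_hom R (?F (Suc n)) (?F (Suc (Suc n)))"
      "\<And>z. z \<in> carrier (?F (Suc n)) \<Longrightarrow>
        d (Suc n) (h' z) = \<kappa> (Suc n) z \<ominus>\<^bsub>?F (Suc n)\<^esub> z \<ominus>\<^bsub>?F (Suc n)\<^esub> h (d n z)"
      using free_module_lift[OF mm mm t r(2) im] by blast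
    have "h \<zero>\<^bsub>?F n\<^esub> = \<zero>\<^bsub>?F (Suc n)\<^esub>" by (rule module_hom_zero[OF mm mm hh])
    then have "P (Suc n) h'"
      unfolding P_def using h' module_homD(1)[OF tid]
      by (auto simp: cycles_def F.minus_eq[of _ "\<zero>\<^bsub>?F (Suc n)\<^esub>"])
    then show ?thesis using h'(2) unfolding Q_def by blast
  qed
  obtain h where h: "\<And>n. P n (h n)" "\<And>n. Q n (h n) (h (Suc n))"
    using dependent_nat_choice[of P Q, OF ex0 step] by blast
  show thesis by (rule that[of h]) (use h in \<open>auto simp: P_def Q_def\<close>)
qed

end

section \<open>Ranks\<close>

text \<open>Modulo \<open>p\<close>, the values of \<Theta> on a group with \<open>r\<close>
  generators are combinations of \<open>r\<close> vectors with coefficients in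
  \<open>0, ..., p - 1\<close>. There are at most \<open>p ^ r\<close> of these, while surjectivity
  asks for \<open>p ^ card W\<close>. The hypothesis \<open>fg\<close> turns the
  \<open>LEAST\<close> in \<open>group_rank\<close> into an attained minimum.\<close>

lemma group_rank_ge:
  fixes \<Theta> :: "'q \<Rightarrow> 'w \<Rightarrow> int" and p :: int
  assumes Q: "group Q" and p: "p > 1" and W: "finite W"
    and fg: "\<exists>S. S \<subseteq> carrier Q \<and> finite S \<and> generate Q S = carrier Q"
    and hom: "\<And>x y w. x \<in> carrier Q \<Longrightarrow> y \<in> carrier Q \<Longrightarrow> w \<in> W \<Longrightarrow> [\<Theta> (x \<otimes>\<^bsub>Q\<^esub> y) w = \<Theta> x w + \<Theta> y w] (mod p)"
    and surj: "\<And>t. \<exists>x\<in>carrier Q. \<forall>w\<in>W. [\<Theta> x w = t w] (mod p)"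
  shows "card W \<le> group_rank Q"
proof -
  interpret Q: group Q by (rule Q)
  have "\<exists>n S. S \<subseteq> carrier Q \<and> finite S \<and> card S = n \<and> generate Q S = carrier Q"
    using fg by blast
  from LeastI_ex[OF this] obtain S where S: "S \<subseteq> carrier Q" "finite S" "card S = group_rank Q"
    "generate Q S = carrier Q"
    unfolding group_rank_def by blast
  have one: "[\<Theta> \<one>\<^bsub>Q\<^esub> w = 0] (mod p)" if "w \<in> W" for w
    using hom[of "\<one>\<^bsub>Q\<^esub>" "\<one>\<^bsub>Q\<^esub>" w] that by (simp add: cong_iff_dvd_diff)
  have inv: "[\<Theta> (inv\<^bsub>Q\<^esub> s) w = - \<Theta> s w] (mod p)" if "w \<in> W" "s \<in> carrier Q" for w s
    using hom[of "inv\<^bsub>Q\<^esub> s" s w] one[of w] that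
    by (metis (no_types, opaque_lifting) Q.inv_closed Q.l_inv add_eq_0_iff add.commute
        cong_add_rcancel cong_sym cong_trans)
  define \<Phi> where "\<Phi> = (\<lambda>k :: 'q \<Rightarrow> int. \<lambda>w\<in>W. (\<Sum>s\<in>S. k s * \<Theta> s w) mod p)"
  have comb: "\<exists>k. \<forall>w\<in>W. [\<Theta> x w = (\<Sum>s\<in>S. k s * \<Theta> s w)] (mod p)" if "x \<in> generate Q S" for x
    using that
  proof (induction rule: generate.induct)
    case one
    show ?case using \<open>\<And>w. w \<in> W \<Longrightarrow> [\<Theta> \<one>\<^bsub>Q\<^esub> w = 0] (mod p)\<close> by (intro exI[of _ "\<lambda>_. 0"]) auto
  next
    case (incl h)
    have "(\<Sum>s\<in>S. (if s = h then 1 else 0) * \<Theta> s w) = \<Theta> h w" for w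
      using incl S(2) by (simp add: if_distrib[of "\<lambda>c. c * _"] cong: if_cong)
    then show ?case by (intro exI[of _ "\<lambda>s. if s = h then 1 else 0"]) auto
  next
    case (inv h)
    have "(\<Sum>s\<in>S. (if s = h then - 1 else 0) * \<Theta> s w) = - \<Theta> h w" for w
      using inv S(2) by (simp add: if_distrib[of "\<lambda>c. c * _"] cong: if_cong)
    then show ?case using \<open>\<And>w s. w \<in> W \<Longrightarrow> s \<in> carrier Q \<Longrightarrow> [\<Theta> (inv\<^bsub>Q\<^esub> s) w = - \<Theta> s w] (mod p)\<close> inv S(1)
      by (intro exI[of _ "\<lambda>s. if s = h then - 1 else 0"]) auto
  next
    case (eng x y)
    then obtain k l where kl: "\<forall>w\<in>W. [\<Theta> x w = (\<Sum>s\<in>S. k s * \<Theta> s w)] (mod p)"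
      "\<forall>w\<in>W. [\<Theta> y w = (\<Sum>s\<in>S. l s * \<Theta> s w)] (mod p)" by blast
    have xy: "x \<in> carrier Q" "y \<in> carrier Q" using eng S(4) by auto
    have "[\<Theta> (x \<otimes>\<^bsub>Q\<^esub> y) w = (\<Sum>s\<in>S. (k s + l s) * \<Theta> s w)] (mod p)" if "w \<in> W" for w
      using cong_trans[OF hom[OF xy that] cong_add[OF kl(1)[rule_format, OF that] kl(2)[rule_format, OF that]]]
      by (simp add: distrib_right sum.distrib)
    then show ?case by (intro exI[of _ "\<lambda>s. k s + l s"]) auto
  qed
  have sub: "W \<rightarrow>\<^sub>E {0..<p} \<subseteq> \<Phi> ` (S \<rightarrow>\<^sub>E {0..<p})"
  proof
    fix t assume t: "t \<in> W \<rightarrow>\<^sub>E {0..<p}"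
    obtain x where x: "x \<in> carrier Q" "\<And>w. w \<in> W \<Longrightarrow> [\<Theta> x w = t w] (mod p)"
      using surj[of t] by blast
    then obtain k where k: "\<And>w. w \<in> W \<Longrightarrow> [\<Theta> x w = (\<Sum>s\<in>S. k s * \<Theta> s w)] (mod p)"
      using comb S(4) by blast
    let ?k = "\<lambda>s\<in>S. k s mod p"
    have "[(\<Sum>s\<in>S. ?k s * \<Theta> s w) = (\<Sum>s\<in>S. k s * \<Theta> s w)] (mod p)" for w
      by (rule cong_sum) (auto intro!: cong_mult)
    then have "(\<Sum>s\<in>S. ?k s * \<Theta> s w) mod p = t w" if "w \<in> W" for w
      using cong_trans[OF cong_sym[OF x(2)[OF that]] k[OF that]] t that
      by (auto simp: cong_def PiE_iff)
    then have "t = \<Phi> ?k" using t unfolding \<Phi>_def by (auto simp: fun_eq_iff PiE_iff extensional_def)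
    moreover have "?k \<in> S \<rightarrow>\<^sub>E {0..<p}" using p by auto
    ultimately show "t \<in> \<Phi> ` (S \<rightarrow>\<^sub>E {0..<p})" by blast
  qed
  have "card (W \<rightarrow>\<^sub>E {0..<p}) \<le> card (S \<rightarrow>\<^sub>E {0..<p})"
    by (rule surj_card_le[OF finite_PiE[OF S(2)] sub]) simp
  then have "nat p ^ card W \<le> nat p ^ group_rank Q"
    using S(2,3) W by (simp add: card_PiE)
  then show ?thesis using p by (simp add: power_le_imp_le_exp)
qed

section \<open>Cohomology of a free resolution with integral coefficients\<close>

text \<open>Coefficients whose additive group is literally the integers, as for every mark module:
  cochains are then integer-valued functions, to which congruences modulo \<open>p\<close>
  apply.\<close>

locale integral_cochains = cring R for R :: "('a, 'b) ring_scheme" (structure) +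
  fixes N :: "('a, int, 'q) module_scheme"
  assumes N: "module R N" and N_simps: "carrier N = UNIV" "add N = (+)" "zero N = 0"
begin

text \<open>In contrast to the elements of \<open>Hom_group\<close>, cochains need not be
  extensional. Sums and composites with chain maps then require no restriction;
  \<open>cochains_restrict\<close> passes between the two forms.\<close>

definition cochains :: "(nat \<Rightarrow> 'i set) \<Rightarrow> nat \<Rightarrow> (('i \<Rightarrow> 'a) \<Rightarrow> int) set" where
  "cochains B n = module_hom R (free_module R (B n)) N"

definition cocycles :: "(nat \<Rightarrow> 'i set) \<Rightarrow> (nat \<Rightarrow> ('i \<Rightarrow> 'a) \<Rightarrow> ('i \<Rightarrow> 'a)) \<Rightarrow> nat \<Rightarrow> (('i \<Rightarrow> 'a) \<Rightarrow> int) set" where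
  "cocycles B d n = {f \<in> cochains B n. \<forall>x\<in>carrier (free_module R (B (Suc n))). f (d n x) = 0}"

lemma smult_add_N: "a \<in> carrier R \<Longrightarrow> a \<odot>\<^bsub>N\<^esub> (x + y) = a \<odot>\<^bsub>N\<^esub> x + a \<odot>\<^bsub>N\<^esub> y"
  using module.smult_r_distr[OF N, of a x y] by (simp add: N_simps)

lemma smult_zero_N: "a \<in> carrier R \<Longrightarrow> a \<odot>\<^bsub>N\<^esub> 0 = 0"
  using module.smult_r_null[OF N, of a] by (simp add: N_simps)

lemma smult_uminus_N: "a \<in> carrier R \<Longrightarrow> a \<odot>\<^bsub>N\<^esub> (- x) = - (a \<odot>\<^bsub>N\<^esub> x)"
  using smult_add_N[of a x "- x"] smult_zero_N[of a] by simp

lemma cochains_iff: "f \<in> cochains B n \<longleftrightarrow>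
   (\<forall>x\<in>carrier (free_module R (B n)). \<forall>y\<in>carrier (free_module R (B n)).
      f (x \<oplus>\<^bsub>free_module R (B n)\<^esub> y) = f x + f y) \<and>
   (\<forall>a\<in>carrier R. \<forall>x\<in>carrier (free_module R (B n)). f (a \<odot>\<^bsub>free_module R (B n)\<^esub> x) = a \<odot>\<^bsub>N\<^esub> f x)"
  by (auto simp: cochains_def module_hom_def N_simps)

lemma cochains_restrict:
  "(\<lambda>x\<in>carrier (free_module R (B n)). f x) \<in> cochains B n \<longleftrightarrow> f \<in> cochains B n"
proof -
  interpret F: module R "free_module R (B n)" by (rule free_module_module)
  show ?thesis by (auto simp: cochains_iff)
qed

lemma cocycles_restrict:
  assumes "d n \<in> module_hom R (free_module R (B (Suc n))) (free_module R (B n))"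
  shows "(\<lambda>x\<in>carrier (free_module R (B n)). f x) \<in> cocycles B d n \<longleftrightarrow> f \<in> cocycles B d n"
  using module_homD(1)[OF assms] by (simp add: cocycles_def cochains_restrict)

lemma cochains_add: "f \<in> cochains B n \<Longrightarrow> g \<in> cochains B n \<Longrightarrow> (\<lambda>x. f x + g x) \<in> cochains B n"
  by (auto simp: cochains_iff smult_add_N)

lemma cochains_uminus: "f \<in> cochains B n \<Longrightarrow> (\<lambda>x. - f x) \<in> cochains B n"
  by (auto simp: cochains_iff smult_uminus_N)

lemma cochains_zero: "(\<lambda>x. 0) \<in> cochains B n"
  by (auto simp: cochains_iff smult_zero_N)

lemma cocycles_add: "f \<in> cocycles B d n \<Longrightarrow> g \<in> cocycles B d n \<Longrightarrow> (\<lambda>x. f x + g x) \<in> cocycles B d n"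
  by (auto simp: cocycles_def cochains_add)

lemma cocycles_uminus: "f \<in> cocycles B d n \<Longrightarrow> (\<lambda>x. - f x) \<in> cocycles B d n"
  by (auto simp: cocycles_def cochains_uminus)

lemma cocycles_zero: "(\<lambda>x. 0) \<in> cocycles B d n"
  by (auto simp: cocycles_def cochains_zero)

lemma cocycles_smult: "f \<in> cocycles B d n \<Longrightarrow> (\<lambda>x. (c :: int) * f x) \<in> cocycles B d n"
proof (induction c rule: int_induct[where k = 0])
  case (step1 i)
  then show ?case using cocycles_add[of "\<lambda>x. i * f x" B d n f] by (simp add: algebra_simps)
next
  case (step2 i)
  then show ?case using cocycles_add[of "\<lambda>x. i * f x" B d n "\<lambda>x. - f x"] cocycles_uminus[of f]
    by (simp add: algebra_simps)
qed (simp add: cocycles_zero)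

lemma cocycles_sum: "(\<And>i. i \<in> I \<Longrightarrow> f i \<in> cocycles B d n) \<Longrightarrow> (\<lambda>x. \<Sum>i\<in>I. f i x) \<in> cocycles B d n"
  by (induction I rule: infinite_finite_induct) (simp_all add: cocycles_zero cocycles_add)

lemma Hom_group_carrier: "carrier (Hom_group R (free_module R (B n)) N) = cochains B n \<inter> extensional (carrier (free_module R (B n)))"
  by (simp add: Hom_group_def cochains_def)

lemma Hom_group_simps:
  "f \<otimes>\<^bsub>Hom_group R (free_module R (B n)) N\<^esub> g = (\<lambda>x\<in>carrier (free_module R (B n)). f x + g x)"
  "\<one>\<^bsub>Hom_group R (free_module R (B n)) N\<^esub> = (\<lambda>x\<in>carrier (free_module R (B n)). 0)"
  by (simp_all add: Hom_group_def N_simps)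

lemma Hom_group_comm_group:
  fixes B :: "nat \<Rightarrow> 'i set"
  shows "comm_group (Hom_group R (free_module R (B n)) N)"
proof (rule comm_groupI)
  fix x assume x: "x \<in> carrier (Hom_group R (free_module R (B n)) N)"
  show "\<exists>y\<in>carrier (Hom_group R (free_module R (B n)) N).
     y \<otimes>\<^bsub>Hom_group R (free_module R (B n)) N\<^esub> x = \<one>\<^bsub>Hom_group R (free_module R (B n)) N\<^esub>"
  proof (rule bexI)
    show "(\<lambda>z\<in>carrier (free_module R (B n)). - x z) \<in> carrier (Hom_group R (free_module R (B n)) N)"
      using x unfolding Hom_group_carrier by (simp add: cochains_restrict cochains_uminus)
  qed (simp add: Hom_group_simps cong: restrict_cong)
qed (auto simp: Hom_group_carrier Hom_group_simps cochains_restrict cochains_add cochains_zero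
      extensional_def fun_eq_iff)

text \<open>The rank bound on the level of cocycles: \<open>u\<close> and \<open>gen\<close> provide
  the finite generation, and \<Theta> descends to cohomology modulo \<open>p\<close> because its
  values on coboundaries are divisible by \<open>p\<close>.\<close>

theorem Hom_cohomology_rank_ge:
  fixes \<Theta> :: "(('i \<Rightarrow> 'a) \<Rightarrow> int) \<Rightarrow> 'w \<Rightarrow> int" and p :: int
  assumes d: "\<And>n. d n \<in> module_hom R (free_module R (B (Suc n))) (free_module R (B n))"
    and dd: "\<And>n x. x \<in> carrier (free_module R (B (Suc (Suc n)))) \<Longrightarrow> d n (d (Suc n) x) = \<zero>\<^bsub>free_module R (B n)\<^esub>"
    and p: "p > 1" and W: "finite W"
    and u: "\<And>i. i < r \<Longrightarrow> u i \<in> cocycles B d (Suc k)"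
    and gen: "\<And>f. f \<in> cocycles B d (Suc k) \<Longrightarrow> \<exists>c :: nat \<Rightarrow> int. \<exists>g\<in>cochains B k.
      \<forall>x\<in>carrier (free_module R (B (Suc k))). f x = (\<Sum>i<r. c i * u i x) + g (d k x)"
    and \<Theta>_cong: "\<And>f g w. \<forall>x\<in>carrier (free_module R (B (Suc k))). f x = g x \<Longrightarrow> w \<in> W \<Longrightarrow> \<Theta> f w = \<Theta> g w"
    and \<Theta>_add: "\<And>f g w. f \<in> cocycles B d (Suc k) \<Longrightarrow> g \<in> cocycles B d (Suc k) \<Longrightarrow> w \<in> W \<Longrightarrow>
      \<Theta> (\<lambda>x. f x + g x) w = \<Theta> f w + \<Theta> g w"
    and \<Theta>_bd: "\<And>g w. g \<in> cochains B k \<Longrightarrow> w \<in> W \<Longrightarrow> p dvd \<Theta> (\<lambda>x. g (d k x)) w"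
    and surj: "\<And>t. \<exists>f\<in>cocycles B d (Suc k). \<forall>w\<in>W. [\<Theta> f w = t w] (mod p)"
  shows "card W \<le> group_rank (Hom_cohomology R B d N (Suc k))"
proof -
  let ?F = "\<lambda>n. carrier (free_module R (B n))"
  let ?C = "\<lambda>n. Hom_group R (free_module R (B n)) N"
  interpret C: comm_group "?C n" for n by (rule Hom_group_comm_group)
  have cr: "restrict f (?F n) \<in> cocycles B d n \<longleftrightarrow> f \<in> cocycles B d n" for f n
    by (rule cocycles_restrict) (rule d)
  define Z where "Z = cocycles B d (Suc k) \<inter> extensional (?F (Suc k))"
  define K where "K = (?C (Suc k))\<lparr>carrier := Z\<rparr>"
  define Bd where "Bd = (\<lambda>g. compose (?F (Suc k)) g (d k)) ` carrier (?C k)"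
  have ker: "kernel (?C (Suc k)) (?C (Suc (Suc k))) (\<lambda>f. compose (?F (Suc (Suc k))) f (d (Suc k))) = Z"
    unfolding kernel_def Hom_group_carrier Hom_group_simps Z_def cocycles_def compose_def
    by (auto simp: fun_eq_iff restrict_def split: if_splits)
  have coh: "Hom_cohomology R B d N (Suc k) = K Mod Bd"
    unfolding Hom_cohomology_def cohomology_def K_def Bd_def by (simp add: ker)
  have dF: "d n x \<in> ?F n" if "x \<in> ?F (Suc n)" for n x using module_homD(1)[OF d that] .
  have bd_cocycle: "(\<lambda>x. g (d k x)) \<in> cocycles B d (Suc k)" if g: "g \<in> cochains B k" for g
  proof -
    have "(\<lambda>x. g (d k x)) \<in> cochains B (Suc k)"
      using module_hom_comp[OF d, of g k N] g unfolding cochains_def by simp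
    moreover have "g \<zero>\<^bsub>free_module R (B k)\<^esub> = 0"
      using module_hom_zero[OF free_module_module N] g by (simp add: cochains_def N_simps)
    ultimately show ?thesis using dd by (simp add: cocycles_def)
  qed
  have Zsub: "subgroup Z (?C (Suc k))"
  proof (rule C.subgroupI)
    show "Z \<subseteq> carrier (?C (Suc k))" by (auto simp: Z_def cocycles_def Hom_group_carrier)
    show "Z \<noteq> {}" using cr[of "\<lambda>x. 0"] cocycles_zero by (force simp: Z_def)
    show "a \<otimes>\<^bsub>?C (Suc k)\<^esub> b \<in> Z" if "a \<in> Z" "b \<in> Z" for a b
      using that by (simp add: Z_def Hom_group_simps cr cocycles_add)
    fix a assume a: "a \<in> Z"
    have "inv\<^bsub>?C (Suc k)\<^esub> a = (\<lambda>x\<in>?F (Suc k). - a x)"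
      by (rule C.inv_equality) (use a in \<open>auto simp: Z_def cocycles_def Hom_group_simps Hom_group_carrier
          cochains_restrict cochains_uminus\<close>)
    then show "inv\<^bsub>?C (Suc k)\<^esub> a \<in> Z"
      using a by (simp add: Z_def cr cocycles_uminus)
  qed
  have Kcomm: "comm_group K"
  proof -
    interpret K: group K unfolding K_def by (rule C.subgroup_imp_group[OF Zsub])
    show ?thesis
      by (rule K.group_comm_groupI) (auto simp: K_def Hom_group_simps add.commute)
  qed
  interpret K: comm_group K by (rule Kcomm)
  have Kc: "carrier K = Z" by (simp add: K_def)
  have Km: "f \<otimes>\<^bsub>K\<^esub> g = (\<lambda>x\<in>?F (Suc k). f x + g x)" for f g by (simp add: K_def Hom_group_simps)
  have K1: "\<one>\<^bsub>K\<^esub> = (\<lambda>x\<in>?F (Suc k). 0)" by (simp add: K_def Hom_group_simps)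
  have Kinv: "inv\<^bsub>K\<^esub> f = (\<lambda>x\<in>?F (Suc k). - f x)" if "f \<in> Z" for f
    by (rule K.inv_equality) (use that in \<open>auto simp: Kc Km K1 Z_def cr cocycles_uminus\<close>)
  have Bd_iff: "f \<in> Bd \<longleftrightarrow> (\<exists>g\<in>cochains B k. f = (\<lambda>x\<in>?F (Suc k). g (d k x)))" for f
  proof
    assume "f \<in> Bd"
    then show "\<exists>g\<in>cochains B k. f = (\<lambda>x\<in>?F (Suc k). g (d k x))"
      by (auto simp: Bd_def Hom_group_carrier compose_def)
  next
    assume "\<exists>g\<in>cochains B k. f = (\<lambda>x\<in>?F (Suc k). g (d k x))"
    then obtain g where g: "g \<in> cochains B k" "f = (\<lambda>x\<in>?F (Suc k). g (d k x))" by blast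
    have "(\<lambda>x\<in>?F k. g x) \<in> carrier (?C k)" using g(1) by (simp add: Hom_group_carrier cochains_restrict)
    moreover have "f = compose (?F (Suc k)) (\<lambda>x\<in>?F k. g x) (d k)"
      unfolding g(2) compose_def using dF by (auto simp: fun_eq_iff)
    ultimately show "f \<in> Bd" unfolding Bd_def by blast
  qed
  have Bd_sub: "subgroup Bd K"
  proof (rule K.subgroupI)
    show Bd_Z: "Bd \<subseteq> carrier K"
      using bd_cocycle by (auto simp: Kc Z_def Bd_iff cr)
    show "Bd \<noteq> {}" using cochains_zero[of B k] Bd_iff by blast
    show "a \<otimes>\<^bsub>K\<^esub> b \<in> Bd" if "a \<in> Bd" "b \<in> Bd" for a b
      using that cochains_add unfolding Bd_iff Km by (fastforce simp: fun_eq_iff)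
    show "inv\<^bsub>K\<^esub> a \<in> Bd" if a: "a \<in> Bd" for a
    proof -
      have "a \<in> Z" using a Bd_Z Kc by blast
      then show ?thesis
        using a cochains_uminus unfolding Bd_iff Kinv[OF \<open>a \<in> Z\<close>] by (fastforce simp: fun_eq_iff)
    qed
  qed
  have normal: "Bd \<lhd> K" by (rule K.subgroup_imp_normal[OF Bd_sub])
  interpret Bd: normal Bd K by (rule normal)
  define Q where "Q = K Mod Bd"
  have Qg: "group Q" unfolding Q_def by (rule Bd.factorgroup_is_group)
  interpret Q: group Q by (rule Qg)
  \<comment> \<open>The class of an arbitrary cocycle, which is first cut down to an extensional
    function; sums of cocycles become products in \<open>Q\<close>, and coboundaries become
    trivial.\<close>
  define q where "q = (\<lambda>f. Bd #>\<^bsub>K\<^esub> (\<lambda>x\<in>?F (Suc k). f x))"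
  have rZ: "(\<lambda>x\<in>?F (Suc k). f x) \<in> Z" if "f \<in> cocycles B d (Suc k)" for f
    using that by (simp add: Z_def cr)
  have Qc: "carrier Q = q ` cocycles B d (Suc k)"
  proof
    show "carrier Q \<subseteq> q ` cocycles B d (Suc k)"
    proof
      fix X assume "X \<in> carrier Q"
      then obtain z where z: "z \<in> Z" "X = Bd #>\<^bsub>K\<^esub> z"
        by (auto simp: Q_def FactGroup_def RCOSETS_def Kc)
      then have "(\<lambda>x\<in>?F (Suc k). z x) = z" by (auto simp: Z_def extensional_def fun_eq_iff)
      then show "X \<in> q ` cocycles B d (Suc k)"
        using z by (intro image_eqI[of _ _ z]) (simp_all add: q_def Z_def)
    qed
    show "q ` cocycles B d (Suc k) \<subseteq> carrier Q"
      using rZ by (auto simp: Q_def FactGroup_def RCOSETS_def Kc q_def)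
  qed
  have qadd: "q (\<lambda>x. f x + g x) = q f \<otimes>\<^bsub>Q\<^esub> q g"
    if "f \<in> cocycles B d (Suc k)" "g \<in> cocycles B d (Suc k)" for f g
  proof -
    have "q f \<otimes>\<^bsub>Q\<^esub> q g = Bd #>\<^bsub>K\<^esub> ((\<lambda>x\<in>?F (Suc k). f x) \<otimes>\<^bsub>K\<^esub> (\<lambda>x\<in>?F (Suc k). g x))"
      unfolding Q_def q_def using rZ that by (simp add: FactGroup_def Bd.rcos_sum Kc)
    then show ?thesis unfolding q_def Km by (simp cong: restrict_cong)
  qed
  have qbd: "q (\<lambda>x. g (d k x)) = \<one>\<^bsub>Q\<^esub>" if "g \<in> cochains B k" for g
    unfolding q_def Q_def one_FactGroup
    by (rule K.coset_join2[OF _ Bd_sub])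
      (use that bd_cocycle rZ Bd_iff in \<open>auto simp: Kc\<close>)
  have q_cong: "q f = q g" if "\<forall>x\<in>?F (Suc k). f x = g x" for f g
    using that unfolding q_def by (metis (no_types, lifting) restrict_ext)
  have fg: "\<exists>S. S \<subseteq> carrier Q \<and> finite S \<and> generate Q S = carrier Q"
  proof (intro exI conjI)
    let ?S = "(\<lambda>i. q (u i)) ` {..<r}"
    show S: "?S \<subseteq> carrier Q" using u Qc by auto
    show "finite ?S" by simp
    have sm: "q (\<lambda>x. c * f x) \<in> generate Q ?S" if "f \<in> cocycles B d (Suc k)" "q f \<in> generate Q ?S" for f and c :: int
    proof (induction c rule: int_induct[where k = 0])
      case base
      have "q (\<lambda>x. 0) = \<one>\<^bsub>Q\<^esub>" using qbd[OF cochains_zero] .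
      then show ?case using generate.one by simp
    next
      case (step1 i)
      have "q (\<lambda>x. (i + 1) * f x) = q (\<lambda>x. i * f x) \<otimes>\<^bsub>Q\<^esub> q f"
        using qadd[OF cocycles_smult[OF that(1), of i] that(1)] by (simp add: algebra_simps)
      then show ?case using step1 that generate.eng by metis
    next
      case (step2 i)
      have "q (\<lambda>x. i * f x) = q (\<lambda>x. (i - 1) * f x) \<otimes>\<^bsub>Q\<^esub> q f"
        using qadd[OF cocycles_smult[OF that(1), of "i - 1"] that(1)] by (simp add: algebra_simps)
      then have "q (\<lambda>x. (i - 1) * f x) = q (\<lambda>x. i * f x) \<otimes>\<^bsub>Q\<^esub> inv\<^bsub>Q\<^esub> (q f)"
      proof -
        have "q f \<in> carrier Q" "q (\<lambda>x. (i - 1) * f x) \<in> carrier Q"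
          using Qc cocycles_smult[OF that(1), of "i - 1"] that(1) by simp_all
        then show ?thesis using \<open>q (\<lambda>x. i * f x) = _\<close> by (simp add: Q.m_assoc)
      qed
      then show ?case using step2 that generate.eng Q.generate_m_inv_closed[OF S] by metis
    qed
    have ps: "q (\<lambda>x. \<Sum>i<j. c i * u i x) \<in> generate Q ?S" if "j \<le> r" for j and c :: "nat \<Rightarrow> int"
      using that
    proof (induction j)
      case 0
      have "q (\<lambda>x. 0) = \<one>\<^bsub>Q\<^esub>" using qbd[OF cochains_zero] .
      then show ?case using generate.one by simp
    next
      case (Suc j)
      have "q (\<lambda>x. \<Sum>i<Suc j. c i * u i x) = q (\<lambda>x. \<Sum>i<j. c i * u i x) \<otimes>\<^bsub>Q\<^esub> q (\<lambda>x. c j * u j x)"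
        using qadd[OF cocycles_sum[of "{..<j}" "\<lambda>i x. c i * u i x"] cocycles_smult[OF u, of j "c j"]]
          cocycles_smult[OF u] Suc(2) by simp
      moreover have "q (u j) \<in> generate Q ?S" using Suc(2) by (auto intro: generate.incl)
      ultimately show ?case using Suc sm[OF u[of j]] generate.eng[of _ Q] by simp
    qed
    show "generate Q ?S = carrier Q"
    proof
      show "generate Q ?S \<subseteq> carrier Q" by (rule Q.generate_incl[OF S])
      show "carrier Q \<subseteq> generate Q ?S"
      proof
        fix X assume "X \<in> carrier Q"
        then obtain f where f: "f \<in> cocycles B d (Suc k)" "X = q f" using Qc by auto
        obtain c :: "nat \<Rightarrow> int" and g where g: "g \<in> cochains B k"
          "\<forall>x\<in>?F (Suc k). f x = (\<Sum>i<r. c i * u i x) + g (d k x)" using gen[OF f(1)] by blast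
        have s: "(\<lambda>x. \<Sum>i<r. c i * u i x) \<in> cocycles B d (Suc k)"
          by (rule cocycles_sum, rule cocycles_smult, rule u) simp
        have "X = q (\<lambda>x. \<Sum>i<r. c i * u i x) \<otimes>\<^bsub>Q\<^esub> q (\<lambda>x. g (d k x))"
          unfolding f(2) q_cong[OF g(2)] by (rule qadd[OF s bd_cocycle[OF g(1)]])
        also have "\<dots> = q (\<lambda>x. \<Sum>i<r. c i * u i x)"
          using Qc s by (simp add: qbd[OF g(1)])
        finally show "X \<in> generate Q ?S" using ps[of r c] by simp
      qed
    qed
  qed
  \<comment> \<open>The representative is arbitrary. Two choices differ by a coboundary, so the
    value is determined only modulo \<open>p\<close>, which is all that \<open>group_rank_ge\<close>
    asks for.\<close>
  define \<Theta>' where "\<Theta>' = (\<lambda>X. \<Theta> (SOME f. f \<in> cocycles B d (Suc k) \<and> q f = X))"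
  have \<Theta>': "[\<Theta>' (q f) w = \<Theta> f w] (mod p)" if f: "f \<in> cocycles B d (Suc k)" and w: "w \<in> W" for f w
  proof -
    have "\<exists>g. g \<in> cocycles B d (Suc k) \<and> q g = q f" using f by blast
    from someI_ex[OF this] obtain g where g: "g \<in> cocycles B d (Suc k)" "q g = q f" "\<Theta>' (q f) = \<Theta> g"
      unfolding \<Theta>'_def by blast
    have "(\<lambda>x\<in>?F (Suc k). g x) \<in> Bd #>\<^bsub>K\<^esub> (\<lambda>x\<in>?F (Suc k). f x)"
      using K.rcos_self[OF _ Bd_sub, of "restrict g (?F (Suc k))"] rZ[OF g(1)] g(2) by (simp add: q_def Kc)
    then obtain h where h: "h \<in> cochains B k"
      "(\<lambda>x\<in>?F (Suc k). g x) = (\<lambda>x\<in>?F (Suc k). h (d k x)) \<otimes>\<^bsub>K\<^esub> (\<lambda>x\<in>?F (Suc k). f x)"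
      using Bd_iff by (auto simp: r_coset_def)
    have "g x = h (d k x) + f x" if "x \<in> ?F (Suc k)" for x
      using fun_cong[OF h(2), of x] that by (simp add: Km)
    then have "\<forall>x\<in>?F (Suc k). g x = h (d k x) + f x" by blast
    then have "\<Theta> g w = \<Theta> (\<lambda>x. h (d k x) + f x) w" by (rule \<Theta>_cong[OF _ w])
    also have "\<dots> = \<Theta> (\<lambda>x. h (d k x)) w + \<Theta> f w" by (rule \<Theta>_add[OF bd_cocycle[OF h(1)] f w])
    finally show ?thesis using \<Theta>_bd[OF h(1) w] g(3) by (simp add: cong_iff_dvd_diff)
  qed
  have "card W \<le> group_rank Q"
  proof (rule group_rank_ge[OF Qg p W fg, of \<Theta>'])
    fix X Y w assume X: "X \<in> carrier Q" and Y: "Y \<in> carrier Q" and w: "w \<in> W"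
    then obtain f g where f: "f \<in> cocycles B d (Suc k)" "X = q f" and g: "g \<in> cocycles B d (Suc k)" "Y = q g"
      using Qc by auto
    have "[\<Theta>' (X \<otimes>\<^bsub>Q\<^esub> Y) w = \<Theta> f w + \<Theta> g w] (mod p)"
      using \<Theta>'[OF cocycles_add[OF f(1) g(1)] w] by (simp add: f(2) g(2) qadd[OF f(1) g(1)] \<Theta>_add[OF f(1) g(1) w])
    then show "[\<Theta>' (X \<otimes>\<^bsub>Q\<^esub> Y) w = \<Theta>' X w + \<Theta>' Y w] (mod p)"
      using cong_add[OF \<Theta>'[OF f(1) w] \<Theta>'[OF g(1) w]] f(2) g(2) cong_sym cong_trans by blast
  next
    fix t :: "'w \<Rightarrow> int"
    obtain f where f: "f \<in> cocycles B d (Suc k)" "\<forall>w\<in>W. [\<Theta> f w = t w] (mod p)" using surj by blast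
    then show "\<exists>x\<in>carrier Q. \<forall>w\<in>W. [\<Theta>' x w = t w] (mod p)"
      using \<Theta>'[OF f(1)] Qc cong_trans by (intro bexI[of _ "q f"]) blast+
  qed
  then show ?thesis unfolding coh Q_def .
qed

section \<open>Passage between two free resolutions\<close>

lemma cochains_comp:
  assumes "f \<in> cochains B n" "\<phi> \<in> module_hom R (free_module R (B' m)) (free_module R (B n))"
  shows "(\<lambda>x. f (\<phi> x)) \<in> cochains B' m"
  using module_hom_comp[OF assms(2), of f N] assms(1) by (simp add: cochains_def)

lemma cochains_zero_val: "f \<in> cochains B n \<Longrightarrow> f \<zero>\<^bsub>free_module R (B n)\<^esub> = 0"
  using module_hom_zero[OF free_module_module N] by (simp add: cochains_def N_simps)

lemma cochains_minus_val:
  assumes "f \<in> cochains B n" "x \<in> carrier (free_module R (B n))" "y \<in> carrier (free_module R (B n))"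
  shows "f (x \<ominus>\<^bsub>free_module R (B n)\<^esub> y) = f x - f y"
proof -
  interpret F: module R "free_module R (B n)" by (rule free_module_module)
  have "f (x \<ominus>\<^bsub>free_module R (B n)\<^esub> y) + f y = f x"
    using assms unfolding cochains_iff F.minus_eq
    by (metis F.a_inv_closed F.add.inv_solve_right' F.add.m_closed)
  then show ?thesis by simp
qed

lemma cocycles_comp:
  assumes "chain_map B d \<epsilon> B' d' \<epsilon>' \<phi>" "f \<in> cocycles B' d' n"
  shows "(\<lambda>x. f (\<phi> n x)) \<in> cocycles B d n"
proof -
  have \<phi>: "\<phi> n \<in> module_hom R (free_module R (B n)) (free_module R (B' n))" for n
    using assms(1) by (simp add: chain_map_def)
  have "f (\<phi> n (d n x)) = 0" if "x \<in> carrier (free_module R (B (Suc n)))" for x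
  proof -
    have "\<phi> n (d n x) = d' n (\<phi> (Suc n) x)" using assms(1) that by (simp add: chain_map_def)
    then show ?thesis using assms(2) module_homD(1)[OF \<phi> that] by (simp add: cocycles_def)
  qed
  then show ?thesis using assms(2) cochains_comp[of f B' n "\<phi> n" B n, OF _ \<phi>] by (simp add: cocycles_def)
qed

text \<open>Apply \<open>f\<close> to the homotopy equation: the term through
  \<open>d (Suc k)\<close> dies because \<open>f\<close> is a cocycle, and \<open>g\<close> is
  \<open>f\<close> composed with \<open>h k\<close>.\<close>

lemma cocycle_homotopic:
  assumes M: "module R M" and res: "free_resolution R M B d \<epsilon>" and \<kappa>: "chain_map B d \<epsilon> B d \<epsilon> \<kappa>"
    and f: "f \<in> cocycles B d (Suc k)"
  obtains g where "g \<in> cochains B k"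
    and "\<And>x. x \<in> carrier (free_module R (B (Suc k))) \<Longrightarrow> f (\<kappa> (Suc k) x) = f x + g (d k x)"
proof -
  obtain h where h: "\<And>n. h n \<in> module_hom R (free_module R (B n)) (free_module R (B (Suc n)))"
    "\<And>n x. x \<in> carrier (free_module R (B (Suc n))) \<Longrightarrow>
      d (Suc n) (h (Suc n) x) = \<kappa> (Suc n) x \<ominus>\<^bsub>free_module R (B (Suc n))\<^esub> x \<ominus>\<^bsub>free_module R (B (Suc n))\<^esub> h n (d n x)"
    using endo_homotopy[OF M res \<kappa>] by blast
  have f': "f \<in> cochains B (Suc k)" using f by (simp add: cocycles_def)
  interpret F: module R "free_module R (B (Suc k))" by (rule free_module_module)
  show thesis
  proof (rule that[of "\<lambda>x. f (h k x)"])
    show "(\<lambda>x. f (h k x)) \<in> cochains B k" by (rule cochains_comp[of f B "Suc k" "h k" B k, OF f' h(1)])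
    fix x assume x: "x \<in> carrier (free_module R (B (Suc k)))"
    have c: "\<kappa> (Suc k) x \<in> carrier (free_module R (B (Suc k)))"
      using \<kappa> x unfolding chain_map_def by (blast dest: module_homD(1))
    have c2: "h k (d k x) \<in> carrier (free_module R (B (Suc k)))"
      using module_homD(1)[OF h(1) module_homD(1)[OF free_resolutionD(2)[OF res] x]] .
    have "f (d (Suc k) (h (Suc k) x)) = 0"
      using f module_homD(1)[OF h(1) x] by (simp add: cocycles_def)
    then show "f (\<kappa> (Suc k) x) = f x + f (h k (d k x))"
      using c c2 x by (simp add: h(2)[OF x] cochains_minus_val[OF f'])
  qed
qed

text \<open>The explicit work happens in the primed resolution, the conclusion concerns the other
  one. Cocycles are moved by composing with \<psi> and evaluated after composing with \<phi>. That
  \<phi> after \<psi> is homotopic to the identity gives finite generation; the same for \<psi>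
  after \<phi> gives surjectivity.\<close>

theorem Hom_cohomology_rank_transfer:
  fixes \<Theta> :: "(('i \<Rightarrow> 'a) \<Rightarrow> int) \<Rightarrow> 'w \<Rightarrow> int" and p :: int
  assumes M: "module R M" and res: "free_resolution R M B d \<epsilon>" and res': "free_resolution R M B' d' \<epsilon>'"
    and p: "p > 1" and W: "finite W"
    and u: "\<And>i. i < r \<Longrightarrow> u i \<in> cocycles B' d' (Suc k)"
    and gen: "\<And>f. f \<in> cocycles B' d' (Suc k) \<Longrightarrow> \<exists>c :: nat \<Rightarrow> int.
      \<forall>x\<in>carrier (free_module R (B' (Suc k))). f x = (\<Sum>i<r. c i * u i x)"
    and \<Theta>_cong: "\<And>f g w. \<forall>x\<in>carrier (free_module R (B' (Suc k))). f x = g x \<Longrightarrow> w \<in> W \<Longrightarrow> \<Theta> f w = \<Theta> g w"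
    and \<Theta>_add: "\<And>f g w. f \<in> cocycles B' d' (Suc k) \<Longrightarrow> g \<in> cocycles B' d' (Suc k) \<Longrightarrow> w \<in> W \<Longrightarrow>
      \<Theta> (\<lambda>x. f x + g x) w = \<Theta> f w + \<Theta> g w"
    and \<Theta>_bd: "\<And>g w. g \<in> cochains B' k \<Longrightarrow> w \<in> W \<Longrightarrow> p dvd \<Theta> (\<lambda>x. g (d' k x)) w"
    and surj: "\<And>t. \<exists>f\<in>cocycles B' d' (Suc k). \<forall>w\<in>W. [\<Theta> f w = t w] (mod p)"
  shows "card W \<le> group_rank (Hom_cohomology R B d N (Suc k))"
proof -
  obtain \<phi> where \<phi>: "chain_map B' d' \<epsilon>' B d \<epsilon> \<phi>" using comparison_exists[OF M res' res] .
  obtain \<psi> where \<psi>: "chain_map B d \<epsilon> B' d' \<epsilon>' \<psi>" using comparison_exists[OF M res res'] .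
  have \<phi>h: "\<phi> n \<in> module_hom R (free_module R (B' n)) (free_module R (B n))" for n
    using \<phi> by (simp add: chain_map_def)
  have \<phi>d: "d n (\<phi> (Suc n) x) = \<phi> n (d' n x)" if "x \<in> carrier (free_module R (B' (Suc n)))" for n x
    using \<phi> that by (simp add: chain_map_def)
  have \<psi>h: "\<psi> n \<in> module_hom R (free_module R (B n)) (free_module R (B' n))" for n
    using \<psi> by (simp add: chain_map_def)
  have bd': "(\<lambda>x. g (d' k x)) \<in> cocycles B' d' (Suc k)" if g: "g \<in> cochains B' k" for g
    using cochains_comp[of g B' k "d' k" B' "Suc k", OF g free_resolutionD(2)[OF res']] resolution_dd[OF res'] cochains_zero_val[OF g]
    by (simp add: cocycles_def)
  show ?thesis
  proof (rule Hom_cohomology_rank_ge[where B = B and d = d and k = k and r = r and W = W and p = p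
        and u = "\<lambda>i x. u i (\<psi> (Suc k) x)" and \<Theta> = "\<lambda>f. \<Theta> (\<lambda>x. f (\<phi> (Suc k) x))"])
    show "d n \<in> module_hom R (free_module R (B (Suc n))) (free_module R (B n))" for n
      by (rule free_resolutionD(2)[OF res])
    show "d n (d (Suc n) x) = \<zero>\<^bsub>free_module R (B n)\<^esub>"
      if "x \<in> carrier (free_module R (B (Suc (Suc n))))" for n x
      by (rule resolution_dd[OF res that])
    show "p > 1" "finite W" by (rule p, rule W)
    show "(\<lambda>x. u i (\<psi> (Suc k) x)) \<in> cocycles B d (Suc k)" if "i < r" for i
      by (rule cocycles_comp[OF \<psi> u[OF that]])
  next
    fix f assume f: "f \<in> cocycles B d (Suc k)"
    obtain g where g: "g \<in> cochains B k"
      "\<And>x. x \<in> carrier (free_module R (B (Suc k))) \<Longrightarrow> f (\<phi> (Suc k) (\<psi> (Suc k) x)) = f x + g (d k x)"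
      using cocycle_homotopic[OF M res chain_map_comp[OF \<psi> \<phi>] f] by blast
    obtain c :: "nat \<Rightarrow> int" where c: "\<And>x. x \<in> carrier (free_module R (B' (Suc k))) \<Longrightarrow>
        f (\<phi> (Suc k) x) = (\<Sum>i<r. c i * u i x)"
      using gen[OF cocycles_comp[OF \<phi> f]] by blast
    have "f x = (\<Sum>i<r. c i * u i (\<psi> (Suc k) x)) + - g (d k x)" if "x \<in> carrier (free_module R (B (Suc k)))" for x
      using g(2)[OF that] c[OF module_homD(1)[OF \<psi>h that]] by linarith
    then show "\<exists>c. \<exists>g\<in>cochains B k. \<forall>x\<in>carrier (free_module R (B (Suc k))).
        f x = (\<Sum>i<r. c i * u i (\<psi> (Suc k) x)) + g (d k x)"
      using cochains_uminus[OF g(1)] by (intro exI[of _ c] bexI[of _ "\<lambda>x. - g x"]) auto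
  next
    show "\<Theta> (\<lambda>x. f (\<phi> (Suc k) x)) w = \<Theta> (\<lambda>x. g (\<phi> (Suc k) x)) w"
      if "\<forall>x\<in>carrier (free_module R (B (Suc k))). f x = g x" "w \<in> W" for f g w
      using that module_homD(1)[OF \<phi>h] by (intro \<Theta>_cong) auto
  next
    show "\<Theta> (\<lambda>x. f (\<phi> (Suc k) x) + g (\<phi> (Suc k) x)) w = \<Theta> (\<lambda>x. f (\<phi> (Suc k) x)) w + \<Theta> (\<lambda>x. g (\<phi> (Suc k) x)) w"
      if "f \<in> cocycles B d (Suc k)" "g \<in> cocycles B d (Suc k)" "w \<in> W" for f g w
      using that by (intro \<Theta>_add cocycles_comp[OF \<phi>])
  next
    fix g w assume g: "g \<in> cochains B k" and w: "w \<in> W"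
    have "\<Theta> (\<lambda>x. g (d k (\<phi> (Suc k) x))) w = \<Theta> (\<lambda>x. g (\<phi> k (d' k x))) w"
      by (rule \<Theta>_cong[OF _ w]) (simp add: \<phi>d)
    then show "p dvd \<Theta> (\<lambda>x. g (d k (\<phi> (Suc k) x))) w"
      using \<Theta>_bd[OF cochains_comp[of g B k "\<phi> k" B' k, OF g \<phi>h] w] by simp
  next
    fix t :: "'w \<Rightarrow> int"
    obtain f where f: "f \<in> cocycles B' d' (Suc k)" "\<forall>w\<in>W. [\<Theta> f w = t w] (mod p)" using surj by blast
    obtain g where g: "g \<in> cochains B' k"
      "\<And>x. x \<in> carrier (free_module R (B' (Suc k))) \<Longrightarrow> f (\<psi> (Suc k) (\<phi> (Suc k) x)) = f x + g (d' k x)"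
      using cocycle_homotopic[OF M res' chain_map_comp[OF \<phi> \<psi>] f(1)] by blast
    have "[\<Theta> (\<lambda>x. f (\<psi> (Suc k) (\<phi> (Suc k) x))) w = t w] (mod p)" if w: "w \<in> W" for w
    proof -
      have "\<Theta> (\<lambda>x. f (\<psi> (Suc k) (\<phi> (Suc k) x))) w = \<Theta> (\<lambda>x. f x + g (d' k x)) w"
        by (rule \<Theta>_cong[OF _ w]) (simp add: g(2))
      also have "\<dots> = \<Theta> f w + \<Theta> (\<lambda>x. g (d' k x)) w" by (rule \<Theta>_add[OF f(1) bd'[OF g(1)] w])
      finally show ?thesis
        using cong_add[OF f(2)[rule_format, OF w], of "\<Theta> (\<lambda>x. g (d' k x)) w" 0] \<Theta>_bd[OF g(1) w]
        by (simp add: cong_0_iff)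
    qed
    then show "\<exists>f\<in>cocycles B d (Suc k). \<forall>w\<in>W. [\<Theta> (\<lambda>x. f (\<phi> (Suc k) x)) w = t w] (mod p)"
      using cocycles_comp[OF \<psi> f(1)] by (intro bexI[of _ "\<lambda>x. f (\<psi> (Suc k) x)"]) auto
  qed
qed

end

section \<open>Lattices of integer-valued functions\<close>

lemma int_lattice_smult:
  fixes U :: "('x \<Rightarrow> int) set"
  assumes "\<And>u v. u \<in> U \<Longrightarrow> v \<in> U \<Longrightarrow> (\<lambda>x. u x - v x) \<in> U" "u \<in> U"
  shows "(\<lambda>x. c * u x) \<in> U"
proof -
  have z: "(\<lambda>x. 0) \<in> U" using assms(1)[OF assms(2,2)] by simp
  have neg: "(\<lambda>x. - v x) \<in> U" if "v \<in> U" for v using assms(1)[OF z that] by simp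
  show ?thesis
  proof (induction c rule: int_induct[where k = 0])
    case (step1 i)
    then show ?case using assms(1)[OF step1(2) neg[OF assms(2)]] by (simp add: algebra_simps)
  next
    case (step2 i)
    then show ?case using assms(1)[OF step2(2) assms(2)] by (simp add: algebra_simps)
  qed (simp add: z)
qed

text \<open>Induction on the support. The vectors vanishing at the new point \<open>x\<close> have a
  basis by induction; a vector with least positive value at \<open>x\<close> completes it, by
  division with remainder. The coordinates are delivered as a function \<open>co\<close> because
  they later serve as additive functionals.\<close>

lemma int_lattice_basis:
  fixes U :: "('x \<Rightarrow> int) set"
  assumes "finite X" "\<forall>u\<in>U. \<forall>x. x \<notin> X \<longrightarrow> u x = 0" "U \<noteq> {}"
    and "\<forall>u\<in>U. \<forall>v\<in>U. (\<lambda>x. u x - v x) \<in> U"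
  shows "\<exists>(m :: nat) e co. (\<forall>i<m. e i \<in> U) \<and> (\<forall>u\<in>U. \<forall>x. u x = (\<Sum>i<m. co u i * e i x)) \<and>
    (\<forall>u\<in>U. \<forall>v\<in>U. \<forall>i<m. co (\<lambda>x. u x + v x) i = co u i + (co v i :: int)) \<and>
    (\<forall>i<m. \<forall>j<m. co (e i) j = (if i = j then 1 else 0))"
  using assms
proof (induction X arbitrary: U rule: finite_induct)
  case empty
  then have "u x = 0" if "u \<in> U" for u x using that by blast
  then show ?case by (intro exI[of _ 0]) auto
next
  case (insert x X)
  have diff: "(\<lambda>x. u x - v x) \<in> U" if "u \<in> U" "v \<in> U" for u v
    using insert.prems(3) that by blast
  have sm: "(\<lambda>x. c * u x) \<in> U" if "u \<in> U" for c u
    by (rule int_lattice_smult[of U, OF _ that]) (rule diff)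
  define U' where "U' = {u \<in> U. u x = 0}"
  have z: "(\<lambda>x. 0) \<in> U" using insert.prems(2) diff by fastforce
  have "U' \<noteq> {}" using z by (auto simp: U'_def)
  moreover have "u y = 0" if "u \<in> U'" "y \<notin> X" for u y using that insert.prems(1) by (cases "y = x") (auto simp: U'_def)
  moreover have "(\<lambda>x. u x - v x) \<in> U'" if "u \<in> U'" "v \<in> U'" for u v using that diff by (auto simp: U'_def)
  ultimately have "\<exists>(m :: nat) e co. (\<forall>i<m. e i \<in> U') \<and> (\<forall>u\<in>U'. \<forall>x. u x = (\<Sum>i<m. co u i * e i x)) \<and>
    (\<forall>u\<in>U'. \<forall>v\<in>U'. \<forall>i<m. co (\<lambda>x. u x + v x) i = co u i + (co v i :: int)) \<and>
    (\<forall>i<m. \<forall>j<m. co (e i) j = (if i = j then 1 else 0))"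
    using insert.IH[of U'] by blast
  then obtain m :: nat and e and co :: "_ \<Rightarrow> nat \<Rightarrow> int" where
    e: "\<And>i. i < m \<Longrightarrow> e i \<in> U'" and ex: "\<And>u x. u \<in> U' \<Longrightarrow> u x = (\<Sum>i<m. co u i * e i x)"
    and add: "\<And>u v i. u \<in> U' \<Longrightarrow> v \<in> U' \<Longrightarrow> i < m \<Longrightarrow> co (\<lambda>x. u x + v x) i = co u i + co v i"
    and ee: "\<And>i j. i < m \<Longrightarrow> j < m \<Longrightarrow> co (e i) j = (if i = j then 1 else 0)" by blast
  show ?case
  proof (cases "\<forall>u\<in>U. u x = 0")
    case True
    then have "U' = U" by (auto simp: U'_def)
    then show ?thesis using e ex add ee by (intro exI[of _ m] exI[of _ e] exI[of _ co]) auto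
  next
    case False
    then obtain v where v: "v \<in> U" "v x \<noteq> 0" by blast
    then have "\<exists>v. v \<in> U \<and> v x > 0"
    proof (cases "v x > 0")
      case False
      then show ?thesis using sm[OF v(1), of "-1"] v(2) by (intro exI[of _ "\<lambda>x. - v x"]) auto
    qed blast
    from exists_least_iff[THEN iffD1, of "\<lambda>n. \<exists>v. v \<in> U \<and> v x > 0 \<and> nat (v x) = n"] this
    obtain w where w: "w \<in> U" "w x > 0" and least: "\<And>v. v \<in> U \<Longrightarrow> v x > 0 \<Longrightarrow> nat (w x) \<le> nat (v x)"
      by (metis not_le)
    have red: "(\<lambda>y. u y - (u x div w x) * w y) \<in> U'" if u: "u \<in> U" for u
    proof -
      have U: "(\<lambda>y. u y - (u x div w x) * w y) \<in> U" using diff[OF u sm[OF w(1)]] .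
      have "u x - (u x div w x) * w x = u x mod w x" by (simp add: minus_div_mult_eq_mod)
      moreover have "\<not> u x mod w x > 0"
      proof
        assume gt: "u x mod w x > 0"
        have "nat (w x) \<le> nat (u x mod w x)" using least[OF U] gt calculation by simp
        then have "w x \<le> u x mod w x" using gt by simp
        then show False using pos_mod_bound[OF w(2), of "u x"] by linarith
      qed
      ultimately show ?thesis using U pos_mod_sign[OF w(2), of "u x"] by (auto simp: U'_def)
    qed
    have dv: "w x dvd u x" if "u \<in> U" for u
      using red[OF that] by (simp add: U'_def) (metis dvd_triv_right)
    define co' where "co' = (\<lambda>u i. if i < m then co (\<lambda>y. u y - (u x div w x) * w y) i else u x div w x)"
    define e' where "e' = e(m := w)"
    have "\<forall>i<Suc m. e' i \<in> U" using e w by (auto simp: e'_def U'_def less_Suc_eq)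
    moreover have "u y = (\<Sum>i<Suc m. co' u i * e' i y)" if "u \<in> U" for u y
      using ex[OF red[OF that], of y] by (simp add: co'_def e'_def)
    moreover have "co' (\<lambda>x. u x + v x) i = co' u i + co' v i" if uv: "u \<in> U" "v \<in> U" and i: "i < Suc m" for u v i
    proof -
      have q: "(u x + v x) div w x = u x div w x + v x div w x"
        using dv[OF uv(1)] by (rule div_add) (rule dv[OF uv(2)])
      show ?thesis
        using add[OF red[OF uv(1)] red[OF uv(2)], of i] i unfolding co'_def q
        by (auto simp: algebra_simps)
    qed
    moreover have "co' (e' i) j = (if i = j then 1 else 0)" if ij: "i < Suc m" "j < Suc m" for i j
    proof (cases "i = m")
      case True
      have "co (\<lambda>y. 0) k = 0" if "k < m" for k
        using add[of "\<lambda>y. 0" "\<lambda>y. 0" k] z that by (simp add: U'_def)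
      then show ?thesis using True ij w(2) by (auto simp: co'_def e'_def)
    next
      case False
      then have i: "i < m" using ij by simp
      then have "e i x = 0" using e by (simp add: U'_def)
      then show ?thesis using False i ij ee by (auto simp: co'_def e'_def)
    qed
    ultimately show ?thesis by (intro exI[of _ "Suc m"] exI[of _ e'] exI[of _ co']) auto
  qed
qed

section \<open>The bar resolution\<close>

text \<open>Additively \<open>R\<close> is the sum of the multiples of \<one> and of the
  augmentation ideal, the kernel of \<pi>, which is free on the \<open>e i\<close>;
  \<open>co\<close> gives the coordinates of the second component. The injection \<open>enc\<close>
  places the words of the bar construction in the index type that \<open>Ext\<close>
  prescribes.\<close>

locale bar = integral_cochains R N for R :: "('a, 'b) ring_scheme" (structure) and N :: "('a, int, 'q) module_scheme" +
  fixes \<pi> :: "'a \<Rightarrow> int" and m :: nat and e :: "nat \<Rightarrow> 'a" and co :: "'a \<Rightarrow> nat \<Rightarrow> int" and enc :: "nat list \<Rightarrow> 'i"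
  assumes smult_N: "\<And>a n. a \<in> carrier R \<Longrightarrow> a \<odot>\<^bsub>N\<^esub> n = \<pi> a * n"
    and \<pi>_add: "\<And>a b. a \<in> carrier R \<Longrightarrow> b \<in> carrier R \<Longrightarrow> \<pi> (a \<oplus> b) = \<pi> a + \<pi> b"
    and \<pi>_mult: "\<And>a b. a \<in> carrier R \<Longrightarrow> b \<in> carrier R \<Longrightarrow> \<pi> (a \<otimes> b) = \<pi> a * \<pi> b"
    and \<pi>_one: "\<pi> \<one> = 1"
    and e_closed: "\<And>i. i < m \<Longrightarrow> e i \<in> carrier R" and \<pi>_e: "\<And>i. i < m \<Longrightarrow> \<pi> (e i) = 0"
    and co_add: "\<And>a b i. a \<in> carrier R \<Longrightarrow> b \<in> carrier R \<Longrightarrow> i < m \<Longrightarrow> co (a \<oplus> b) i = co a i + co b i"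
    and co_one: "\<And>i. i < m \<Longrightarrow> co \<one> i = 0"
    and co_e: "\<And>i j. i < m \<Longrightarrow> j < m \<Longrightarrow> co (e i) j = (if i = j then 1 else 0)"
    and expand: "\<And>a. a \<in> carrier R \<Longrightarrow>
      a = add_pow R (\<pi> a) \<one> \<oplus> finsum R (\<lambda>i. add_pow R (co a i) (e i)) {..<m}"
    and inj_enc: "inj enc"
begin

definition \<iota> :: "int \<Rightarrow> 'a" where "\<iota> c = add_pow R c \<one>"

lemma \<iota>_closed [simp]: "\<iota> c \<in> carrier R" by (simp add: \<iota>_def)
lemma \<iota>_0 [simp]: "\<iota> 0 = \<zero>" by (simp add: \<iota>_def add_pow_int_ge)
lemma \<iota>_1 [simp]: "\<iota> 1 = \<one>" by (simp add: \<iota>_def add.int_pow_1)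
lemma \<iota>_add: "\<iota> (a + b) = \<iota> a \<oplus> \<iota> b" by (simp add: \<iota>_def add.int_pow_mult)
lemma \<iota>_uminus: "\<iota> (- a) = \<ominus> \<iota> a" by (simp add: \<iota>_def add.int_pow_neg)

lemma \<pi>_zero [simp]: "\<pi> \<zero> = 0" using \<pi>_add[of \<zero> \<zero>] by simp
lemma \<pi>_uminus: "a \<in> carrier R \<Longrightarrow> \<pi> (\<ominus> a) = - \<pi> a"
  using \<pi>_add[of a "\<ominus> a"] by (simp add: r_neg)
lemma co_zero [simp]: "i < m \<Longrightarrow> co \<zero> i = 0" using co_add[of \<zero> \<zero> i] by simp
lemma co_uminus: "a \<in> carrier R \<Longrightarrow> i < m \<Longrightarrow> co (\<ominus> a) i = - co a i"
  using co_add[of a "\<ominus> a" i] by (simp add: r_neg)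

lemma \<iota>_mult_induct:
  assumes "x \<in> carrier R" "P x" "\<And>a b. a \<in> carrier R \<Longrightarrow> b \<in> carrier R \<Longrightarrow> P a \<Longrightarrow> P b \<Longrightarrow> P (a \<oplus> b)"
    "\<And>a. a \<in> carrier R \<Longrightarrow> P a \<Longrightarrow> P (\<ominus> a)"
  shows "P (x \<otimes> \<iota> c)"
proof (induction c rule: int_induct[where k = 0])
  case base
  show ?case using assms(3)[OF assms(1) _ assms(2) assms(4)[OF assms(1,2)]] assms(1) by (simp add: r_neg)
next
  case (step1 i)
  then show ?case using assms(3)[OF _ assms(1) step1(2) assms(2)] assms(1) by (simp add: \<iota>_add r_distr)
next
  case (step2 i)
  have "\<iota> (i - 1) = \<iota> i \<oplus> \<ominus> \<one>" using \<iota>_add[of i "-1"] \<iota>_uminus[of 1] by simp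
  then show ?case using assms(3)[OF _ _ step2(2) assms(4)[OF assms(1,2)]] assms(1) by (simp add: r_distr r_minus)
qed

lemma co_mult_\<iota>:
  assumes "x \<in> carrier R" "i < m"
  shows "co (x \<otimes> \<iota> c) i = c * co x i"
proof (induction c rule: int_induct[where k = 0])
  case (step1 j)
  then show ?case using assms by (simp add: \<iota>_add r_distr co_add algebra_simps)
next
  case (step2 j)
  have "\<iota> (j - 1) = \<iota> j \<oplus> \<ominus> \<one>" using \<iota>_add[of j "-1"] \<iota>_uminus[of 1] by simp
  then show ?case using step2 assms by (simp add: r_distr r_minus co_add co_uminus algebra_simps)
qed (use assms in simp)

lemma co_\<iota>: "i < m \<Longrightarrow> co (\<iota> c) i = 0"
  using co_mult_\<iota>[of \<one> i c] co_one by simp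

lemma \<pi>_\<iota>: "\<pi> (\<iota> c) = c"
proof (induction c rule: int_induct[where k = 0])
  case (step1 j)
  then show ?case by (simp add: \<iota>_add \<pi>_add \<pi>_one)
next
  case (step2 j)
  have "\<iota> (j - 1) = \<iota> j \<oplus> \<ominus> \<one>" using \<iota>_add[of j "-1"] \<iota>_uminus[of 1] by simp
  then show ?case using step2 by (simp add: \<pi>_add \<pi>_uminus \<pi>_one)
qed simp

lemma add_pow_eq: "x \<in> carrier R \<Longrightarrow> add_pow R (c :: int) x = x \<otimes> \<iota> c"
  unfolding \<iota>_def using add_pow_rdistr_int[of x \<one> c] by simp

lemma expand': "a \<in> carrier R \<Longrightarrow> a = \<one> \<otimes> \<iota> (\<pi> a) \<oplus> finsum R (\<lambda>i. e i \<otimes> \<iota> (co a i)) {..<m}"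
proof -
  assume a: "a \<in> carrier R"
  have "finsum R (\<lambda>i. add_pow R (co a i) (e i)) {..<m} = finsum R (\<lambda>i. e i \<otimes> \<iota> (co a i)) {..<m}"
    by (rule finsum_cong') (use e_closed in \<open>auto simp: add_pow_eq\<close>)
  then show ?thesis using expand[OF a] by (simp add: add_pow_eq)
qed

text \<open>Reduction to additive generators of \<open>R\<close>, for statements that are additive
  but not linear, such as the identities for the contraction \<open>s\<close>.\<close>

lemma lattice_induct [consumes 1, case_names one e add uminus]:
  assumes a: "a \<in> carrier R" and P1: "P \<one>" and Pe: "\<And>i. i < m \<Longrightarrow> P (e i)"
    and Padd: "\<And>a b. a \<in> carrier R \<Longrightarrow> b \<in> carrier R \<Longrightarrow> P a \<Longrightarrow> P b \<Longrightarrow> P (a \<oplus> b)"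
    and Pneg: "\<And>a. a \<in> carrier R \<Longrightarrow> P a \<Longrightarrow> P (\<ominus> a)"
  shows "P a"
proof -
  have P0: "P \<zero>" using Padd[of \<one> "\<ominus> \<one>"] P1 Pneg[of \<one>] by (simp add: r_neg)
  have "finsum R (\<lambda>i. e i \<otimes> \<iota> (c i)) {..<j} \<in> carrier R \<and> P (finsum R (\<lambda>i. e i \<otimes> \<iota> (c i)) {..<j})" if "j \<le> m" for j c
    using that
  proof (induction j)
    case (Suc j)
    have "finsum R (\<lambda>i. e i \<otimes> \<iota> (c i)) {..<Suc j} = e j \<otimes> \<iota> (c j) \<oplus> finsum R (\<lambda>i. e i \<otimes> \<iota> (c i)) {..<j}"
      unfolding lessThan_Suc using Suc(2) e_closed by (intro finsum_insert) auto
    moreover have "P (e j \<otimes> \<iota> (c j))" "e j \<in> carrier R"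
      using \<iota>_mult_induct[OF e_closed Pe Padd Pneg] Suc(2) e_closed by auto
    ultimately show ?case using Suc Padd by simp
  qed (simp add: P0)
  moreover have "P (\<one> \<otimes> \<iota> (\<pi> a))" by (rule \<iota>_mult_induct[OF _ P1 Padd Pneg]) auto
  ultimately have "P (\<one> \<otimes> \<iota> (\<pi> a) \<oplus> finsum R (\<lambda>i. e i \<otimes> \<iota> (co a i)) {..<m})"
    by (intro Padd) auto
  then show ?thesis using expand'[OF a] by simp
qed

section \<open>The free modules, contraction and differential of the bar resolution\<close>

definition words :: "nat \<Rightarrow> nat list set" where "words n = {xs. length xs = n \<and> set xs \<subseteq> {..<m}}"

text \<open>The word \<open>x1 ... xn\<close> stands for the bar symbol
  \<open>[e x1 | ... | e xn]\<close>. As the ideal is free abelian on the \<open>e i\<close>, these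
  symbols form an \<open>R\<close>-basis of the degree \<open>n\<close> term of the normalized bar
  resolution.\<close>

definition L :: "nat \<Rightarrow> 'i set" where "L n = enc ` words n"

lemma finite_words [simp]: "finite (words n)"
  unfolding words_def using finite_lists_length_eq[of "{..<m}" n] by (simp add: conj_commute)

lemma words_0: "words 0 = {[]}" by (auto simp: words_def)
lemma words_Suc: "words (Suc n) = (\<lambda>(k, ys). k # ys) ` ({..<m} \<times> words n)"
  by (force simp: words_def length_Suc_conv image_iff)
lemma Cons_words: "k # ys \<in> words (Suc n) \<longleftrightarrow> k < m \<and> ys \<in> words n" by (auto simp: words_def)

lemma sum_words_Suc: "(\<Sum>xs\<in>words (Suc n). g xs) = (\<Sum>k<m. \<Sum>ys\<in>words n. g (k # ys))"
proof -
  have "inj_on (\<lambda>(k :: nat, ys). k # ys) ({..<m} \<times> words n)" by (auto simp: inj_on_def)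
  then have "(\<Sum>xs\<in>words (Suc n). g xs) = (\<Sum>(k, ys)\<in>{..<m} \<times> words n. g (k # ys))"
    unfolding words_Suc sum.reindex[OF \<open>inj_on _ _\<close>] by (simp add: o_def case_prod_unfold)
  then show ?thesis by (simp add: sum.cartesian_product)
qed

lemma enc_eq [simp]: "enc xs = enc ys \<longleftrightarrow> xs = ys" using inj_enc by (auto dest: injD)
lemma enc_L [simp]: "enc xs \<in> L n \<longleftrightarrow> xs \<in> words n" by (auto simp: L_def)

abbreviation FM :: "nat \<Rightarrow> ('a, 'i \<Rightarrow> 'a) module" where "FM n \<equiv> free_module R (L n)"

lemma carrier_FM: "z \<in> carrier (FM n) \<longleftrightarrow> (\<forall>i. z i \<in> carrier R) \<and> (\<forall>i. i \<notin> L n \<longrightarrow> z i = \<zero>)"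
proof -
  have "finite {i. z i \<noteq> \<zero>}" if "\<forall>i. i \<notin> L n \<longrightarrow> z i = \<zero>"
    by (rule finite_subset[of _ "L n"]) (use that in \<open>auto simp: L_def\<close>)
  then show ?thesis by (auto simp: carrier_free_module)
qed

lemma FM_closed: "z \<in> carrier (FM n) \<Longrightarrow> z i \<in> carrier R" by (simp add: carrier_FM)

abbreviation bv :: "nat list \<Rightarrow> 'i \<Rightarrow> 'a" where "bv xs \<equiv> basis_vec R (enc xs)"

lemma bv_closed: "xs \<in> words n \<Longrightarrow> bv xs \<in> carrier (FM n)"
  by (rule basis_vec_closed) simp

lemma bv_enc: "bv xs (enc ys) = (if ys = xs then \<one> else \<zero>)" by (simp add: basis_vec_def)

lemma FM_induct [consumes 1, case_names add uminus zero one e]: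
  assumes z: "z \<in> carrier (FM n)"
    and Padd: "\<And>x y. x \<in> carrier (FM n) \<Longrightarrow> y \<in> carrier (FM n) \<Longrightarrow> P x \<Longrightarrow> P y \<Longrightarrow> P (\<lambda>i. x i \<oplus> y i)"
    and Pneg: "\<And>x. x \<in> carrier (FM n) \<Longrightarrow> P x \<Longrightarrow> P (\<lambda>i. \<ominus> x i)"
    and P0: "P (\<lambda>i. \<zero>)"
    and P1: "\<And>xs. xs \<in> words n \<Longrightarrow> P (bv xs)"
    and Pe: "\<And>k xs. k < m \<Longrightarrow> xs \<in> words n \<Longrightarrow> P (\<lambda>i. e k \<otimes> bv xs i)"
  shows "P z"
  using z
proof (induction rule: free_induct)
  case (single a i)
  then obtain xs where xs: "xs \<in> words n" "i = enc xs" by (auto simp: L_def)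
  have bR: "bv xs j \<in> carrier R" for j by (simp add: basis_vec_def)
  have c: "(\<lambda>j. a \<otimes> bv xs j) \<in> carrier (FM n)" if "a \<in> carrier R" for a
    by (rule free_smult_closed[OF that bv_closed[OF xs(1)]])
  show ?case unfolding xs(2) using single(1)
  proof (induction rule: lattice_induct)
    case one
    then show ?case using P1[OF xs(1)] bR by simp
  next
    case (add a b)
    then show ?case using Padd[OF c c] bR by (simp add: l_distr)
  next
    case (uminus a)
    then show ?case using Pneg[OF c] bR by (simp add: l_minus)
  qed (use Pe xs in simp)
qed (use Padd P0 in auto)

text \<open>The standard contraction, sending \<open>a [ys]\<close> to
  \<open>1 [a - \<pi> a | ys]\<close>, in coordinates: the coefficient of \<open>k # ys\<close> is
  the \<open>k\<close>-th coordinate of the coefficient of \<open>ys\<close>, as a multiple of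
  \<one>.\<close>

definition s :: "('i \<Rightarrow> 'a) \<Rightarrow> 'i \<Rightarrow> 'a" where
  "s z i = (if i \<in> range enc then (case inv_into UNIV enc i of [] \<Rightarrow> \<zero> | k # ys \<Rightarrow> if k < m then \<iota> (co (z (enc ys)) k) else \<zero>) else \<zero>)"

lemma inv_enc [simp]: "inv_into UNIV enc (enc xs) = xs" by (rule inv_f_f[OF inj_enc])

lemma s_Nil [simp]: "s z (enc []) = \<zero>" by (simp add: s_def)
lemma s_Cons: "s z (enc (k # ys)) = (if k < m then \<iota> (co (z (enc ys)) k) else \<zero>)" by (simp add: s_def)

lemma s_closed:
  assumes "z \<in> carrier (FM n)"
  shows "s z \<in> carrier (FM (Suc n))"
  unfolding carrier_FM
proof (intro conjI allI impI)
  fix i show "s z i \<in> carrier R" by (auto simp: s_def split: list.splits)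
  assume i: "i \<notin> L (Suc n)"
  show "s z i = \<zero>"
  proof (cases "i \<in> range enc")
    case True
    then obtain xs where xs: "i = enc xs" by blast
    show ?thesis
    proof (cases xs)
      case (Cons k ys)
      have "z (enc ys) = \<zero>" if "k < m" using i assms xs Cons that by (simp add: carrier_FM Cons_words)
      then show ?thesis using xs Cons by (simp add: s_Cons)
    qed (simp add: xs)
  qed (simp add: s_def)
qed

lemma s_cases:
  obtains k ys where "i = enc (k # ys)" "k < m" | "\<And>k ys. k < m \<Longrightarrow> i \<noteq> enc (k # ys)" "\<And>z. s z i = \<zero>"
proof (cases "i \<in> range enc")
  case True
  then obtain xs where xs: "i = enc xs" by blast
  show thesis
  proof (cases xs)
    case (Cons k ys)
    then show thesis using that xs by (cases "k < m") (auto simp: s_Cons)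
  qed (use that xs in auto)
qed (use that in \<open>auto simp: s_def\<close>)

lemma s_add:
  assumes "x \<in> carrier (FM n)" "y \<in> carrier (FM n)"
  shows "s (\<lambda>i. x i \<oplus> y i) = (\<lambda>i. s x i \<oplus> s y i)"
proof
  fix i show "s (\<lambda>i. x i \<oplus> y i) i = s x i \<oplus> s y i"
    by (cases i rule: s_cases)
      (simp_all add: s_Cons co_add \<iota>_add FM_closed[OF assms(1)] FM_closed[OF assms(2)])
qed

lemma s_uminus:
  assumes "x \<in> carrier (FM n)"
  shows "s (\<lambda>i. \<ominus> x i) = (\<lambda>i. \<ominus> s x i)"
proof
  fix i show "s (\<lambda>i. \<ominus> x i) i = \<ominus> s x i"
    by (cases i rule: s_cases) (simp_all add: s_Cons co_uminus \<iota>_uminus FM_closed[OF assms])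
qed

lemma s_zero [simp]: "s (\<lambda>i. \<zero>) = (\<lambda>i. \<zero>)"
proof
  fix i show "s (\<lambda>i. \<zero>) i = \<zero>" by (cases i rule: s_cases) (simp_all add: s_Cons)
qed

text \<open>Coefficients of \<open>s z\<close> are integer multiples of \<one> and have no component
  in the ideal; this is why \<open>s\<close> squares to zero.\<close>

lemma s_integral: "\<exists>c. s z i = \<iota> c"
  by (cases i rule: s_cases) (auto simp: s_Cons intro: exI[of _ 0])

lemma s_s [simp]: "s (s z) = (\<lambda>i. \<zero>)"
proof
  fix i show "s (s z) i = \<zero>"
  proof (cases i rule: s_cases)
    case (1 k ys)
    obtain c where "s z (enc ys) = \<iota> c" using s_integral by blast
    then show ?thesis using 1 by (simp add: s_Cons co_\<iota>)
  qed
qed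

lemma s_bv [simp]: "s (bv xs) = (\<lambda>i. \<zero>)"
proof
  fix i show "s (bv xs) i = \<zero>" by (cases i rule: s_cases) (simp_all add: s_Cons bv_enc co_one)
qed

lemma s_e_bv: assumes "x < m" shows "s (\<lambda>i. e x \<otimes> bv xs i) = bv (x # xs)"
proof
  fix i show "s (\<lambda>i. e x \<otimes> bv xs i) i = bv (x # xs) i"
  proof (cases i rule: s_cases)
    case (1 k ys)
    then show ?thesis using assms by (simp add: s_Cons bv_enc co_e e_closed)
  next
    case 2
    then show ?thesis using assms by (simp add: basis_vec_def)
  qed
qed

lemma FM_smult: "a \<in> carrier R \<Longrightarrow> z \<in> carrier (FM n) \<Longrightarrow> (\<lambda>i. a \<otimes> z i) \<in> carrier (FM n)"
  by (rule free_smult_closed)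

lemma FM_minus: "x \<in> carrier (FM n) \<Longrightarrow> y \<in> carrier (FM n) \<Longrightarrow> (\<lambda>i. x i \<ominus> y i) \<in> carrier (FM n)"
  by (auto simp: carrier_FM minus_eq)

text \<open>The differential is forced by the contraction: \<open>s\<close> sends
  \<open>e x [xs]\<close> to \<open>[x | xs]\<close>, so the identity \<open>d s + s d = id\<close>
  at \<open>e x [xs]\<close> reads \<open>D (x # xs) = e x [xs] - s (e x D xs)\<close>. This
  replaces the usual alternating sum.\<close>

fun D :: "nat list \<Rightarrow> 'i \<Rightarrow> 'a" where
  "D [] = (\<lambda>i. \<zero>)"
| "D (x # xs) = (\<lambda>i. e x \<otimes> bv xs i \<ominus> s (\<lambda>j. e x \<otimes> D xs j) i)"

lemma D_closed: "xs \<in> words (Suc n) \<Longrightarrow> D xs \<in> carrier (FM n)"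
proof (induction xs arbitrary: n)
  case (Cons x xs)
  then have x: "x < m" "xs \<in> words n" by (auto simp: Cons_words)
  have 1: "(\<lambda>i. e x \<otimes> bv xs i) \<in> carrier (FM n)" using x e_closed bv_closed by (intro FM_smult) auto
  have 2: "s (\<lambda>j. e x \<otimes> D xs j) \<in> carrier (FM n)"
  proof (cases n)
    case 0
    then have "xs = []" using x by (simp add: words_0)
    then show ?thesis using e_closed[OF x(1)] by (simp add: carrier_FM)
  next
    case (Suc n')
    then show ?thesis using Cons.IH[of n'] x e_closed by (auto intro!: s_closed FM_smult)
  qed
  show ?case unfolding D.simps by (rule FM_minus[OF 1 2])
qed (simp add: words_def)

lemma L_D: "i \<in> L (Suc n) \<Longrightarrow> D (inv_into UNIV enc i) \<in> carrier (FM n)"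
proof -
  assume "i \<in> L (Suc n)"
  then obtain xs where "xs \<in> words (Suc n)" "i = enc xs" by (auto simp: L_def)
  then show ?thesis by (simp add: D_closed)
qed

definition bd :: "nat \<Rightarrow> ('i \<Rightarrow> 'a) \<Rightarrow> 'i \<Rightarrow> 'a" where
  "bd n = lin_ext (FM n) (\<lambda>i. D (inv_into UNIV enc i))"

lemma bd_hom: "bd n \<in> module_hom R (FM (Suc n)) (FM n)"
  unfolding bd_def by (rule lin_ext_hom[OF free_module_module L_D])

lemma bd_bv: "xs \<in> words (Suc n) \<Longrightarrow> bd n (bv xs) = D xs"
  unfolding bd_def by (subst lin_ext_basis[OF free_module_module, of "L (Suc n)"]) (auto simp: L_D)

lemma bd_closed: "z \<in> carrier (FM (Suc n)) \<Longrightarrow> bd n z \<in> carrier (FM n)"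
  by (rule module_homD(1)[OF bd_hom])

lemma bd_add: "x \<in> carrier (FM (Suc n)) \<Longrightarrow> y \<in> carrier (FM (Suc n)) \<Longrightarrow>
    bd n (\<lambda>i. x i \<oplus> y i) = (\<lambda>i. bd n x i \<oplus> bd n y i)"
  using module_homD(2)[OF bd_hom, of x n y] by (simp add: free_module_simps)

lemma bd_smult: "a \<in> carrier R \<Longrightarrow> x \<in> carrier (FM (Suc n)) \<Longrightarrow> bd n (\<lambda>i. a \<otimes> x i) = (\<lambda>i. a \<otimes> bd n x i)"
  using module_homD(3)[OF bd_hom, of a x n] by (simp add: free_module_simps)

lemma bd_minus: "x \<in> carrier (FM (Suc n)) \<Longrightarrow> y \<in> carrier (FM (Suc n)) \<Longrightarrow>
    bd n (\<lambda>i. x i \<ominus> y i) = (\<lambda>i. bd n x i \<ominus> bd n y i)"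
  using module_hom_minus[OF free_module_module free_module_module bd_hom, of x n y]
  by (simp add: free_minus[of x _ y] free_minus[of "bd n x" _ "bd n y"] bd_closed)

lemma bd_zero: "bd n (\<lambda>i. \<zero>) = (\<lambda>i. \<zero>)"
  using module_hom_zero[OF free_module_module free_module_module bd_hom[of n]] by (simp add: free_module_simps)

lemma bd_uminus: "x \<in> carrier (FM (Suc n)) \<Longrightarrow> bd n (\<lambda>i. \<ominus> x i) = (\<lambda>i. \<ominus> bd n x i)"
  using bd_smult[of "\<ominus> \<one>" x n] FM_closed[of x "Suc n"] FM_closed[OF bd_closed[of x n]] by (simp add: l_minus)

lemma bv_carrier [simp]: "bv xs i \<in> carrier R" by (simp add: basis_vec_def)

lemma D_R [simp]: "xs \<in> words (Suc n) \<Longrightarrow> D xs i \<in> carrier R"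
  using D_closed FM_closed by blast

lemma s_R [simp]: "s z i \<in> carrier R"
  using s_integral[of z i] by auto

lemma uminus_FM: "z \<in> carrier (FM n) \<Longrightarrow> (\<lambda>i. \<ominus> z i) \<in> carrier (FM n)"
  by (simp add: carrier_FM)

lemma s_D:
  assumes "xs \<in> words (Suc n)"
  shows "s (D xs) = bv xs"
proof -
  obtain x ys where xs: "xs = x # ys" "x < m" "ys \<in> words n" using assms by (auto simp: words_Suc)
  have 1: "(\<lambda>i. e x \<otimes> bv ys i) \<in> carrier (FM n)" using xs e_closed bv_closed by (intro FM_smult) auto
  have 2: "s (\<lambda>j. e x \<otimes> D ys j) \<in> carrier (FM n)"
  proof (cases n)
    case 0
    then show ?thesis using xs e_closed by (simp add: words_0 carrier_FM)
  next
    case (Suc n')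
    then show ?thesis using xs e_closed D_closed by (auto intro!: s_closed FM_smult)
  qed
  have "s (D xs) = (\<lambda>i. s (\<lambda>i. e x \<otimes> bv ys i) i \<oplus> s (\<lambda>i. \<ominus> s (\<lambda>j. e x \<otimes> D ys j) i) i)"
    unfolding xs(1) D.simps minus_eq by (rule s_add[OF 1 uminus_FM[OF 2]])
  then show ?thesis using xs by (simp add: s_uminus[OF 2] s_e_bv)
qed

text \<open>The map \<open>s\<close> is a contraction of the augmented complex; it is additive but not linear.\<close>

lemma contraction:
  assumes "z \<in> carrier (FM (Suc n))"
  shows "(\<lambda>i. bd (Suc n) (s z) i \<oplus> s (bd n z) i) = z"
  using assms
proof (induction rule: FM_induct)
  case (add x y)
  note c = FM_closed[OF bd_closed[OF s_closed[OF add(1)]]] FM_closed[OF bd_closed[OF s_closed[OF add(2)]]]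
  have "(\<lambda>i. bd (Suc n) (s (\<lambda>i. x i \<oplus> y i)) i \<oplus> s (bd n (\<lambda>i. x i \<oplus> y i)) i)
      = (\<lambda>i. (bd (Suc n) (s x) i \<oplus> s (bd n x) i) \<oplus> (bd (Suc n) (s y) i \<oplus> s (bd n y) i))"
    by (simp add: s_add[OF add(1,2)] bd_add[OF s_closed[OF add(1)] s_closed[OF add(2)]]
        bd_add[OF add(1,2)] s_add[OF bd_closed[OF add(1)] bd_closed[OF add(2)]] c a_ac)
  then show ?case using fun_cong[OF add(3)] fun_cong[OF add(4)] by simp
next
  case (uminus x)
  note c = FM_closed[OF bd_closed[OF s_closed[OF uminus(1)]]]
  have "(\<lambda>i. bd (Suc n) (s (\<lambda>i. \<ominus> x i)) i \<oplus> s (bd n (\<lambda>i. \<ominus> x i)) i)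
      = (\<lambda>i. \<ominus> (bd (Suc n) (s x) i \<oplus> s (bd n x) i))"
    by (simp add: s_uminus[OF uminus(1)] bd_uminus[OF s_closed[OF uminus(1)]]
        bd_uminus[OF uminus(1)] s_uminus[OF bd_closed[OF uminus(1)]] c minus_add)
  then show ?case using fun_cong[OF uminus(2)] by simp
next
  case (one xs)
  then show ?case by (simp add: bd_zero bd_bv s_D)
next
  \<comment> \<open>At \<open>e k [xs]\<close> the identity is the recursive equation of
    \<open>D\<close>; at a bare basis vector it was \<open>s_D\<close>.\<close>
  case (e k xs)
  have kxs: "k # xs \<in> words (Suc (Suc n))" using e by (simp add: Cons_words)
  show ?case
    using e e_closed by (auto simp: s_e_bv bd_bv[OF kxs] bd_smult bv_closed bd_bv minus_eq a_assoc l_neg)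
qed (simp add: bd_zero)

definition aug :: "('i \<Rightarrow> 'a) \<Rightarrow> int" where "aug z = \<pi> (z (enc []))"

lemma contraction_0:
  assumes "z \<in> carrier (FM 0)"
  shows "(\<lambda>i. bd 0 (s z) i \<oplus> \<iota> (aug z) \<otimes> bv [] i) = z"
  using assms
proof (induction rule: FM_induct)
  case (add x y)
  note c = FM_closed[OF bd_closed[OF s_closed[OF add(1)]]] FM_closed[OF bd_closed[OF s_closed[OF add(2)]]]
  have "(\<lambda>i. bd 0 (s (\<lambda>i. x i \<oplus> y i)) i \<oplus> \<iota> (aug (\<lambda>i. x i \<oplus> y i)) \<otimes> bv [] i)
      = (\<lambda>i. (bd 0 (s x) i \<oplus> \<iota> (aug x) \<otimes> bv [] i) \<oplus> (bd 0 (s y) i \<oplus> \<iota> (aug y) \<otimes> bv [] i))"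
    by (simp add: s_add[OF add(1,2)] bd_add[OF s_closed[OF add(1)] s_closed[OF add(2)]]
        aug_def \<pi>_add FM_closed[OF add(1)] FM_closed[OF add(2)] \<iota>_add l_distr c a_ac)
  then show ?case using fun_cong[OF add(3)] fun_cong[OF add(4)] by simp
next
  case (uminus x)
  note c = FM_closed[OF bd_closed[OF s_closed[OF uminus(1)]]]
  have "(\<lambda>i. bd 0 (s (\<lambda>i. \<ominus> x i)) i \<oplus> \<iota> (aug (\<lambda>i. \<ominus> x i)) \<otimes> bv [] i)
      = (\<lambda>i. \<ominus> (bd 0 (s x) i \<oplus> \<iota> (aug x) \<otimes> bv [] i))"
    by (simp add: s_uminus[OF uminus(1)] bd_uminus[OF s_closed[OF uminus(1)]]
        aug_def \<pi>_uminus FM_closed[OF uminus(1)] \<iota>_uminus l_minus c minus_add)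
  then show ?case using fun_cong[OF uminus(2)] by simp
next
  case (one xs)
  then show ?case by (simp add: bd_zero words_0 aug_def bv_enc \<pi>_one)
next
  case (e k xs)
  then have xs: "xs = []" and k: "k < m" "e k \<in> carrier R" using e_closed by (simp_all add: words_0)
  have "D [k] = (\<lambda>i. e k \<otimes> bv [] i)" using k by (simp add: minus_eq)
  moreover have "bd 0 (bv [k]) = D [k]" by (rule bd_bv) (simp add: Cons_words words_0 k)
  ultimately show ?case using k by (simp add: xs s_e_bv aug_def bv_enc \<pi>_e)
qed (simp add: bd_zero aug_def)

lemma aug_D: "xs \<in> words (Suc 0) \<Longrightarrow> aug (D xs) = 0"
  by (auto simp: words_Suc words_0 aug_def bv_enc e_closed \<pi>_e minus_eq)

text \<open>For the word \<open>x # ys\<close> put \<open>w = e x D ys\<close>, a cycle by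
  induction. The contraction gives \<open>d (s w) = w\<close>, so
  \<open>D (x # ys) = e x [ys] - s w\<close> has boundary \<open>w - w\<close>. In the base case,
  cycle means augmentation zero.\<close>

lemma bd_D: "xs \<in> words (Suc (Suc n)) \<Longrightarrow> bd n (D xs) = (\<lambda>i. \<zero>)"
proof (induction n arbitrary: xs)
  case 0
  then obtain x ys where xs: "xs = x # ys" "x < m" "ys \<in> words (Suc 0)" by (auto simp: words_Suc[of "Suc 0"])
  define w where "w = (\<lambda>j. e x \<otimes> D ys j)"
  have w: "w \<in> carrier (FM 0)" unfolding w_def using xs e_closed D_closed by (intro FM_smult) auto
  have "aug w = \<pi> (e x) * aug (D ys)" unfolding w_def aug_def using xs e_closed by (simp add: \<pi>_mult)
  then have "aug w = 0" using aug_D xs by simp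
  then have sw: "bd 0 (s w) = w"
    using contraction_0[OF w] FM_closed[OF bd_closed[OF s_closed[OF w]]] by simp
  have "bd 0 (D xs) = (\<lambda>i. bd 0 (\<lambda>i. e x \<otimes> bv ys i) i \<ominus> bd 0 (s w) i)"
    unfolding xs(1) D.simps w_def[symmetric]
    by (rule bd_minus[OF FM_smult s_closed[OF w]]) (use xs e_closed bv_closed in auto)
  also have "bd 0 (\<lambda>i. e x \<otimes> bv ys i) = w"
    unfolding w_def using xs e_closed bv_closed by (simp add: bd_smult bd_bv)
  finally show ?case using sw FM_closed[OF w] by (simp add: minus_eq r_neg)
next
  case (Suc n)
  then obtain x ys where xs: "xs = x # ys" "x < m" "ys \<in> words (Suc (Suc n))" by (auto simp: words_Suc[of "Suc (Suc n)"])
  define w where "w = (\<lambda>j. e x \<otimes> D ys j)"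
  have w: "w \<in> carrier (FM (Suc n))" unfolding w_def using xs e_closed D_closed by (intro FM_smult) auto
  have "bd n w = (\<lambda>i. e x \<otimes> bd n (D ys) i)"
    unfolding w_def using xs e_closed D_closed by (intro bd_smult) auto
  then have "bd n w = (\<lambda>i. \<zero>)" using Suc.IH[OF xs(3)] e_closed xs(2) by simp
  then have sw: "bd (Suc n) (s w) = w"
    using contraction[OF w] FM_closed[OF bd_closed[OF s_closed[OF w]]] by simp
  have "bd (Suc n) (D xs) = (\<lambda>i. bd (Suc n) (\<lambda>i. e x \<otimes> bv ys i) i \<ominus> bd (Suc n) (s w) i)"
    unfolding xs(1) D.simps w_def[symmetric]
    by (rule bd_minus[OF FM_smult s_closed[OF w]]) (use xs e_closed bv_closed in auto)
  also have "bd (Suc n) (\<lambda>i. e x \<otimes> bv ys i) = w"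
    unfolding w_def using xs e_closed bv_closed by (simp add: bd_smult bd_bv)
  finally show ?case using sw FM_closed[OF w] by (simp add: minus_eq r_neg)
qed

lemma bd_bd: "z \<in> carrier (FM (Suc (Suc n))) \<Longrightarrow> bd n (bd (Suc n) z) = (\<lambda>i. \<zero>)"
proof -
  assume z: "z \<in> carrier (FM (Suc (Suc n)))"
  interpret F: module R "FM n" by (rule free_module_module)
  have zero: "(\<lambda>z. \<zero>\<^bsub>FM n\<^esub>) \<in> module_hom R (FM (Suc (Suc n))) (FM n)"
    by (rule module_homI) simp_all
  have "bd n (bd (Suc n) z) = \<zero>\<^bsub>FM n\<^esub>"
    by (rule free_hom_eqI[OF free_module_module module_hom_comp[OF bd_hom bd_hom] zero _ z])
      (auto simp: L_def bd_bv bd_D free_module_simps)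
  then show ?thesis by (simp add: free_module_simps)
qed

lemma aug_hom: "aug \<in> module_hom R (FM 0) N"
  by (rule module_homI) (auto simp: aug_def free_module_simps N_simps \<pi>_add \<pi>_mult smult_N FM_closed)

lemma aug_bd: "z \<in> carrier (FM (Suc 0)) \<Longrightarrow> aug (bd 0 z) = 0"
proof -
  assume z: "z \<in> carrier (FM (Suc 0))"
  have zero: "(\<lambda>z. 0) \<in> module_hom R (FM (Suc 0)) N"
    by (rule module_homI) (simp_all add: N_simps smult_N)
  show ?thesis
    by (rule free_hom_eqI[OF N module_hom_comp[OF bd_hom aug_hom] zero _ z])
      (auto simp: L_def bd_bv aug_D)
qed

text \<open>Exactness is read off from the contraction: a cycle \<open>x\<close> is the boundary of
  \<open>s x\<close>.\<close>

theorem bar_resolution: "free_resolution R N L bd aug"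
  unfolding free_resolution_def
proof (intro conjI allI)
  show "aug \<in> module_hom R (FM 0) N" by (rule aug_hom)
  show "bd n \<in> module_hom R (FM (Suc n)) (FM n)" for n by (rule bd_hom)
  show "aug ` carrier (FM 0) = carrier N"
  proof -
    have "c \<in> aug ` carrier (FM 0)" for c
    proof (rule image_eqI)
      show "(\<lambda>i. \<iota> c \<otimes> bv [] i) \<in> carrier (FM 0)" by (intro FM_smult bv_closed) (auto simp: words_0)
      show "c = aug (\<lambda>i. \<iota> c \<otimes> bv [] i)" by (simp add: aug_def bv_enc \<pi>_\<iota>)
    qed
    then show ?thesis by (auto simp: N_simps)
  qed
  show "bd 0 ` carrier (FM 1) = {x \<in> carrier (FM 0). aug x = \<zero>\<^bsub>N\<^esub>}"
  proof (rule Set.set_eqI, rule iffI)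
    fix x assume "x \<in> bd 0 ` carrier (FM 1)"
    then show "x \<in> {x \<in> carrier (FM 0). aug x = \<zero>\<^bsub>N\<^esub>}" using aug_bd bd_closed by (auto simp: N_simps)
  next
    fix x assume x: "x \<in> {x \<in> carrier (FM 0). aug x = \<zero>\<^bsub>N\<^esub>}"
    then have "x = bd 0 (s x)"
      using contraction_0[of x] FM_closed[OF bd_closed[OF s_closed[of x 0]]] by (simp add: N_simps)
    then show "x \<in> bd 0 ` carrier (FM 1)" using x s_closed[of x 0] by auto
  qed
  show "bd (Suc n) ` carrier (FM (Suc (Suc n))) = {x \<in> carrier (FM (Suc n)). bd n x = \<zero>\<^bsub>FM n\<^esub>}" for n
  proof (rule Set.set_eqI, rule iffI)
    fix x assume "x \<in> bd (Suc n) ` carrier (FM (Suc (Suc n)))"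
    then show "x \<in> {x \<in> carrier (FM (Suc n)). bd n x = \<zero>\<^bsub>FM n\<^esub>}"
      using bd_bd bd_closed by (auto simp: free_module_simps)
  next
    fix x assume x: "x \<in> {x \<in> carrier (FM (Suc n)). bd n x = \<zero>\<^bsub>FM n\<^esub>}"
    then have "x = bd (Suc n) (s x)"
      using contraction[of x n] FM_closed[OF bd_closed[OF s_closed[of x "Suc n"]]] by (simp add: free_module_simps)
    then show "x \<in> bd (Suc n) ` carrier (FM (Suc (Suc n)))" using x s_closed[of x "Suc n"] by auto
  qed
qed

section \<open>Integral cochains of the bar resolution\<close>

text \<open>Ring elements act on the integers through \<pi>, so a cochain is determined by its
  values \<open>u\<close> on words; by \<open>cochain_eq_ev\<close> every cochain has this
  form.\<close>

definition ev :: "nat \<Rightarrow> (nat list \<Rightarrow> int) \<Rightarrow> ('i \<Rightarrow> 'a) \<Rightarrow> int" where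
  "ev n u z = (\<Sum>xs\<in>words n. \<pi> (z (enc xs)) * u xs)"

lemma ev_cochain: "ev n u \<in> cochains L n"
  unfolding cochains_iff
proof (intro conjI ballI)
  fix x y assume "x \<in> carrier (FM n)" "y \<in> carrier (FM n)"
  then show "ev n u (x \<oplus>\<^bsub>FM n\<^esub> y) = ev n u x + ev n u y"
    by (simp add: ev_def free_module_simps \<pi>_add FM_closed distrib_right sum.distrib)
next
  fix a x assume "a \<in> carrier R" "x \<in> carrier (FM n)"
  then show "ev n u (a \<odot>\<^bsub>FM n\<^esub> x) = a \<odot>\<^bsub>N\<^esub> ev n u x"
    by (simp add: ev_def free_module_simps \<pi>_mult smult_N FM_closed sum_distrib_left mult.assoc)
qed

lemma ev_bv: "xs \<in> words n \<Longrightarrow> ev n u (bv xs) = u xs"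
  by (simp add: ev_def bv_enc if_distrib[of \<pi>] \<pi>_one if_distrib[of "\<lambda>c. c * _"] cong: if_cong)

lemma cochain_eq_ev:
  assumes "f \<in> cochains L n" "z \<in> carrier (FM n)"
  shows "f z = ev n (\<lambda>xs. f (bv xs)) z"
proof (rule free_hom_eqI[OF N _ _ _ assms(2)])
  show "f \<in> module_hom R (FM n) N" "ev n (\<lambda>xs. f (bv xs)) \<in> module_hom R (FM n) N"
    using assms(1) ev_cochain[of n] by (auto simp: cochains_def)
qed (auto simp: L_def ev_bv)

lemma ev_minus:
  assumes "x \<in> carrier (FM n)" "y \<in> carrier (FM n)"
  shows "ev n u (\<lambda>i. x i \<ominus> y i) = ev n u x - ev n u y"
  using cochains_minus_val[OF ev_cochain assms] free_minus[OF assms] by simp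

lemma ev_s: "ev (Suc n) u (s z) = (\<Sum>k<m. \<Sum>ys\<in>words n. co (z (enc ys)) k * u (k # ys))"
  unfolding ev_def sum_words_Suc by (rule sum.cong[OF refl]) (simp add: s_Cons \<pi>_\<iota>)

text \<open>The bar coboundary, that is the sum over \<open>i\<close> of
  \<open>(-1)^i u(..., x_i x_(i+1), ...)\<close>. The outer terms are absent because letters act as
  zero on the integers; hence also the value 0 on words with fewer than two letters.\<close>

fun \<delta> :: "(nat list \<Rightarrow> int) \<Rightarrow> nat list \<Rightarrow> int" where
  "\<delta> u (x # y # ys) = - (\<Sum>k<m. co (e x \<otimes> e y) k * u (k # ys)) - \<delta> (\<lambda>zs. u (x # zs)) (y # ys)"
| "\<delta> u _ = 0"

text \<open>As \<open>s z\<close> has integer coefficients, \<open>e x\<close> times it has only the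
  coordinate \<open>x\<close>, and the outer \<open>s\<close> merely prepends that letter.\<close>

lemma ev_s_e_s:
  assumes "x < m"
  shows "ev (Suc (Suc n)) u (s (\<lambda>i. e x \<otimes> s z i)) = ev (Suc n) (\<lambda>zs. u (x # zs)) (s z)"
proof -
  have *: "co (e x \<otimes> s z i) k = (if x = k then \<pi> (s z i) else 0)" if k: "k < m" for k i
  proof -
    obtain c where "s z i = \<iota> c" using s_integral by blast
    then show ?thesis using assms k by (simp add: co_mult_\<iota> e_closed co_e \<pi>_\<iota>)
  qed
  have "ev (Suc (Suc n)) u (s (\<lambda>i. e x \<otimes> s z i))
      = (\<Sum>k<m. if x = k then \<Sum>ys\<in>words (Suc n). \<pi> (s z (enc ys)) * u (k # ys) else 0)"
    unfolding ev_s by (intro sum.cong refl) (auto simp: *)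
  then show ?thesis using assms by (simp add: ev_def)
qed

text \<open>Unfold \<open>D\<close> twice: \<pi> kills the terms with a factor \<open>e x\<close>,
  the product \<open>(e x \<otimes> e y) [ys]\<close> yields the product term of \<delta>, and the
  remaining \<open>e x v\<close> prepends \<open>x\<close>, so that induction supplies the
  tail.\<close>

lemma ev_D: "xs \<in> words (Suc n) \<Longrightarrow> ev n u (D xs) = \<delta> u xs"
proof (induction n arbitrary: xs u)
  case 0
  then show ?case by (auto simp: words_Suc words_0 ev_def bv_enc e_closed minus_eq \<pi>_e)
next
  case (Suc n)
  then obtain x y ys where xs: "xs = x # y # ys" "x < m" "y < m" "ys \<in> words n"
    by (auto simp: words_Suc)
  then have yys: "y # ys \<in> words (Suc n)" by (simp add: Cons_words)
  note ex = e_closed[OF xs(2)] and ey = e_closed[OF xs(3)]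
  define v where "v = s (\<lambda>j. e y \<otimes> D ys j)"
  have v: "v \<in> carrier (FM n)"
  proof (cases n)
    case 0
    then show ?thesis using xs ey by (simp add: v_def words_0 carrier_FM)
  next
    case (Suc n')
    then show ?thesis using xs ey D_closed by (auto simp: v_def intro!: s_closed FM_smult)
  qed
  have vR: "v i \<in> carrier R" for i using FM_closed[OF v] .
  note bys = bv_closed[OF xs(4)]
  have ev_D': "ev n u' (D (y # ys)) = - ev n u' v" for u'
  proof -
    have "ev n u' (D (y # ys)) = ev n u' (\<lambda>i. e y \<otimes> bv ys i) - ev n u' v"
      unfolding D.simps v_def[symmetric] by (rule ev_minus[OF FM_smult[OF ey bys] v])
    then show ?thesis using ey by (simp add: ev_def \<pi>_mult \<pi>_e xs(3))
  qed
  have w: "(\<lambda>j. e x \<otimes> D (y # ys) j) \<in> carrier (FM n)" by (rule FM_smult[OF ex D_closed[OF yys]])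
  have weq: "(\<lambda>j. e x \<otimes> D (y # ys) j) = (\<lambda>j. (e x \<otimes> e y) \<otimes> bv ys j \<oplus> \<ominus> (e x \<otimes> v j))"
    using ex ey vR by (simp add: v_def[symmetric] minus_eq r_distr r_minus m_assoc)
  have sw: "s (\<lambda>j. e x \<otimes> D (y # ys) j) = (\<lambda>i. s (\<lambda>j. (e x \<otimes> e y) \<otimes> bv ys j) i \<ominus> s (\<lambda>j. e x \<otimes> v j) i)"
    unfolding weq minus_eq using ex ey v bys
    by (subst s_add[of _ n]) (auto intro!: FM_smult uminus_FM simp: s_uminus[OF FM_smult[OF ex v]])
  have "ev (Suc n) u (D xs) = ev (Suc n) u (\<lambda>i. e x \<otimes> bv (y # ys) i) - ev (Suc n) u (s (\<lambda>j. e x \<otimes> D (y # ys) j))"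
    unfolding xs(1) D.simps(2)[of x "y # ys"]
    by (rule ev_minus[OF FM_smult[OF ex bv_closed[OF yys]] s_closed[OF w]])
  also have "ev (Suc n) u (\<lambda>i. e x \<otimes> bv (y # ys) i) = 0"
    using ex by (simp add: ev_def \<pi>_mult \<pi>_e xs(2))
  also have "ev (Suc n) u (s (\<lambda>j. e x \<otimes> D (y # ys) j))
      = ev (Suc n) u (s (\<lambda>j. (e x \<otimes> e y) \<otimes> bv ys j)) - ev (Suc n) u (s (\<lambda>j. e x \<otimes> v j))"
    unfolding sw using ex ey by (intro ev_minus s_closed FM_smult v bys) auto
  also have "ev (Suc n) u (s (\<lambda>j. (e x \<otimes> e y) \<otimes> bv ys j)) = (\<Sum>k<m. co (e x \<otimes> e y) k * u (k # ys))"
    unfolding ev_s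
  proof (rule sum.cong[OF refl])
    fix k assume k: "k \<in> {..<m}"
    have "(\<Sum>zs\<in>words n. co ((e x \<otimes> e y) \<otimes> bv ys (enc zs)) k * u (k # zs))
        = (\<Sum>zs\<in>words n. if zs = ys then co (e x \<otimes> e y) k * u (k # zs) else 0)"
      using k ex ey by (intro sum.cong refl) (auto simp: bv_enc)
    then show "(\<Sum>zs\<in>words n. co ((e x \<otimes> e y) \<otimes> bv ys (enc zs)) k * u (k # zs)) = co (e x \<otimes> e y) k * u (k # ys)"
      using xs(4) by simp
  qed
  also have "ev (Suc n) u (s (\<lambda>j. e x \<otimes> v j)) = ev n (\<lambda>zs. u (x # zs)) v"
  proof (cases n)
    case 0
    then have "v = (\<lambda>i. \<zero>)" using xs ey by (simp add: v_def words_0)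
    then show ?thesis using ex by (simp add: ev_def)
  next
    case (Suc n')
    then show ?thesis unfolding v_def by (simp add: ev_s_e_s[OF xs(2)])
  qed
  also have "ev n (\<lambda>zs. u (x # zs)) v = - \<delta> (\<lambda>zs. u (x # zs)) (y # ys)"
    using Suc.IH[OF yys, of "\<lambda>zs. u (x # zs)"] ev_D' by simp
  finally show ?case unfolding xs(1) by simp
qed

lemma ev_bd:
  assumes "z \<in> carrier (FM (Suc n))"
  shows "ev n u (bd n z) = ev (Suc n) (\<delta> u) z"
proof -
  have c: "(\<lambda>z. ev n u (bd n z)) \<in> cochains L (Suc n)"
    using cochains_comp[of "ev n u" L n "bd n" L "Suc n", OF ev_cochain bd_hom] .
  show ?thesis
    unfolding cochain_eq_ev[OF c assms] unfolding ev_def[of "Suc n"]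
    by (rule sum.cong[OF refl]) (simp add: bd_bv ev_D)
qed

text \<open>The value on \<open>[b1 | ... | bn]\<close> of the cochain with values \<open>u\<close>,
  expanded multilinearly through the coordinates. Components along \<one> are dropped, as in the
  normalized bar construction.\<close>

fun mev :: "(nat list \<Rightarrow> int) \<Rightarrow> 'a list \<Rightarrow> int" where
  "mev u [] = u []"
| "mev u (b # bs) = (\<Sum>k<m. co b k * mev (\<lambda>zs. u (k # zs)) bs)"

lemma mev_add: "mev (\<lambda>xs. u xs + v xs) bs = mev u bs + mev v bs"
  by (induction bs arbitrary: u v) (simp_all add: distrib_left sum.distrib)

lemma mev_smult: "mev (\<lambda>xs. c * u xs) bs = c * mev u bs"
  by (induction bs arbitrary: u) (simp_all add: sum_distrib_left algebra_simps)

lemma mev_uminus: "mev (\<lambda>xs. - u xs) bs = - mev u bs"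
  using mev_smult[of "-1" u bs] by simp

lemma mev_zero: "mev (\<lambda>xs. 0) bs = 0"
  using mev_smult[of 0 "\<lambda>xs. 0" bs] by simp

lemma mev_sum: "mev (\<lambda>xs. \<Sum>i\<in>I. u i xs) bs = (\<Sum>i\<in>I. mev (u i) bs)"
  by (induction I rule: infinite_finite_induct) (simp_all add: mev_zero mev_add)

lemma mev_cong: "(\<And>xs. xs \<in> words (length bs) \<Longrightarrow> u xs = v xs) \<Longrightarrow> mev u bs = mev v bs"
proof (induction bs arbitrary: u v)
  case (Cons b bs)
  have "mev (\<lambda>zs. u (k # zs)) bs = mev (\<lambda>zs. v (k # zs)) bs" if "k < m" for k
    by (rule Cons.IH) (use Cons.prems that in \<open>simp add: Cons_words\<close>)
  then show ?case by simp
qed (simp add: words_0)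

lemma co_sum:
  assumes "\<And>i. i \<in> I \<Longrightarrow> x i \<in> carrier R" "k < m"
  shows "co (finsum R x I) k = (\<Sum>i\<in>I. co (x i) k)"
  using assms(1)
proof (induction I rule: infinite_finite_induct)
  case (insert i I)
  then show ?case using assms(2) by (simp add: Pi_def co_add finsum_closed)
qed (use assms(2) in simp_all)

lemma expand_I:
  assumes "a \<in> carrier R" "\<pi> a = 0"
  shows "a = finsum R (\<lambda>i. e i \<otimes> \<iota> (co a i)) {..<m}"
proof -
  have "finsum R (\<lambda>i. e i \<otimes> \<iota> (co a i)) {..<m} \<in> carrier R"
    using e_closed by (intro finsum_closed) auto
  then show ?thesis using expand'[OF assms(1)] assms(2) by simp
qed

lemma co_mult:
  assumes a: "a \<in> carrier R" "\<pi> a = 0" and b: "b \<in> carrier R" "\<pi> b = 0" and k: "k < m"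
  shows "co (a \<otimes> b) k = (\<Sum>i<m. \<Sum>j<m. co a i * co b j * co (e i \<otimes> e j) k)"
proof -
  have eb: "co (e i \<otimes> b) k = (\<Sum>j<m. co b j * co (e i \<otimes> e j) k)" if i: "i < m" for i
  proof -
    have "e i \<otimes> b = finsum R (\<lambda>j. e i \<otimes> (e j \<otimes> \<iota> (co b j))) {..<m}"
      by (subst expand_I[OF b]) (use e_closed i in \<open>auto intro!: finsum_rdistr\<close>)
    then have "co (e i \<otimes> b) k = (\<Sum>j<m. co (e i \<otimes> (e j \<otimes> \<iota> (co b j))) k)"
      using co_sum[of "{..<m}" "\<lambda>j. e i \<otimes> (e j \<otimes> \<iota> (co b j))" k] e_closed i k by simp
    then show ?thesis using e_closed i k by (simp add: m_assoc[symmetric] co_mult_\<iota>)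
  qed
  have "a \<otimes> b = finsum R (\<lambda>i. (e i \<otimes> \<iota> (co a i)) \<otimes> b) {..<m}"
    by (subst expand_I[OF a]) (use e_closed b in \<open>auto intro!: finsum_ldistr\<close>)
  then have "co (a \<otimes> b) k = (\<Sum>i<m. co ((e i \<otimes> \<iota> (co a i)) \<otimes> b) k)"
    using co_sum[of "{..<m}" "\<lambda>i. (e i \<otimes> \<iota> (co a i)) \<otimes> b" k] e_closed b k by simp
  also have "\<dots> = (\<Sum>i<m. co a i * co (e i \<otimes> b) k)"
  proof (rule sum.cong[OF refl])
    fix i assume "i \<in> {..<m}"
    then have "(e i \<otimes> \<iota> (co a i)) \<otimes> b = (e i \<otimes> b) \<otimes> \<iota> (co a i)" "e i \<otimes> b \<in> carrier R"
      using e_closed b by (simp_all add: m_ac)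
    then show "co ((e i \<otimes> \<iota> (co a i)) \<otimes> b) k = co a i * co (e i \<otimes> b) k" using k by (simp add: co_mult_\<iota>)
  qed
  finally show ?thesis by (simp add: eb sum_distrib_left mult.assoc)
qed

text \<open>Products of elements of the ideal lie in the ideal, so the condition makes consecutive
  products divisible by \<open>p\<close>. With integral coefficients every term of the bar
  differential of \<open>[b1 | ... | bn]\<close> then vanishes modulo \<open>p\<close>.\<close>

definition bar_chain :: "int \<Rightarrow> 'a list \<Rightarrow> bool" where
  "bar_chain p bs \<longleftrightarrow> (\<forall>b\<in>set bs. b \<in> carrier R \<and> \<pi> b = 0) \<and>
    successively (\<lambda>a b. \<forall>k<m. p dvd co (a \<otimes> b) k) bs"

text \<open>By \<open>co_mult\<close>, the sum over the first two letters recombines into values of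
  \<open>u\<close> with the pair \<open>b, b'\<close> replaced by its product, whose coordinates are
  divisible by \<open>p\<close>; the other terms fall to the induction hypothesis for the shorter
  list.\<close>

lemma mev_\<delta>_dvd:
  assumes "bar_chain p bs"
  shows "p dvd mev (\<delta> u) bs"
  using assms
proof (induction bs arbitrary: u)
  case (Cons b bs)
  show ?case
  proof (cases bs)
    case Nil
    then show ?thesis by simp
  next
    case (Cons b' bs')
    have b: "b \<in> carrier R" "\<pi> b = 0" "b' \<in> carrier R" "\<pi> b' = 0" "\<And>k. k < m \<Longrightarrow> p dvd co (b \<otimes> b') k"
      and rest: "bar_chain p bs" using Cons.prems Cons by (auto simp: bar_chain_def)
    let ?M = "\<lambda>j. mev (\<lambda>zs. u (j # zs)) bs'"
    have "mev (\<delta> u) (b # bs) = (\<Sum>i<m. \<Sum>j<m. co b i * (co b' j *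
        (- (\<Sum>k<m. co (e i \<otimes> e j) k * ?M k) - mev (\<lambda>zs. \<delta> (\<lambda>zs. u (i # zs)) (j # zs)) bs')))"
    proof -
      have "mev (\<lambda>zs. \<delta> u (i # j # zs)) bs' = - (\<Sum>k<m. co (e i \<otimes> e j) k * ?M k)
          - mev (\<lambda>zs. \<delta> (\<lambda>zs. u (i # zs)) (j # zs)) bs'" for i j
        using mev_add[of "\<lambda>zs. - (\<Sum>k<m. co (e i \<otimes> e j) k * u (k # zs))"
            "\<lambda>zs. - \<delta> (\<lambda>zs. u (i # zs)) (j # zs)" bs']
        by (simp add: mev_uminus mev_sum mev_smult)
      then show ?thesis unfolding Cons by (simp add: sum_distrib_left)
    qed
    also have "\<dots> = - (\<Sum>i<m. \<Sum>j<m. \<Sum>k<m. co b i * co b' j * co (e i \<otimes> e j) k * ?M k)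
        - (\<Sum>i<m. co b i * mev (\<delta> (\<lambda>zs. u (i # zs))) bs)"
      unfolding Cons
      by (simp add: sum_distrib_left sum_subtractf sum_negf algebra_simps)
    also have "(\<Sum>i<m. \<Sum>j<m. \<Sum>k<m. co b i * co b' j * co (e i \<otimes> e j) k * ?M k)
        = (\<Sum>k<m. co (b \<otimes> b') k * ?M k)"
    proof -
      have "(\<Sum>k<m. co (b \<otimes> b') k * ?M k) = (\<Sum>k<m. \<Sum>i<m. \<Sum>j<m. co b i * co b' j * co (e i \<otimes> e j) k * ?M k)"
        by (rule sum.cong[OF refl]) (simp add: co_mult[OF b(1-4)] sum_distrib_right)
      also have "\<dots> = (\<Sum>i<m. \<Sum>k<m. \<Sum>j<m. co b i * co b' j * co (e i \<otimes> e j) k * ?M k)"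
        by (rule sum.swap)
      also have "\<dots> = (\<Sum>i<m. \<Sum>j<m. \<Sum>k<m. co b i * co b' j * co (e i \<otimes> e j) k * ?M k)"
        by (rule sum.cong[OF refl], rule sum.swap)
      finally show ?thesis by simp
    qed
    finally have eq: "mev (\<delta> u) (b # bs) = - (\<Sum>k<m. co (b \<otimes> b') k * ?M k)
        - (\<Sum>i<m. co b i * mev (\<delta> (\<lambda>zs. u (i # zs))) bs)" .
    show ?thesis unfolding eq using b(5) Cons.IH[OF rest]
      by (intro dvd_diff iffD2[OF dvd_minus_iff] dvd_sum) auto
  qed
qed simp

lemma ev_cocycle:
  assumes "\<And>xs. xs \<in> words (Suc n) \<Longrightarrow> \<delta> u xs = 0"
  shows "ev n u \<in> cocycles L bd n"
  using assms ev_cochain by (auto simp: cocycles_def ev_bd ev_def[of "Suc n"])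

text \<open>A cocycle is an integer vector on the finite set of words subject to linear equations,
  so the cocycles form a lattice and \<open>int_lattice_basis\<close> applies.\<close>

lemma cocycles_finitely_generated:
  "\<exists>(r :: nat) us. (\<forall>i<r. us i \<in> cocycles L bd n) \<and>
    (\<forall>f\<in>cocycles L bd n. \<exists>c :: nat \<Rightarrow> int. \<forall>x\<in>carrier (FM n). f x = (\<Sum>i<r. c i * us i x))"
proof -
  define U where "U = {u. (\<forall>xs. xs \<notin> words n \<longrightarrow> u xs = 0) \<and> (\<forall>xs\<in>words (Suc n). ev n u (D xs) = 0)}"
  have U3: "\<forall>u\<in>U. \<forall>v\<in>U. (\<lambda>x. u x - v x) \<in> U"
    by (auto simp: U_def ev_def right_diff_distrib sum_subtractf)
  have "(\<lambda>xs. 0) \<in> U" by (simp add: U_def ev_def)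
  then have U2: "U \<noteq> {}" by blast
  have U1: "\<forall>u\<in>U. \<forall>x. x \<notin> words n \<longrightarrow> u x = 0" by (simp add: U_def)
  obtain r :: nat and b and c :: "(nat list \<Rightarrow> int) \<Rightarrow> nat \<Rightarrow> int"
    where b: "\<And>i. i < r \<Longrightarrow> b i \<in> U" and c: "\<And>u x. u \<in> U \<Longrightarrow> u x = (\<Sum>i<r. c u i * b i x)"
    using int_lattice_basis[OF finite_words U1 U2 U3] by blast
  have coc: "ev n u \<in> cocycles L bd n" if "u \<in> U" for u
    using that by (intro ev_cocycle) (simp add: U_def ev_D)
  have "\<exists>c :: nat \<Rightarrow> int. \<forall>x\<in>carrier (FM n). f x = (\<Sum>i<r. c i * ev n (b i) x)" if f: "f \<in> cocycles L bd n" for f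
  proof -
    define u where "u = (\<lambda>xs. if xs \<in> words n then f (bv xs) else 0)"
    have fc: "f \<in> cochains L n" using f by (simp add: cocycles_def)
    have fu: "f x = ev n u x" if "x \<in> carrier (FM n)" for x
      unfolding cochain_eq_ev[OF fc that] by (simp add: ev_def u_def)
    have "ev n u (D xs) = 0" if "xs \<in> words (Suc n)" for xs
    proof -
      have "f (bd n (bv xs)) = 0" using f bv_closed[OF that] by (simp add: cocycles_def)
      then show ?thesis using fu[OF D_closed[OF that]] that by (simp add: bd_bv)
    qed
    then have "u \<in> U" by (simp add: U_def u_def)
    have "f x = (\<Sum>i<r. c u i * ev n (b i) x)" if "x \<in> carrier (FM n)" for x
    proof -
      have "ev n u x = (\<Sum>xs\<in>words n. \<Sum>i<r. c u i * (\<pi> (x (enc xs)) * b i xs))"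
        unfolding ev_def
        by (rule sum.cong[OF refl], subst c[OF \<open>u \<in> U\<close>]) (simp add: sum_distrib_left algebra_simps)
      also have "\<dots> = (\<Sum>i<r. \<Sum>xs\<in>words n. c u i * (\<pi> (x (enc xs)) * b i xs))" by (rule sum.swap)
      finally show ?thesis by (simp add: fu[OF that] ev_def sum_distrib_left)
    qed
    then show ?thesis by blast
  qed
  then show ?thesis using b coc by (intro exI[of _ r] exI[of _ "\<lambda>i. ev n (b i)"]) auto
qed

section \<open>Cup product classes and the cycles modulo \<open>p\<close> dual to them\<close>

lemma additive_expand:
  assumes add: "\<And>a b. a \<in> carrier R \<Longrightarrow> b \<in> carrier R \<Longrightarrow> h (a \<oplus> b) = h a + (h b :: int)"
    and a: "a \<in> carrier R"
  shows "h a = \<pi> a * h \<one> + (\<Sum>k<m. co a k * h (e k))"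
proof -
  have 0: "h \<zero> = 0" using add[of \<zero> \<zero>] by simp
  have neg: "h (\<ominus> x) = - h x" if "x \<in> carrier R" for x
    using add[of x "\<ominus> x"] that by (simp add: r_neg 0)
  show ?thesis
    using a
  proof (induction rule: lattice_induct)
    case (e i)
    have "(\<Sum>k<m. co (e i) k * h (e k)) = (\<Sum>k<m. if i = k then h (e k) else 0)"
      using e by (intro sum.cong refl) (simp add: co_e)
    then show ?case using e by (simp add: \<pi>_e)
  next
    case (add a b)
    then show ?case using assms(1)[of a b] by (simp add: \<pi>_add co_add distrib_right sum.distrib)
  next
    case (uminus a)
    then show ?case by (simp add: neg \<pi>_uminus co_uminus sum_negf)
  qed (simp add: \<pi>_one co_one)
qed

lemma additive_mult_\<iota>:
  assumes add: "\<And>a b. a \<in> carrier R \<Longrightarrow> b \<in> carrier R \<Longrightarrow> h (a \<oplus> b) = h a + (h b :: int)"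
    and x: "x \<in> carrier R"
  shows "h (x \<otimes> \<iota> c) = c * h x"
proof -
  have 0: "h \<zero> = 0" using add[of \<zero> \<zero>] by simp
  have neg: "h (\<ominus> x) = - h x" if "x \<in> carrier R" for x
    using add[of x "\<ominus> x"] that by (simp add: r_neg 0)
  show ?thesis
  proof (induction c rule: int_induct[where k = 0])
    case (step1 j)
    then show ?case using x by (simp add: \<iota>_add r_distr add algebra_simps)
  next
    case (step2 j)
    have "\<iota> (j - 1) = \<iota> j \<oplus> \<ominus> \<one>" using \<iota>_add[of j "-1"] \<iota>_uminus[of 1] by simp
    then show ?case using step2 x by (simp add: r_distr r_minus add neg algebra_simps)
  qed (use x 0 in simp)
qed

lemma \<delta>_smult: "\<delta> (\<lambda>xs. c * u xs) xs = c * \<delta> u xs"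
proof (induction u xs rule: \<delta>.induct)
  case (1 u x y ys)
  have "(\<Sum>k<m. co (e x \<otimes> e y) k * (c * u (k # ys))) = c * (\<Sum>k<m. co (e x \<otimes> e y) k * u (k # ys))"
    by (simp add: sum_distrib_left algebra_simps)
  then show ?case using 1 by (simp add: algebra_simps)
qed simp_all

text \<open>
  If \<open>g\<close> is additive and takes values divisible by \<open>p\<close> on products of two elements of the augmentation
  ideal, then \<open>(a, b) \<mapsto> g (a b) / p\<close> is an integral 2-cocycle.  An element \<open>f\<close> of the augmentation
  ideal that acts on \<open>b\<close> as the integer \<open>q p\<close> turns \<open>[f | b]\<close> into a cycle modulo \<open>p\<close>, on which
  this cocycle takes the value \<open>q g(b)\<close>.
\<close>

context
  fixes p q :: int and g :: "bool \<Rightarrow> 'a \<Rightarrow> int" and f :: 'a and b :: "bool \<Rightarrow> 'a"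
  assumes p: "prime p" and q: "\<not> p dvd q"
    and g_add: "\<And>i a b. a \<in> carrier R \<Longrightarrow> b \<in> carrier R \<Longrightarrow> g i (a \<oplus> b) = g i a + g i b"
    and g_mult: "\<And>i a b. a \<in> carrier R \<Longrightarrow> b \<in> carrier R \<Longrightarrow> \<pi> a = 0 \<Longrightarrow> \<pi> b = 0 \<Longrightarrow> p dvd g i (a \<otimes> b)"
    and f: "f \<in> carrier R" "\<pi> f = 0" and b: "\<And>i. b i \<in> carrier R" "\<And>i. \<pi> (b i) = 0"
    and fb: "\<And>i. f \<otimes> b i = b i \<otimes> \<iota> (q * p)"
    and dual: "\<And>i j. p dvd g i (b j) \<longleftrightarrow> i \<noteq> j"
begin

definition c2 :: "bool \<Rightarrow> nat \<Rightarrow> nat \<Rightarrow> int" where "c2 i x y = g i (e x \<otimes> e y) div p"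

lemma c2_mult: "x < m \<Longrightarrow> y < m \<Longrightarrow> c2 i x y * p = g i (e x \<otimes> e y)"
  unfolding c2_def using g_mult[of "e x" "e y" i] e_closed \<pi>_e by simp

lemma c2_left:
  assumes "a \<in> carrier R" "\<pi> a = 0" "z < m"
  shows "(\<Sum>k<m. co a k * c2 i k z) * p = g i (a \<otimes> e z)"
proof -
  note ez = e_closed[OF assms(3)]
  have "g i (a \<otimes> e z) = (\<Sum>k<m. co a k * g i (e k \<otimes> e z))"
    using additive_expand[of "\<lambda>a. g i (a \<otimes> e z)" a] assms(1,2) ez by (simp add: l_distr g_add)
  also have "\<dots> = (\<Sum>k<m. co a k * c2 i k z) * p"
    unfolding sum_distrib_right by (rule sum.cong[OF refl]) (use assms(3) in \<open>simp add: c2_mult[symmetric]\<close>)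
  finally show ?thesis by simp
qed

lemma c2_right:
  assumes "a \<in> carrier R" "\<pi> a = 0" "z < m"
  shows "(\<Sum>k<m. co a k * c2 i z k) * p = g i (e z \<otimes> a)"
proof -
  note ez = e_closed[OF assms(3)]
  have "g i (e z \<otimes> a) = (\<Sum>k<m. co a k * g i (e z \<otimes> e k))"
    using additive_expand[of "\<lambda>a. g i (e z \<otimes> a)" a] assms(1,2) ez by (simp add: r_distr g_add)
  also have "\<dots> = (\<Sum>k<m. co a k * c2 i z k) * p"
    unfolding sum_distrib_right by (rule sum.cong[OF refl]) (use assms(3) in \<open>simp add: c2_mult[symmetric]\<close>)
  finally show ?thesis by simp
qed

text \<open>Associativity: multiplied by \<open>p\<close>, both sides become
  \<open>g i (e x \<otimes> e y \<otimes> e z)\<close>.\<close>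

lemma c2_cocycle:
  assumes "x < m" "y < m" "z < m"
  shows "(\<Sum>k<m. co (e x \<otimes> e y) k * c2 i k z) = (\<Sum>k<m. co (e y \<otimes> e z) k * c2 i x k)"
proof -
  have "(\<Sum>k<m. co (e x \<otimes> e y) k * c2 i k z) * p = (\<Sum>k<m. co (e y \<otimes> e z) k * c2 i x k) * p"
    using assms e_closed \<pi>_e by (simp add: c2_left c2_right \<pi>_mult m_assoc)
  then show ?thesis using p by auto
qed

text \<open>The iterated cup product of the degree 2 cocycles \<open>c2 i\<close>, taken along the
  word.\<close>

fun wc :: "bool list \<Rightarrow> nat list \<Rightarrow> int" where
  "wc [] [] = 1"
| "wc (i # w) (x # y # xs) = c2 i x y * wc w xs"
| "wc _ _ = 0"

text \<open>Leibniz rule: products within the first three letters give the two sides of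
  \<open>c2_cocycle\<close> with opposite signs, and what remains is \<open>c2 i x y\<close> times
  the coboundary of the shorter cup product.\<close>

lemma \<delta>_wc: "xs \<in> words (Suc (2 * length w)) \<Longrightarrow> \<delta> (wc w) xs = 0"
proof (induction w arbitrary: xs)
  case Nil
  then show ?case by (auto simp: words_Suc words_0)
next
  case (Cons i w)
  then obtain x y z zs where xs: "xs = x # y # z # zs" "x < m" "y < m" "z < m" "z # zs \<in> words (Suc (2 * length w))"
    by (auto simp: words_def length_Suc_conv)
  have "\<delta> (wc (i # w)) xs = - (\<Sum>k<m. co (e x \<otimes> e y) k * c2 i k z) * wc w zs
      + (\<Sum>k<m. co (e y \<otimes> e z) k * c2 i x k) * wc w zs + c2 i x y * \<delta> (wc w) (z # zs)"
    unfolding xs(1) by (simp add: \<delta>_smult sum_distrib_right mult.assoc)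
  then show ?case using Cons.IH[OF xs(5)] c2_cocycle[OF xs(2-4)] by simp
qed

fun cyc :: "bool list \<Rightarrow> 'a list" where
  "cyc [] = []"
| "cyc (i # w) = f # b i # cyc w"

lemma length_cyc [simp]: "length (cyc w) = 2 * length w" by (induction w) auto

lemma co_fb: "k < m \<Longrightarrow> p dvd co (f \<otimes> b i) k"
  by (simp add: fb co_mult_\<iota> b)

text \<open>Interleaving with \<open>f\<close> makes each consecutive product
  \<open>f \<otimes> b i\<close> or \<open>b i \<otimes> f\<close>, both equal to \<open>b i\<close>
  times the integer \<open>q * p\<close>.\<close>

lemma bar_chain_cyc: "bar_chain p (cyc w)"
proof -
  \<comment> \<open>The leading \<open>b i\<close> strengthens the induction so that the adjacency
    of \<open>b i\<close> and the next \<open>f\<close>, between two blocks, is covered as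
    well.\<close>
  have s: "successively (\<lambda>a b. \<forall>k<m. p dvd co (a \<otimes> b) k) (b i # cyc w)" for i
    by (induction w arbitrary: i) (auto simp: co_fb, auto simp: m_comm[OF b(1) f(1)] co_fb)
  have "set (cyc w) \<subseteq> insert f (range b)" by (induction w) auto
  moreover have "successively (\<lambda>a b. \<forall>k<m. p dvd co (a \<otimes> b) k) (cyc w)"
    using s[of True] by (cases "cyc w") auto
  ultimately show ?thesis using f b by (auto simp: bar_chain_def)
qed

text \<open>The pairing is multiplicative over blocks of two. For one block, \<open>p\<close> times
  the pairing is \<open>g i (f \<otimes> b j)\<close>, that is \<open>q * p * g i (b j)\<close>: the
  division by \<open>p\<close> in \<open>c2\<close> cancels the \<open>p\<close> in the action of
  \<open>f\<close>.\<close>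

lemma mev_wc_Cons: "mev (wc (i # w)) (cyc (j # v)) = q * g i (b j) * mev (wc w) (cyc v)"
proof -
  have "mev (wc (i # w)) (cyc (j # v)) = (\<Sum>k<m. co f k * (\<Sum>l<m. co (b j) l * c2 i k l)) * mev (wc w) (cyc v)"
    by (simp add: mev_smult sum_distrib_left sum_distrib_right mult.assoc)
  moreover have "(\<Sum>k<m. co f k * (\<Sum>l<m. co (b j) l * c2 i k l)) = q * g i (b j)"
  proof -
    have "(\<Sum>k<m. co f k * (\<Sum>l<m. co (b j) l * c2 i k l)) * p = (\<Sum>k<m. co f k * g i (e k \<otimes> b j))"
      unfolding sum_distrib_right by (rule sum.cong[OF refl]) (simp add: c2_right b mult.assoc)
    also have "\<dots> = g i (f \<otimes> b j)"
      using additive_expand[of "\<lambda>a. g i (a \<otimes> b j)" f] f b(1)[of j] by (simp add: l_distr g_add)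
    also have "\<dots> = q * g i (b j) * p"
      unfolding fb using additive_mult_\<iota>[of "g i" "b j" "q * p"] g_add b(1) by simp
    finally show ?thesis using p by auto
  qed
  ultimately show ?thesis by simp
qed

text \<open>The pairing matrix is diagonal modulo \<open>p\<close> with units on the diagonal: a
  letter in which the words differ contributes a factor divisible by \<open>p\<close>, while for
  equal words all factors \<open>q\<close> and \<open>g i (b i)\<close> are prime to
  \<open>p\<close>.\<close>

lemma p_dvd_mev_wc: "length w = length v \<Longrightarrow> p dvd mev (wc w) (cyc v) \<longleftrightarrow> w \<noteq> v"
proof (induction w v rule: list_induct2)
  case Nil
  then show ?case using p by (auto simp: not_prime_unit)
next
  case (Cons i w j v)
  then show ?case unfolding mev_wc_Cons using p q dual by (auto simp: prime_dvd_mult_iff)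
qed

theorem Hom_cohomology_rank_power:
  fixes B :: "nat \<Rightarrow> 'i set"
  assumes res: "free_resolution R N B d \<epsilon>" and l: "l \<ge> 1"
  shows "2 ^ l \<le> group_rank (Hom_cohomology R B d N (2 * l))"
proof -
  define k where "k = 2 * l - 1"
  have k: "Suc k = 2 * l" using l by (simp add: k_def)
  define W where "W = {w :: bool list. length w = l}"
  define \<Theta> where "\<Theta> = (\<lambda>f w. mev (\<lambda>xs. f (bv xs)) (cyc w))"
  have W: "finite W" "card W = 2 ^ l"
    using finite_lists_length_eq[of "UNIV :: bool set" l] card_lists_length_eq[of "UNIV :: bool set" l]
    by (simp_all add: W_def)
  obtain r us where us: "\<And>i. i < r \<Longrightarrow> us i \<in> cocycles L bd (Suc k)"
    and gen: "\<And>f. f \<in> cocycles L bd (Suc k) \<Longrightarrow>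
      \<exists>c :: nat \<Rightarrow> int. \<forall>x\<in>carrier (FM (Suc k)). f x = (\<Sum>i<r. c i * us i x)"
    using cocycles_finitely_generated[of "Suc k"] by blast
  have lenW: "2 * length w = Suc k" if "w \<in> W" for w using that k by (simp add: W_def)
  have "card W \<le> group_rank (Hom_cohomology R B d N (Suc k))"
  proof (rule Hom_cohomology_rank_transfer[OF N res bar_resolution _ W(1) us gen, where \<Theta> = \<Theta> and p = p])
    show "p > 1" using p by (rule prime_gt_1_int)
  next
    fix f f' :: "('i \<Rightarrow> 'a) \<Rightarrow> int" and w assume "\<forall>x\<in>carrier (FM (Suc k)). f x = f' x" "w \<in> W"
    then show "\<Theta> f w = \<Theta> f' w"
      unfolding \<Theta>_def by (intro mev_cong) (simp add: lenW bv_closed)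
  next
    fix h w assume h: "h \<in> cochains L k" and w: "w \<in> W"
    have "\<Theta> (\<lambda>x. h (bd k x)) w = mev (\<delta> (\<lambda>xs. h (bv xs))) (cyc w)"
      unfolding \<Theta>_def
    proof (rule mev_cong)
      fix xs assume "xs \<in> words (length (cyc w))"
      then have xs: "xs \<in> words (Suc k)" using w lenW by simp
      then show "h (bd k (bv xs)) = \<delta> (\<lambda>xs. h (bv xs)) xs"
        using cochain_eq_ev[OF h D_closed[OF xs]] by (simp add: bd_bv ev_D)
    qed
    then show "p dvd \<Theta> (\<lambda>x. h (bd k x)) w" using mev_\<delta>_dvd[OF bar_chain_cyc] by simp
  next
    fix t :: "bool list \<Rightarrow> int"
    \<comment> \<open>Diagonal entries are invertible modulo \<open>p\<close>, so each class can be
      scaled to realize the prescribed value at its dual cycle.\<close>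
    have "\<exists>a. [a * mev (wc w) (cyc w) = t w] (mod p)" for w
    proof -
      have "coprime (mev (wc w) (cyc w)) p"
        using p_dvd_mev_wc[of w w] p by (simp add: prime_imp_coprime coprime_commute)
      then obtain x where "[mev (wc w) (cyc w) * x = 1] (mod p)" using cong_solve_coprime_int by blast
      then have "[(t w * x) * mev (wc w) (cyc w) = t w] (mod p)"
        using cong_scalar_left[of "mev (wc w) (cyc w) * x" 1 p "t w"] by (simp add: algebra_simps)
      then show ?thesis by blast
    qed
    then obtain a where a: "\<And>w. [a w * mev (wc w) (cyc w) = t w] (mod p)" by metis
    define F where "F = (\<lambda>x. \<Sum>w\<in>W. a w * ev (Suc k) (wc w) x)"
    have coc: "ev (Suc k) (wc w) \<in> cocycles L bd (Suc k)" if "w \<in> W" for w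
      by (rule ev_cocycle, rule \<delta>_wc) (use that k in \<open>simp add: W_def\<close>)
    have "F \<in> cocycles L bd (Suc k)"
      unfolding F_def by (rule cocycles_sum, rule cocycles_smult, rule coc)
    moreover have "[\<Theta> F v = t v] (mod p)" if v: "v \<in> W" for v
    proof -
      have "\<Theta> F v = mev (\<lambda>xs. \<Sum>w\<in>W. a w * wc w xs) (cyc v)"
        unfolding \<Theta>_def F_def by (rule mev_cong) (simp add: lenW[OF v] ev_bv)
      also have "\<dots> = (\<Sum>w\<in>W. a w * mev (wc w) (cyc v))" by (simp add: mev_sum mev_smult)
      also have "\<dots> = a v * mev (wc v) (cyc v) + (\<Sum>w\<in>W - {v}. a w * mev (wc w) (cyc v))"
        by (rule sum.remove[OF W(1) v])
      finally have "\<Theta> F v = a v * mev (wc v) (cyc v) + (\<Sum>w\<in>W - {v}. a w * mev (wc w) (cyc v))" .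
      moreover have "p dvd (\<Sum>w\<in>W - {v}. a w * mev (wc w) (cyc v))"
        using p_dvd_mev_wc v by (intro dvd_sum) (auto simp: W_def)
      ultimately show ?thesis using cong_add[OF a[of v], of _ 0] by (simp add: cong_0_iff)
    qed
    ultimately show "\<exists>f\<in>cocycles L bd (Suc k). \<forall>w\<in>W. [\<Theta> f w = t w] (mod p)" by blast
  qed (simp_all add: \<Theta>_def mev_add)
  then show ?thesis using W(2) k by simp
qed

end

end

section \<open>Finite G-sets and their marks\<close>

locale finite_group = group G for G (structure) +
  assumes finite_carrier: "finite (carrier G)"
begin

lemma finite_gsetI:
  assumes "finite X" "\<And>g x. g \<in> carrier G \<Longrightarrow> x \<in> X \<Longrightarrow> a g x \<in> X" "\<And>x. x \<in> X \<Longrightarrow> a \<one> x = x"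
    "\<And>g h x. g \<in> carrier G \<Longrightarrow> h \<in> carrier G \<Longrightarrow> x \<in> X \<Longrightarrow> a (g \<otimes> h) x = a g (a h x)"
  shows "finite_gset G (X, \<lambda>g. \<lambda>x\<in>X. a g x)"
proof -
  have bij: "bij_betw (\<lambda>x\<in>X. a g x) X X" if g: "g \<in> carrier G" for g
    by (rule bij_betw_byWitness[of _ "\<lambda>x. a (inv g) x"])
      (use g assms(2,3) assms(4)[of g "inv g"] assms(4)[of "inv g" g] in \<open>auto simp: r_inv l_inv\<close>)
  have "group_hom G (BijGroup X) (\<lambda>g. \<lambda>x\<in>X. a g x)"
  proof (intro group_hom.intro group_hom_axioms.intro is_group group_BijGroup homI)
    fix g assume g: "g \<in> carrier G"
    then show "(\<lambda>x\<in>X. a g x) \<in> carrier (BijGroup X)" using bij by (simp add: BijGroup_def Bij_def)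
    fix h assume h: "h \<in> carrier G"
    have "(\<lambda>x\<in>X. a g x) \<in> Bij X" "(\<lambda>x\<in>X. a h x) \<in> Bij X" using bij g h by (simp_all add: Bij_def)
    then show "(\<lambda>x\<in>X. a (g \<otimes> h) x) = (\<lambda>x\<in>X. a g x) \<otimes>\<^bsub>BijGroup X\<^esub> (\<lambda>x\<in>X. a h x)"
      using g h assms by (auto simp: BijGroup_def compose_def fun_eq_iff)
  qed
  then show ?thesis using assms(1) by (simp add: finite_gset_def group_action_def)
qed

lemma gset_action:
  assumes "finite_gset G X"
  shows "finite (fst X)" "g \<in> carrier G \<Longrightarrow> x \<in> fst X \<Longrightarrow> snd X g x \<in> fst X" "x \<in> fst X \<Longrightarrow> snd X \<one> x = x"
    "g \<in> carrier G \<Longrightarrow> h \<in> carrier G \<Longrightarrow> x \<in> fst X \<Longrightarrow> snd X (g \<otimes> h) x = snd X g (snd X h x)"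
    "g \<in> carrier G \<Longrightarrow> x \<in> fst X \<Longrightarrow> snd X (inv g) (snd X g x) = x"
    "g \<in> carrier G \<Longrightarrow> x \<in> fst X \<Longrightarrow> snd X g (snd X (inv g) x) = x"
proof -
  interpret A: group_action G "fst X" "snd X" using assms by (simp add: finite_gset_def)
  show "finite (fst X)" using assms by (simp add: finite_gset_def)
  show cl: "snd X g x \<in> fst X" if "g \<in> carrier G" "x \<in> fst X" for g x
    using A.element_image that by blast
  show id: "snd X \<one> x = x" if "x \<in> fst X" for x using A.id_eq_one that by (metis restrict_apply')
  show comp: "snd X (g \<otimes> h) x = snd X g (snd X h x)" if "g \<in> carrier G" "h \<in> carrier G" "x \<in> fst X" for g h x
    using A.composition_rule that by blast
  show "snd X (inv g) (snd X g x) = x" if "g \<in> carrier G" "x \<in> fst X"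
    using comp[of "inv g" g x] id that by simp
  show "snd X g (snd X (inv g) x) = x" if "g \<in> carrier G" "x \<in> fst X"
    using comp[of g "inv g" x] id that by simp
qed

text \<open>The default 0 off subgroups makes equality of mark vectors as functions the same as
  equality of the marks at all subgroups.\<close>

definition mk :: "('a, 'x) gset \<Rightarrow> 'a set \<Rightarrow> int" where
  "mk X H = (if subgroup H G then int (card (fixed_points H X)) else 0)"

lemma mk_iso:
  assumes X: "finite_gset G X" and iso: "gset_iso G X Y"
  shows "mk X = mk Y"
proof
  fix H
  obtain f where f: "bij_betw f (fst X) (fst Y)"
    "\<And>g x. g \<in> carrier G \<Longrightarrow> x \<in> fst X \<Longrightarrow> f (snd X g x) = snd Y g (f x)"
    using iso by (auto simp: gset_iso_def)
  show "mk X H = mk Y H"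
  proof (cases "subgroup H G")
    case True
    have fx: "f x \<in> fst Y" if "x \<in> fst X" for x using f(1) that by (auto simp: bij_betw_def)
    have "snd X h x = x \<longleftrightarrow> snd Y h (f x) = f x" if "h \<in> H" "x \<in> fst X" for h x
    proof -
      have h: "h \<in> carrier G" using True that by (meson subgroup.mem_carrier)
      have "snd X h x \<in> fst X" using gset_action(2)[OF X h that(2)] .
      then have "f (snd X h x) = f x \<longleftrightarrow> snd X h x = x"
        using f(1) that by (auto simp: bij_betw_def dest: inj_onD)
      then show ?thesis using f(2)[OF h that(2)] by simp
    qed
    then have fp: "x \<in> fixed_points H X \<longleftrightarrow> f x \<in> fixed_points H Y" if "x \<in> fst X" for x
      using fx that by (auto simp: fixed_points_def)
    have sub: "fixed_points H X \<subseteq> fst X" "fixed_points H Y \<subseteq> f ` fst X"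
      using f(1) by (auto simp: fixed_points_def bij_betw_def)
    have "f ` fixed_points H X = fixed_points H Y"
    proof (rule equalityI; rule subsetI)
      fix y assume "y \<in> f ` fixed_points H X"
      then show "y \<in> fixed_points H Y" using fp sub(1) by blast
    next
      fix y assume y: "y \<in> fixed_points H Y"
      then obtain x where "x \<in> fst X" "y = f x" using sub(2) by blast
      then show "y \<in> f ` fixed_points H X" using fp y by blast
    qed
    moreover have "inj_on f (fixed_points H X)"
      using f(1) sub(1) by (auto simp: bij_betw_def intro: inj_on_subset)
    ultimately have "card (fixed_points H X) = card (fixed_points H Y)" by (metis card_image)
    then show ?thesis by (simp add: mk_def)
  qed (simp add: mk_def)
qed

lemma nat_copy:
  fixes X :: "('a, 'x) gset"
  assumes X: "finite_gset G X"
  obtains Y :: "('a, nat) gset" where "finite_gset G Y" "gset_iso G X Y"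
proof -
  obtain f :: "'x \<Rightarrow> nat" where f: "inj_on f (fst X)"
    using finite_imp_inj_to_nat_seg[OF gset_action(1)[OF X]] by blast
  let ?i = "inv_into (fst X) f"
  let ?Y = "(f ` fst X, \<lambda>g. \<lambda>y\<in>f ` fst X. f (snd X g (?i y)))"
  note act = gset_action[OF X]
  have "finite_gset G ?Y"
    by (rule finite_gsetI) (use act f in \<open>auto simp: inv_into_f_f\<close>)
  moreover have "gset_iso G X ?Y"
    unfolding gset_iso_def using f act(2)
    by (intro exI[of _ f]) (auto simp: bij_betw_def inv_into_f_f)
  ultimately show thesis by (rule that)
qed

lemma finite_gset_sum:
  assumes "finite_gset G X" "finite_gset G Y"
  shows "finite_gset G (gset_sum X Y)"
  unfolding gset_sum_def
  by (rule finite_gsetI) (auto simp: gset_action(1-4)[OF assms(1)] gset_action(1-4)[OF assms(2)])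

lemma finite_gset_prod:
  assumes "finite_gset G X" "finite_gset G Y"
  shows "finite_gset G (gset_prod X Y)"
  unfolding gset_prod_def
  by (rule finite_gsetI) (auto simp: gset_action(1-4)[OF assms(1)] gset_action(1-4)[OF assms(2)])

lemma finite_gset_empty: "finite_gset G gset_empty"
  unfolding gset_empty_def by (rule finite_gsetI) auto

lemma finite_gset_point: "finite_gset G gset_point"
  unfolding gset_point_def by (rule finite_gsetI) auto

lemma finite_fixed_points: "finite_gset G X \<Longrightarrow> finite (fixed_points H X)"
  using gset_action(1)[of X] by (simp add: fixed_points_def)

lemma mk_sum:
  assumes "finite_gset G X" "finite_gset G Y"
  shows "mk (gset_sum X Y) H = mk X H + mk Y H"
proof -
  have "fixed_points H (gset_sum X Y) = Sum_Type.Plus (fixed_points H X) (fixed_points H Y)"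
    by (auto simp: fixed_points_def gset_sum_def)
  then show ?thesis using finite_fixed_points[OF assms(1), of H] finite_fixed_points[OF assms(2), of H]
    by (simp add: mk_def card_Plus)
qed

lemma mk_prod: "mk (gset_prod X Y) H = mk X H * mk Y H"
proof -
  have "fixed_points H (gset_prod X Y) = fixed_points H X \<times> fixed_points H Y"
    by (auto simp: fixed_points_def gset_prod_def)
  then show ?thesis by (simp add: mk_def card_cartesian_product)
qed

lemma mk_empty: "mk gset_empty H = 0"
  by (simp add: mk_def fixed_points_def gset_empty_def)

lemma mk_point: "mk gset_point H = (if subgroup H G then 1 else 0)"
proof -
  have "fixed_points H gset_point = {0}" by (auto simp: fixed_points_def gset_point_def)
  then show ?thesis by (simp add: mk_def)
qed

section \<open>Stabilizers, orbits and recovery of a G-set from its marks\<close>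

definition stab :: "('a, 'x) gset \<Rightarrow> 'x \<Rightarrow> 'a set" where
  "stab X x = {g \<in> carrier G. snd X g x = x}"

lemma stab_subgroup: "finite_gset G X \<Longrightarrow> x \<in> fst X \<Longrightarrow> subgroup (stab X x) G"
  using group_action.stabilizer_subgroup[of G "fst X" "snd X" x]
  by (simp add: finite_gset_def stab_def stabilizer_def)

lemma fixed_points_iff_stab:
  "H \<subseteq> carrier G \<Longrightarrow> x \<in> fixed_points H X \<longleftrightarrow> x \<in> fst X \<and> H \<subseteq> stab X x"
  by (auto simp: fixed_points_def stab_def)

definition gset_restrict :: "('a, 'x) gset \<Rightarrow> 'x set \<Rightarrow> ('a, 'x) gset" where
  "gset_restrict X A = (A, \<lambda>g. \<lambda>x\<in>A. snd X g x)"

lemma finite_gset_restrict: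
  assumes "finite_gset G X" "A \<subseteq> fst X" "\<And>g x. g \<in> carrier G \<Longrightarrow> x \<in> A \<Longrightarrow> snd X g x \<in> A"
  shows "finite_gset G (gset_restrict X A)"
proof -
  have A: "x \<in> A \<Longrightarrow> x \<in> fst X" for x using assms(2) by blast
  have "finite A" by (rule finite_subset[OF assms(2) gset_action(1)[OF assms(1)]])
  then show ?thesis
    unfolding gset_restrict_def
    by (intro finite_gsetI) (simp_all add: gset_action[OF assms(1)] A assms(3))
qed

lemma fixed_points_restrict: "A \<subseteq> fst X \<Longrightarrow> fixed_points H (gset_restrict X A) = fixed_points H X \<inter> A"
  by (auto simp: fixed_points_def gset_restrict_def)

lemma mk_restrict_split:
  assumes "finite_gset G X" "A \<subseteq> fst X"
  shows "mk X H = mk (gset_restrict X A) H + mk (gset_restrict X (fst X - A)) H"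
proof -
  have "fixed_points H X = (fixed_points H X \<inter> A) \<union> (fixed_points H X \<inter> (fst X - A))"
    by (auto simp: fixed_points_def)
  then have "card (fixed_points H X) = card (fixed_points H X \<inter> A) + card (fixed_points H X \<inter> (fst X - A))"
    using finite_fixed_points[OF assms(1), of H] by (metis Diff_disjoint Int_Diff_disjoint card_Un_disjoint finite_Int inf_left_commute inf_assoc inf_bot_right)
  then show ?thesis using assms(2) by (simp add: mk_def fixed_points_restrict)
qed

text \<open>Send \<open>g x\<close> to \<open>g y\<close>. This is well defined and injective since
  \<open>g x = h x\<close> and \<open>g y = h y\<close> both say that
  \<open>inv h \<otimes> g\<close> lies in the common stabilizer.\<close>

lemma orbit_iso:
  fixes X :: "('a, 'x) gset" and Y :: "('a, 'y) gset"
  assumes X: "finite_gset G X" and Y: "finite_gset G Y" and x: "x \<in> fst X" and y: "y \<in> fst Y"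
    and st: "stab X x = stab Y y"
  obtains f where "bij_betw f (orbit G (snd X) x) (orbit G (snd Y) y)"
    "\<And>g z. g \<in> carrier G \<Longrightarrow> z \<in> orbit G (snd X) x \<Longrightarrow> f (snd X g z) = snd Y g (f z)"
proof -
  note aX = gset_action[OF X] and aY = gset_action[OF Y]
  have key: "snd X g x = snd X h x \<longleftrightarrow> snd Y g y = snd Y h y" if g: "g \<in> carrier G" and h: "h \<in> carrier G" for g h
  proof -
    have "snd X g x = snd X h x \<longleftrightarrow> snd X (inv h \<otimes> g) x = x"
      using aX(4)[of "inv h" g x] aX(5)[of h x] aX(6)[of h "snd X g x"] aX(2)[of g x] g h x by force
    moreover have "snd Y g y = snd Y h y \<longleftrightarrow> snd Y (inv h \<otimes> g) y = y"
      using aY(4)[of "inv h" g y] aY(5)[of h y] aY(6)[of h "snd Y g y"] aY(2)[of g y] g h y by force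
    moreover have "snd X (inv h \<otimes> g) x = x \<longleftrightarrow> snd Y (inv h \<otimes> g) y = y"
      using st g h by (auto simp: stab_def)
    ultimately show ?thesis by simp
  qed
  define f where "f = (\<lambda>z. snd Y (SOME g. g \<in> carrier G \<and> snd X g x = z) y)"
  have f: "f (snd X g x) = snd Y g y" if "g \<in> carrier G" for g
  proof -
    have "\<exists>h. h \<in> carrier G \<and> snd X h x = snd X g x" using that by blast
    from someI_ex[OF this] show ?thesis unfolding f_def using key that by blast
  qed
  show thesis
  proof (rule that[of f])
    show "bij_betw f (orbit G (snd X) x) (orbit G (snd Y) y)"
    proof (rule bij_betw_imageI)
      show "inj_on f (orbit G (snd X) x)" using f key by (auto simp: inj_on_def orbit_def)
      show "f ` orbit G (snd X) x = orbit G (snd Y) y"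
        using f by (force simp: orbit_def image_iff)
    qed
    fix g z assume g: "g \<in> carrier G" and "z \<in> orbit G (snd X) x"
    then obtain h where h: "h \<in> carrier G" "z = snd X h x" by (auto simp: orbit_def)
    show "f (snd X g z) = snd Y g (f z)"
      using f[of "g \<otimes> h"] f[of h] g h aX(4)[OF g h(1) x] aY(4)[OF g h(1) y] by simp
  qed
qed

lemma orbit_closed:
  assumes X: "finite_gset G X" and x: "x \<in> fst X"
  shows "orbit G (snd X) x \<subseteq> fst X" "x \<in> orbit G (snd X) x"
    "\<And>g z. g \<in> carrier G \<Longrightarrow> z \<in> orbit G (snd X) x \<Longrightarrow> snd X g z \<in> orbit G (snd X) x"
    "\<And>g z. g \<in> carrier G \<Longrightarrow> z \<in> fst X - orbit G (snd X) x \<Longrightarrow> snd X g z \<in> fst X - orbit G (snd X) x"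
proof -
  note a = gset_action[OF X]
  show "orbit G (snd X) x \<subseteq> fst X" using a(2) x by (auto simp: orbit_def)
  show "x \<in> orbit G (snd X) x" using a(3)[OF x] by (force simp: orbit_def)
  show cl: "snd X g z \<in> orbit G (snd X) x" if g: "g \<in> carrier G" and z: "z \<in> orbit G (snd X) x" for g z
  proof -
    obtain h where "h \<in> carrier G" "z = snd X h x" using z by (auto simp: orbit_def)
    then have "snd X g z = snd X (g \<otimes> h) x" "g \<otimes> h \<in> carrier G" using a(4)[OF g _ x, of h] g by simp_all
    then show ?thesis unfolding orbit_def by blast
  qed
  show "snd X g z \<in> fst X - orbit G (snd X) x" if g: "g \<in> carrier G" and z: "z \<in> fst X - orbit G (snd X) x" for g z
    using a(2)[OF g] a(5)[OF g] cl[of "inv g" "snd X g z"] g z by auto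
qed

text \<open>Burnside's theorem, by splitting off orbits with a stabilizer of maximal order.\<close>

theorem gset_iso_if_marks_eq:
  fixes X :: "('a, 'x) gset" and Y :: "('a, 'y) gset"
  assumes "finite_gset G X" "finite_gset G Y" "mk X = mk Y"
  shows "gset_iso G X Y"
  using assms
proof (induction "card (fst X)" arbitrary: X Y rule: less_induct)
  case less
  note X = less.prems(1) and Y = less.prems(2) and eq = less.prems(3)
  note aX = gset_action[OF X] and aY = gset_action[OF Y]
  have fp_one: "fixed_points {\<one>} X = fst X" "fixed_points {\<one>} Y = fst Y"
    using aX(3) aY(3) by (auto simp: fixed_points_def)
  have card_eq: "card (fst X) = card (fst Y)"
    using fun_cong[OF eq, of "{\<one>}"] triv_subgroup by (simp add: mk_def fp_one)
  have ne: "fixed_points H X \<noteq> {} \<longleftrightarrow> fixed_points H Y \<noteq> {}" if "subgroup H G" for H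
    using fun_cong[OF eq, of H] that finite_fixed_points[OF X, of H] finite_fixed_points[OF Y, of H]
    by (auto simp: mk_def)
  show ?case
  proof (cases "fst X = {}")
    case True
    then have "fst Y = {}" using card_eq aY(1) by simp
    then show ?thesis using True by (auto simp: gset_iso_def bij_betw_def)
  next
    case False
    define c where "c = Max ((\<lambda>x. card (stab X x)) ` fst X)"
    have "c \<in> (\<lambda>x. card (stab X x)) ` fst X" unfolding c_def using aX(1) False by (intro Max_in) auto
    then obtain x where x: "x \<in> fst X" "card (stab X x) = c" by auto
    have max: "card (stab X z) \<le> c" if "z \<in> fst X" for z unfolding c_def using aX(1) that by (intro Max_ge) auto
    have sx: "subgroup (stab X x) G" by (rule stab_subgroup[OF X x(1)])
    have "x \<in> fixed_points (stab X x) X" using x by (auto simp: fixed_points_def stab_def)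
    then obtain y where "y \<in> fixed_points (stab X x) Y" using ne[OF sx] by blast
    then have y: "y \<in> fst Y" "stab X x \<subseteq> stab Y y"
      using fixed_points_iff_stab[OF subgroup.subset[OF sx], of y Y] by simp_all
    have sy: "subgroup (stab Y y) G" by (rule stab_subgroup[OF Y y(1)])
    have "y \<in> fixed_points (stab Y y) Y" using y by (auto simp: fixed_points_def stab_def)
    then obtain z where "z \<in> fixed_points (stab Y y) X" using ne[OF sy] by blast
    then have z: "z \<in> fst X" "stab Y y \<subseteq> stab X z"
      using fixed_points_iff_stab[OF subgroup.subset[OF sy], of z X] by simp_all
    have fs: "finite (stab X z)" "finite (stab Y y)" using finite_carrier by (auto simp: stab_def)
    \<comment> \<open>The inclusions of \<open>stab X x\<close> in \<open>stab Y y\<close> and of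
      the latter in \<open>stab X z\<close>, with the maximal order of \<open>stab X x\<close>,
      force equality in the first.\<close>
    have "card (stab Y y) \<le> card (stab X x)" using card_mono[OF fs(1) z(2)] max[OF z(1)] x(2) by simp
    then have st: "stab X x = stab Y y" using card_seteq[OF fs(2) y(2)] by simp
    define O1 where "O1 = orbit G (snd X) x"
    define O2 where "O2 = orbit G (snd Y) y"
    note o1 = orbit_closed[OF X x(1), folded O1_def] and o2 = orbit_closed[OF Y y(1), folded O2_def]
    obtain f where f: "bij_betw f O1 O2" "\<And>g z. g \<in> carrier G \<Longrightarrow> z \<in> O1 \<Longrightarrow> f (snd X g z) = snd Y g (f z)"
      using orbit_iso[OF X Y x(1) y(1) st] unfolding O1_def O2_def by blast
    let ?X = "gset_restrict X (fst X - O1)" and ?Y = "gset_restrict Y (fst Y - O2)"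
    have fX: "finite_gset G ?X" by (rule finite_gset_restrict[OF X _ o1(4)]) auto
    have fY: "finite_gset G ?Y" by (rule finite_gset_restrict[OF Y _ o2(4)]) auto
    have "gset_iso G (gset_restrict X O1) (gset_restrict Y O2)"
      unfolding gset_iso_def gset_restrict_def using f o1(3) f(1)
      by (intro exI[of _ f]) (auto simp: bij_betw_def)
    then have eqO: "mk (gset_restrict X O1) = mk (gset_restrict Y O2)"
    proof (rule mk_iso[rotated])
      show "finite_gset G (gset_restrict X O1)" by (rule finite_gset_restrict[OF X o1(1)]) (rule o1(3))
    qed
    have "mk ?X = mk ?Y"
    proof
      fix H show "mk ?X H = mk ?Y H"
        using mk_restrict_split[OF X o1(1), of H] mk_restrict_split[OF Y o2(1), of H]
          fun_cong[OF eq, of H] fun_cong[OF eqO, of H] by linarith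
    qed
    moreover have "card (fst ?X) < card (fst X)"
      using o1(1,2) aX(1) by (auto simp: gset_restrict_def intro!: psubset_card_mono)
    ultimately have "gset_iso G ?X ?Y" using less.hyps[OF _ fX fY] by blast
    then obtain f' where f': "bij_betw f' (fst X - O1) (fst Y - O2)"
      "\<And>g z. g \<in> carrier G \<Longrightarrow> z \<in> fst X - O1 \<Longrightarrow> f' (snd X g z) = snd Y g (f' z)"
    proof -
      obtain f' where b: "bij_betw f' (fst X - O1) (fst Y - O2)"
        "\<forall>g\<in>carrier G. \<forall>z\<in>fst X - O1. f' (snd ?X g z) = snd ?Y g (f' z)"
        using \<open>gset_iso G ?X ?Y\<close> by (auto simp: gset_iso_def gset_restrict_def)
      have "f' (snd X g z) = snd Y g (f' z)" if "g \<in> carrier G" "z \<in> fst X - O1" for g z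
      proof -
        have "f' z \<in> fst Y - O2" using b(1) that(2) by (auto simp: bij_betw_def)
        then show ?thesis using b(2) that by (simp add: gset_restrict_def)
      qed
      then show thesis using that b(1) by blast
    qed
    define h where "h = (\<lambda>z. if z \<in> O1 then f z else f' z)"
    have "bij_betw h (O1 \<union> (fst X - O1)) (O2 \<union> (fst Y - O2))"
    proof (rule bij_betw_combine)
      show "bij_betw h O1 O2" using f(1) by (rule bij_betw_cong[THEN iffD1, rotated]) (simp add: h_def)
      show "bij_betw h (fst X - O1) (fst Y - O2)" using f'(1) by (rule bij_betw_cong[THEN iffD1, rotated]) (simp add: h_def)
    qed auto
    then have "bij_betw h (fst X) (fst Y)" using o1(1) o2(1) by (simp add: Un_absorb1)
    moreover have "h (snd X g z) = snd Y g (h z)" if "g \<in> carrier G" "z \<in> fst X" for g z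
      using that f(2) f'(2) o1(3,4) by (cases "z \<in> O1") (auto simp: h_def)
    ultimately show ?thesis unfolding gset_iso_def by blast
  qed
qed

corollary gset_iso_iff: "finite_gset G X \<Longrightarrow> finite_gset G Y \<Longrightarrow> gset_iso G X Y \<longleftrightarrow> mk X = mk Y"
  using gset_iso_if_marks_eq mk_iso by blast

section \<open>The Burnside ring as a ring of marks\<close>

definition mark_vectors :: "('a set \<Rightarrow> int) set" where
  "mark_vectors = {mk X | X :: ('a, nat) gset. finite_gset G X}"

text \<open>By Burnside's theorem the G-sets with a given realized vector of marks form one
  isomorphism class, so \<open>cl\<close> names classes by integer functions.\<close>

definition cl :: "('a set \<Rightarrow> int) \<Rightarrow> ('a, nat) gset set" where
  "cl v = {Y. finite_gset G Y \<and> mk Y = v}"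

lemma mk_mark_vectors: "finite_gset G X \<Longrightarrow> mk X \<in> mark_vectors"
  using nat_copy[of X] mk_iso unfolding mark_vectors_def by (metis (mono_tags, lifting) mem_Collect_eq)

lemma gset_class_cl: "finite_gset G X \<Longrightarrow> gset_class G X = cl (mk X)"
  unfolding gset_class_def cl_def by (rule Collect_cong) (metis gset_iso_iff)

lemma cl_nonempty: "v \<in> mark_vectors \<Longrightarrow> cl v \<noteq> {}" by (auto simp: mark_vectors_def cl_def)

lemma cl_inject: "v \<in> mark_vectors \<Longrightarrow> w \<in> mark_vectors \<Longrightarrow> cl v = cl w \<longleftrightarrow> v = w"
  by (auto simp: mark_vectors_def cl_def)

lemma mark_vectors_add: "v \<in> mark_vectors \<Longrightarrow> w \<in> mark_vectors \<Longrightarrow> (\<lambda>H. v H + w H) \<in> mark_vectors"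
proof -
  assume "v \<in> mark_vectors" "w \<in> mark_vectors"
  then obtain X Y :: "('a, nat) gset" where XY: "finite_gset G X" "v = mk X" "finite_gset G Y" "w = mk Y"
    by (auto simp: mark_vectors_def)
  then have "(\<lambda>H. v H + w H) = mk (gset_sum X Y)" by (simp add: fun_eq_iff mk_sum)
  then show ?thesis using mk_mark_vectors[OF finite_gset_sum[OF XY(1,3)]] by simp
qed

lemma mark_vectors_mult: "v \<in> mark_vectors \<Longrightarrow> w \<in> mark_vectors \<Longrightarrow> (\<lambda>H. v H * w H) \<in> mark_vectors"
proof -
  assume "v \<in> mark_vectors" "w \<in> mark_vectors"
  then obtain X Y :: "('a, nat) gset" where XY: "finite_gset G X" "v = mk X" "finite_gset G Y" "w = mk Y"
    by (auto simp: mark_vectors_def)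
  then have "(\<lambda>H. v H * w H) = mk (gset_prod X Y)" by (simp add: fun_eq_iff mk_prod)
  then show ?thesis using mk_mark_vectors[OF finite_gset_prod[OF XY(1,3)]] by simp
qed

lemma mark_vectors_zero: "(\<lambda>H. 0) \<in> mark_vectors"
  using mk_mark_vectors[OF finite_gset_empty] mk_empty by (metis (no_types, lifting) ext)

text \<open>Not the constant 1, because mark vectors vanish outside the subgroups.\<close>

definition unit_marks :: "'a set \<Rightarrow> int" where "unit_marks H = (if subgroup H G then 1 else 0)"

lemma mark_vectors_one: "unit_marks \<in> mark_vectors"
proof -
  have "unit_marks = mk gset_point" by (simp add: fun_eq_iff mk_point unit_marks_def)
  then show ?thesis using mk_mark_vectors[OF finite_gset_point] by simp
qed

abbreviation S where "S \<equiv> gset_semiring G"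

lemma semiring_carrier: "carrier S = cl ` mark_vectors"
proof -
  have "carrier S = {gset_class G X | X :: ('a, nat) gset. finite_gset G X}"
    by (simp add: gset_semiring_def)
  also have "\<dots> = cl ` mark_vectors"
  proof (rule equalityI; rule subsetI)
    fix C assume "C \<in> {gset_class G X | X :: ('a, nat) gset. finite_gset G X}"
    then obtain X :: "('a, nat) gset" where "finite_gset G X" "C = gset_class G X" by blast
    then show "C \<in> cl ` mark_vectors" using gset_class_cl[of X] mk_mark_vectors[of X] by simp
  next
    fix C assume "C \<in> cl ` mark_vectors"
    then obtain X :: "('a, nat) gset" where "finite_gset G X" "C = cl (mk X)" by (auto simp: mark_vectors_def)
    then show "C \<in> {gset_class G X | X :: ('a, nat) gset. finite_gset G X}" using gset_class_cl[of X] by blast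
  qed
  finally show ?thesis .
qed

lemma semiring_add: "v \<in> mark_vectors \<Longrightarrow> w \<in> mark_vectors \<Longrightarrow> cl v \<oplus>\<^bsub>S\<^esub> cl w = cl (\<lambda>H. v H + w H)"
proof -
  assume vw: "v \<in> mark_vectors" "w \<in> mark_vectors"
  have "gset_class G (gset_sum X Y) = cl (\<lambda>H. v H + w H)" if "X \<in> cl v" "Y \<in> cl w" for X Y
  proof -
    have XY: "finite_gset G X" "mk X = v" "finite_gset G Y" "mk Y = w" using that by (auto simp: cl_def)
    have "mk (gset_sum X Y) = (\<lambda>H. v H + w H)" using XY by (simp add: fun_eq_iff mk_sum)
    then show ?thesis using gset_class_cl[OF finite_gset_sum[OF XY(1,3)]] by simp
  qed
  then show ?thesis using cl_nonempty[OF vw(1)] cl_nonempty[OF vw(2)] by (auto simp: gset_semiring_def)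
qed

lemma semiring_mult: "v \<in> mark_vectors \<Longrightarrow> w \<in> mark_vectors \<Longrightarrow> cl v \<otimes>\<^bsub>S\<^esub> cl w = cl (\<lambda>H. v H * w H)"
proof -
  assume vw: "v \<in> mark_vectors" "w \<in> mark_vectors"
  have "gset_class G (gset_prod X Y) = cl (\<lambda>H. v H * w H)" if "X \<in> cl v" "Y \<in> cl w" for X Y
  proof -
    have XY: "finite_gset G X" "mk X = v" "finite_gset G Y" "mk Y = w" using that by (auto simp: cl_def)
    have "mk (gset_prod X Y) = (\<lambda>H. v H * w H)" using XY by (simp add: fun_eq_iff mk_prod)
    then show ?thesis using gset_class_cl[OF finite_gset_prod[OF XY(1,3)]] by simp
  qed
  then show ?thesis using cl_nonempty[OF vw(1)] cl_nonempty[OF vw(2)] by (auto simp: gset_semiring_def)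
qed

lemma semiring_zero: "\<zero>\<^bsub>S\<^esub> = cl (\<lambda>H. 0)"
proof -
  have "mk gset_empty = (\<lambda>H. 0)" by (simp add: fun_eq_iff mk_empty)
  then show ?thesis using gset_class_cl[OF finite_gset_empty] by (simp add: gset_semiring_def)
qed

lemma semiring_one: "\<one>\<^bsub>S\<^esub> = cl unit_marks"
proof -
  have "mk gset_point = unit_marks" by (simp add: fun_eq_iff mk_point unit_marks_def)
  then show ?thesis using gset_class_cl[OF finite_gset_point] by (simp add: gset_semiring_def)
qed

text \<open>The image of the Burnside ring in its ghost ring, here the integer functions under
  pointwise operations.\<close>

definition mark_lattice :: "('a set \<Rightarrow> int) set" where
  "mark_lattice = {\<lambda>H. v H - w H | v w. v \<in> mark_vectors \<and> w \<in> mark_vectors}"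

definition gc :: "('a set \<Rightarrow> int) \<Rightarrow> (('a, nat) gset set \<times> ('a, nat) gset set) set" where
  "gc u = {(cl v, cl w) | v w. v \<in> mark_vectors \<and> w \<in> mark_vectors \<and> (\<forall>H. v H - w H = u H)}"

text \<open>Integer functions cancel, so the auxiliary summand in the Grothendieck relation
  disappears and only the difference of marks matters.\<close>

lemma grothendieck_rel_cl:
  assumes "v \<in> mark_vectors" "w \<in> mark_vectors" "v' \<in> mark_vectors" "w' \<in> mark_vectors"
  shows "((cl v, cl w), (cl v', cl w')) \<in> grothendieck_rel S \<longleftrightarrow> (\<forall>H. v H - w H = v' H - w' H)"
proof -
  have "((cl v, cl w), (cl v', cl w')) \<in> grothendieck_rel S \<longleftrightarrow>
      (\<exists>k\<in>mark_vectors. cl (\<lambda>H. (v H + w' H) + k H) = cl (\<lambda>H. (v' H + w H) + k H))"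
    using assms by (simp add: grothendieck_rel_def semiring_carrier semiring_add mark_vectors_add)
  also have "\<dots> \<longleftrightarrow> (\<exists>k\<in>mark_vectors. (\<lambda>H. (v H + w' H) + k H) = (\<lambda>H. (v' H + w H) + k H))"
    using assms by (intro bex_cong refl cl_inject mark_vectors_add) auto
  also have "\<dots> \<longleftrightarrow> (\<forall>H. v H - w H = v' H - w' H)"
    using mark_vectors_zero by (auto simp: fun_eq_iff algebra_simps)
  finally show ?thesis .
qed

lemma grothendieck_class_cl:
  assumes "v \<in> mark_vectors" "w \<in> mark_vectors"
  shows "grothendieck_class S (cl v, cl w) = gc (\<lambda>H. v H - w H)"
proof (rule Set.set_eqI)
  fix q :: "('a, nat) gset set \<times> ('a, nat) gset set"
  show "q \<in> grothendieck_class S (cl v, cl w) \<longleftrightarrow> q \<in> gc (\<lambda>H. v H - w H)"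
  proof (cases "q \<in> carrier S \<times> carrier S")
    case True
    then obtain v' w' where q: "q = (cl v', cl w')" "v' \<in> mark_vectors" "w' \<in> mark_vectors"
      by (auto simp: semiring_carrier)
    have "q \<in> gc (\<lambda>H. v H - w H) \<longleftrightarrow> (\<forall>H. v' H - w' H = v H - w H)"
      using q cl_inject by (auto simp: gc_def)
    moreover have "q \<in> grothendieck_class S (cl v, cl w) \<longleftrightarrow> (\<forall>H. v H - w H = v' H - w' H)"
      using grothendieck_rel_cl[OF assms q(2,3)] q(1) by (simp add: grothendieck_class_def)
    ultimately show ?thesis by auto
  next
    case False
    then show ?thesis by (auto simp: grothendieck_class_def grothendieck_rel_def gc_def semiring_carrier)
  qed
qed

abbreviation A where "A \<equiv> burnside_ring G"

lemma gcE:
  assumes "P \<in> gc u"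
  obtains v w where "P = (cl v, cl w)" "v \<in> mark_vectors" "w \<in> mark_vectors" "u = (\<lambda>H. v H - w H)"
proof -
  obtain v w where "P = (cl v, cl w)" "v \<in> mark_vectors" "w \<in> mark_vectors" "\<forall>H. v H - w H = u H"
    using assms unfolding gc_def mem_Collect_eq by blast
  then show thesis by (intro that[of v w]) auto
qed

lemma gc_nonempty: "u \<in> mark_lattice \<Longrightarrow> gc u \<noteq> {}"
  by (auto simp: gc_def mark_lattice_def)

lemma burnside_carrier: "carrier A = gc ` mark_lattice"
proof -
  have "carrier A = {grothendieck_class S (cl v, cl w) | v w. v \<in> mark_vectors \<and> w \<in> mark_vectors}"
    by (auto simp: burnside_ring_def grothendieck_ring_def quotient_def semiring_carrier grothendieck_class_def)
  then show ?thesis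
    by (auto simp: grothendieck_class_cl mark_lattice_def image_iff) (metis grothendieck_class_cl)+
qed

lemma burnside_add:
  assumes "u \<in> mark_lattice" "u' \<in> mark_lattice"
  shows "gc u \<oplus>\<^bsub>A\<^esub> gc u' = gc (\<lambda>H. u H + u' H)"
proof -
  have *: "(case P of (a, b) \<Rightarrow> case Q of (c, d) \<Rightarrow> grothendieck_class S (a \<oplus>\<^bsub>S\<^esub> c, b \<oplus>\<^bsub>S\<^esub> d)) = gc (\<lambda>H. u H + u' H)"
    if PQ: "P \<in> gc u" "Q \<in> gc u'" for P Q
  proof -
    obtain v w where P: "P = (cl v, cl w)" "v \<in> mark_vectors" "w \<in> mark_vectors" "u = (\<lambda>H. v H - w H)"
      using gcE[OF PQ(1)] .
    obtain v' w' where Q: "Q = (cl v', cl w')" "v' \<in> mark_vectors" "w' \<in> mark_vectors" "u' = (\<lambda>H. v' H - w' H)"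
      using gcE[OF PQ(2)] .
    show ?thesis
      using P Q by (simp add: semiring_add grothendieck_class_cl mark_vectors_add algebra_simps)
  qed
  have "gc u \<oplus>\<^bsub>A\<^esub> gc u' = (\<Union>P\<in>gc u. \<Union>Q\<in>gc u'. case P of (a, b) \<Rightarrow> case Q of (c, d) \<Rightarrow>
      grothendieck_class S (a \<oplus>\<^bsub>S\<^esub> c, b \<oplus>\<^bsub>S\<^esub> d))"
    by (auto simp: burnside_ring_def grothendieck_ring_def split: prod.splits)
  then show ?thesis using * gc_nonempty[OF assms(1)] gc_nonempty[OF assms(2)] by auto
qed

lemma burnside_mult:
  assumes "u \<in> mark_lattice" "u' \<in> mark_lattice"
  shows "gc u \<otimes>\<^bsub>A\<^esub> gc u' = gc (\<lambda>H. u H * u' H)"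
proof -
  have *: "(case P of (a, b) \<Rightarrow> case Q of (c, d) \<Rightarrow> grothendieck_class S
      (a \<otimes>\<^bsub>S\<^esub> c \<oplus>\<^bsub>S\<^esub> b \<otimes>\<^bsub>S\<^esub> d, a \<otimes>\<^bsub>S\<^esub> d \<oplus>\<^bsub>S\<^esub> b \<otimes>\<^bsub>S\<^esub> c)) = gc (\<lambda>H. u H * u' H)"
    if PQ: "P \<in> gc u" "Q \<in> gc u'" for P Q
  proof -
    obtain v w where P: "P = (cl v, cl w)" "v \<in> mark_vectors" "w \<in> mark_vectors" "u = (\<lambda>H. v H - w H)"
      using gcE[OF PQ(1)] .
    obtain v' w' where Q: "Q = (cl v', cl w')" "v' \<in> mark_vectors" "w' \<in> mark_vectors" "u' = (\<lambda>H. v' H - w' H)"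
      using gcE[OF PQ(2)] .
    show ?thesis
      using P Q by (simp add: semiring_add semiring_mult grothendieck_class_cl mark_vectors_add
          mark_vectors_mult algebra_simps)
  qed
  have "gc u \<otimes>\<^bsub>A\<^esub> gc u' = (\<Union>P\<in>gc u. \<Union>Q\<in>gc u'. case P of (a, b) \<Rightarrow> case Q of (c, d) \<Rightarrow>
      grothendieck_class S (a \<otimes>\<^bsub>S\<^esub> c \<oplus>\<^bsub>S\<^esub> b \<otimes>\<^bsub>S\<^esub> d, a \<otimes>\<^bsub>S\<^esub> d \<oplus>\<^bsub>S\<^esub> b \<otimes>\<^bsub>S\<^esub> c))"
    by (auto simp: burnside_ring_def grothendieck_ring_def split: prod.splits)
  then show ?thesis using * gc_nonempty[OF assms(1)] gc_nonempty[OF assms(2)] by auto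
qed

lemma burnside_zero: "\<zero>\<^bsub>A\<^esub> = gc (\<lambda>H. 0)"
  using grothendieck_class_cl[OF mark_vectors_zero mark_vectors_zero]
  by (simp add: burnside_ring_def grothendieck_ring_def semiring_zero)

lemma burnside_one: "\<one>\<^bsub>A\<^esub> = gc unit_marks"
  using grothendieck_class_cl[OF mark_vectors_one mark_vectors_zero]
  by (simp add: burnside_ring_def grothendieck_ring_def semiring_zero semiring_one)

lemma mark_gc:
  assumes "u \<in> mark_lattice"
  shows "subgroup H G \<Longrightarrow> mark H (gc u) = u H"
proof -
  assume H: "subgroup H G"
  have cm: "class_mark H (cl v) = v H" if v: "v \<in> mark_vectors" for v
  proof -
    have "int (card (fixed_points H X)) = v H" if "X \<in> cl v" for X
    proof -
      have "mk X = v" using that by (simp add: cl_def)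
      then show ?thesis using H by (auto simp: mk_def)
    qed
    then have "(\<lambda>X. int (card (fixed_points H X))) ` cl v = {v H}"
      using cl_nonempty[OF v] by auto
    then show ?thesis by (simp add: class_mark_def)
  qed
  have "(case P of (a, b) \<Rightarrow> class_mark H a - class_mark H b) = u H" if "P \<in> gc u" for P
    using that cm by (elim gcE) auto
  then have "(\<lambda>(a, b). class_mark H a - class_mark H b) ` gc u = {u H}"
    using gc_nonempty[OF assms] by auto
  then show ?thesis by (simp add: mark_def)
qed

lemma mark_lattice_outside: "u \<in> mark_lattice \<Longrightarrow> \<not> subgroup H G \<Longrightarrow> u H = 0"
  by (auto simp: mark_lattice_def mark_vectors_def mk_def)

lemma mark_latticeI:
  assumes "v \<in> mark_vectors" "w \<in> mark_vectors" "\<And>H. u H = v H - w H"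
  shows "u \<in> mark_lattice"
proof -
  have "u = (\<lambda>H. v H - w H)" using assms(3) by auto
  then show ?thesis unfolding mark_lattice_def mem_Collect_eq
    by (intro exI[of _ v] exI[of _ w] conjI assms(1,2))
qed

lemma mark_vectors_lattice: "v \<in> mark_vectors \<Longrightarrow> v \<in> mark_lattice"
  by (rule mark_latticeI[OF _ mark_vectors_zero]) auto

lemma mark_lattice_zero: "(\<lambda>H. 0) \<in> mark_lattice"
  by (rule mark_vectors_lattice[OF mark_vectors_zero])

lemma mark_lattice_one: "unit_marks \<in> mark_lattice"
  by (rule mark_vectors_lattice[OF mark_vectors_one])

lemma mark_latticeE:
  assumes "u \<in> mark_lattice"
  obtains v w where "v \<in> mark_vectors" "w \<in> mark_vectors" "\<And>H. u H = v H - w H"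
proof -
  obtain v w where "u = (\<lambda>H. v H - w H)" "v \<in> mark_vectors" "w \<in> mark_vectors"
    using assms unfolding mark_lattice_def mem_Collect_eq by blast
  then show thesis by (intro that[of v w]) simp_all
qed

lemma mark_lattice_diff:
  assumes "u \<in> mark_lattice" "u' \<in> mark_lattice"
  shows "(\<lambda>H. u H - u' H) \<in> mark_lattice"
proof -
  obtain v w where u: "v \<in> mark_vectors" "w \<in> mark_vectors" "\<And>H. u H = v H - w H"
    using mark_latticeE[OF assms(1)] by blast
  obtain v' w' where u': "v' \<in> mark_vectors" "w' \<in> mark_vectors" "\<And>H. u' H = v' H - w' H"
    using mark_latticeE[OF assms(2)] by blast
  show ?thesis
    by (rule mark_latticeI[OF mark_vectors_add[OF u(1) u'(2)] mark_vectors_add[OF u(2) u'(1)]])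
      (simp add: u(3) u'(3))
qed

lemma mark_lattice_uminus: "u \<in> mark_lattice \<Longrightarrow> (\<lambda>H. - u H) \<in> mark_lattice"
  using mark_lattice_diff[OF mark_lattice_zero] by simp

lemma mark_lattice_add:
  assumes "u \<in> mark_lattice" "u' \<in> mark_lattice"
  shows "(\<lambda>H. u H + u' H) \<in> mark_lattice"
  using mark_lattice_diff[OF assms(1) mark_lattice_uminus[OF assms(2)]] by simp

lemma mark_lattice_smult: "u \<in> mark_lattice \<Longrightarrow> (\<lambda>H. c * u H) \<in> mark_lattice"
  by (rule int_lattice_smult[OF mark_lattice_diff])

lemma mark_lattice_mult:
  assumes "u \<in> mark_lattice" "u' \<in> mark_lattice"
  shows "(\<lambda>H. u H * u' H) \<in> mark_lattice"
proof -
  obtain v w where u: "v \<in> mark_vectors" "w \<in> mark_vectors" "\<And>H. u H = v H - w H"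
    using mark_latticeE[OF assms(1)] by blast
  obtain v' w' where u': "v' \<in> mark_vectors" "w' \<in> mark_vectors" "\<And>H. u' H = v' H - w' H"
    using mark_latticeE[OF assms(2)] by blast
  show ?thesis
    by (rule mark_latticeI[OF mark_vectors_add[OF mark_vectors_mult[OF u(1) u'(1)] mark_vectors_mult[OF u(2) u'(2)]]
          mark_vectors_add[OF mark_vectors_mult[OF u(1) u'(2)] mark_vectors_mult[OF u(2) u'(1)]]])
      (simp add: u(3) u'(3) algebra_simps)
qed

lemma unit_marks_mult: "u \<in> mark_lattice \<Longrightarrow> (\<lambda>H. unit_marks H * u H) = u"
  using mark_lattice_outside by (auto simp: unit_marks_def fun_eq_iff)

text \<open>Under \<open>gc\<close> the operations are pointwise operations on integer functions,
  from which the ring laws are inherited.\<close>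

lemma burnside_cring: "cring A"
proof (rule cringI)
  show "abelian_group A"
  proof (rule abelian_groupI)
    fix x assume "x \<in> carrier A"
    then obtain u where u: "u \<in> mark_lattice" "x = gc u" by (auto simp: burnside_carrier)
    show "\<exists>y\<in>carrier A. y \<oplus>\<^bsub>A\<^esub> x = \<zero>\<^bsub>A\<^esub>"
      using u mark_lattice_uminus[OF u(1)]
      by (intro bexI[of _ "gc (\<lambda>H. - u H)"]) (simp_all add: burnside_carrier burnside_add burnside_zero)
  qed (auto simp: burnside_carrier burnside_add burnside_zero mark_lattice_zero mark_lattice_add add_ac)
  show "comm_monoid A"
  proof (rule comm_monoidI)
    fix x assume "x \<in> carrier A"
    then show "\<one>\<^bsub>A\<^esub> \<otimes>\<^bsub>A\<^esub> x = x"
      by (auto simp: burnside_carrier burnside_mult burnside_one mark_lattice_one unit_marks_mult)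
  qed (auto simp: burnside_carrier burnside_mult burnside_one mark_lattice_one mark_lattice_mult mult_ac)
qed (auto simp: burnside_carrier burnside_add burnside_mult mark_lattice_add mark_lattice_mult distrib_right)

lemma burnside_add_pow:
  assumes u: "u \<in> mark_lattice"
  shows "add_pow A (k :: int) (gc u) = gc (\<lambda>H. k * u H)"
proof -
  interpret A: cring A by (rule burnside_cring)
  have c: "gc u \<in> carrier A" using u by (simp add: burnside_carrier)
  show ?thesis
  proof (induction k rule: int_induct[where k = 0])
    case base
    show ?case by (simp add: add_pow_int_ge burnside_zero)
  next
    case (step1 i)
    have "add_pow A (i + 1) (gc u) = add_pow A i (gc u) \<oplus>\<^bsub>A\<^esub> gc u"
      using A.add.int_pow_mult[OF c, of i 1] A.add.int_pow_1[OF c] by simp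
    then show ?case using step1 by (simp add: burnside_add mark_lattice_smult u algebra_simps)
  next
    case (step2 i)
    have m: "\<ominus>\<^bsub>A\<^esub> gc u = gc (\<lambda>H. - u H)"
      by (rule A.minus_equality)
        (use u mark_lattice_uminus[OF u] in \<open>simp_all add: burnside_carrier burnside_add burnside_zero\<close>)
    have "add_pow A (i - 1) (gc u) = add_pow A i (gc u) \<oplus>\<^bsub>A\<^esub> \<ominus>\<^bsub>A\<^esub> gc u"
      using A.add.int_pow_mult[OF c, of i "-1"] A.add.int_pow_neg[OF c, of 1] A.add.int_pow_1[OF c] by simp
    then show ?case using step2 by (simp add: m burnside_add mark_lattice_smult mark_lattice_uminus u algebra_simps)
  qed
qed

lemma burnside_finsum:
  assumes "\<And>i. i \<in> I \<Longrightarrow> u i \<in> mark_lattice" "finite I"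
  shows "finsum A (\<lambda>i. gc (u i)) I = gc (\<lambda>H. \<Sum>i\<in>I. u i H)" "(\<lambda>H. \<Sum>i\<in>I. u i H) \<in> mark_lattice"
proof -
  interpret A: cring A by (rule burnside_cring)
  have "finsum A (\<lambda>i. gc (u i)) I = gc (\<lambda>H. \<Sum>i\<in>I. u i H) \<and> (\<lambda>H. \<Sum>i\<in>I. u i H) \<in> mark_lattice"
    using assms(2,1)
  proof (induction rule: finite_induct)
    case empty
    then show ?case by (simp add: burnside_zero mark_lattice_zero)
  next
    case (insert i I)
    have "(\<lambda>i. gc (u i)) \<in> I \<rightarrow> carrier A" "gc (u i) \<in> carrier A"
      using insert.prems by (auto simp: burnside_carrier)
    then show ?case using insert by (simp add: burnside_add mark_lattice_add)
  qed
  then show "finsum A (\<lambda>i. gc (u i)) I = gc (\<lambda>H. \<Sum>i\<in>I. u i H)" "(\<lambda>H. \<Sum>i\<in>I. u i H) \<in> mark_lattice" by auto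
qed

section \<open>Congruences between marks\<close>

definition conj_set :: "'a \<Rightarrow> 'a set \<Rightarrow> 'a set" where
  "conj_set x J = (\<lambda>j. x \<otimes> j \<otimes> inv x) ` J"

lemma inj_conj: "x \<in> carrier G \<Longrightarrow> J \<subseteq> carrier G \<Longrightarrow> inj_on (\<lambda>j. x \<otimes> j \<otimes> inv x) J"
  by (auto simp: inj_on_def subset_iff)

lemma card_conj_set: "x \<in> carrier G \<Longrightarrow> J \<subseteq> carrier G \<Longrightarrow> card (conj_set x J) = card J"
  unfolding conj_set_def by (rule card_image[OF inj_conj])

lemma finite_subgroup: "subgroup H G \<Longrightarrow> finite H"
  using finite_carrier subgroup.subset finite_subset by metis

text \<open>The transitive G-set \<open>G/K\<close>, modelled on right cosets; acting by the inverse
  on the right makes it a left action.\<close>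

definition coset_gset :: "'a set \<Rightarrow> ('a, 'a set) gset" where
  "coset_gset K = (rcosets K, \<lambda>g. \<lambda>C\<in>rcosets K. C #> inv g)"

context
  fixes K assumes K: "subgroup K G"
begin

lemma K_subset: "K \<subseteq> carrier G" by (rule subgroup.subset[OF K])

lemma rcoset_mult: "C \<in> rcosets K \<Longrightarrow> g \<in> carrier G \<Longrightarrow> C #> g \<in> rcosets K"
  using K_subset by (auto simp: RCOSETS_def coset_mult_assoc)

lemma finite_gset_coset: "finite_gset G (coset_gset K)"
  unfolding coset_gset_def
proof (rule finite_gsetI)
  show "finite (rcosets K)" using finite_carrier by (simp add: RCOSETS_def)
  have sub: "C \<subseteq> carrier G" if "C \<in> rcosets K" for C by (rule subgroup.rcosets_carrier[OF K is_group that])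
  show "C #> inv \<one> = C" if "C \<in> rcosets K" for C using sub[OF that] by simp
  show "C #> inv (g \<otimes> h) = C #> inv h #> inv g" if "g \<in> carrier G" "h \<in> carrier G" "C \<in> rcosets K" for g h C
    using sub[OF that(3)] that by (simp add: inv_mult_group coset_mult_assoc)
qed (simp add: rcoset_mult)

text \<open>For \<open>J = K\<close> this is the normalizer of \<open>K\<close>: a conjugate of the
  finite group \<open>K\<close> that lies in \<open>K\<close> is all of \<open>K\<close>.\<close>

definition transporter :: "'a set \<Rightarrow> 'a set" where
  "transporter J = {x \<in> carrier G. \<forall>j\<in>J. x \<otimes> j \<otimes> inv x \<in> K}"

lemma rcoset_fixed_iff:
  assumes x: "x \<in> carrier G" and J: "subgroup J G"
  shows "K #> x \<in> fixed_points J (coset_gset K) \<longleftrightarrow> x \<in> transporter J"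
proof -
  have one: "(K #> x) #> inv j = K #> x \<longleftrightarrow> x \<otimes> inv j \<otimes> inv x \<in> K" if j: "j \<in> carrier G" for j
  proof -
    have "(K #> x) #> inv j = K #> (x \<otimes> inv j)" using K_subset x j by (simp add: coset_mult_assoc)
    moreover have "K #> (x \<otimes> inv j) = K #> x \<longleftrightarrow> K #> ((x \<otimes> inv j) \<otimes> inv x) = K"
      using coset_mult_inv1[of K "x \<otimes> inv j" x] coset_mult_inv2[of K "x \<otimes> inv j" x] K_subset x j by auto
    moreover have "K #> ((x \<otimes> inv j) \<otimes> inv x) = K \<longleftrightarrow> (x \<otimes> inv j) \<otimes> inv x \<in> K"
      using coset_join1[of K "(x \<otimes> inv j) \<otimes> inv x"] coset_join2[of "(x \<otimes> inv j) \<otimes> inv x" K] K K_subset x j by auto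
    ultimately show ?thesis by simp
  qed
  have Kx: "K #> x \<in> rcosets K" using x by (auto simp: RCOSETS_def)
  have "K #> x \<in> fixed_points J (coset_gset K) \<longleftrightarrow> (\<forall>j\<in>J. x \<otimes> inv j \<otimes> inv x \<in> K)"
    using Kx one subgroup.mem_carrier[OF J] by (auto simp: fixed_points_def coset_gset_def)
  also have "\<dots> \<longleftrightarrow> (\<forall>j\<in>J. x \<otimes> j \<otimes> inv x \<in> K)"
    using subgroup.m_inv_closed[OF J] subgroup.mem_carrier[OF J] by (metis inv_inv)
  finally show ?thesis using x by (simp add: transporter_def)
qed

text \<open>The cosets fixed by \<open>J\<close> are those contained in the transporter, and they
  partition it.\<close>

lemma mk_coset:
  assumes J: "subgroup J G"
  shows "mk (coset_gset K) J * int (card K) = int (card (transporter J))"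
proof -
  let ?F = "fixed_points J (coset_gset K)"
  have F: "?F \<subseteq> rcosets K" by (auto simp: fixed_points_def coset_gset_def)
  have U: "\<Union> ?F = transporter J"
  proof (rule equalityI; rule subsetI)
    fix x assume "x \<in> \<Union> ?F"
    then obtain C where C: "C \<in> ?F" "x \<in> C" by blast
    then obtain y where y: "y \<in> carrier G" "C = K #> y" using F by (auto simp: RCOSETS_def)
    have "K #> x = C" "x \<in> carrier G"
      using repr_independence[OF _ y(1) K, of x] C(2) y r_coset_subset_G[OF K_subset y(1)] by auto
    then show "x \<in> transporter J" using rcoset_fixed_iff[OF _ J] C(1) by blast
  next
    fix x assume x: "x \<in> transporter J"
    then have "x \<in> carrier G" by (simp add: transporter_def)
    then show "x \<in> \<Union> ?F" using rcoset_fixed_iff[OF _ J] x rcos_self[OF _ K] by blast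
  qed
  have "card (\<Union> ?F) = (\<Sum>C\<in>?F. card C)"
  proof (rule card_Union_disjoint)
    show "pairwise disjnt ?F"
      using rcos_disjoint[OF K] F by (auto simp: pairwise_def disjnt_def)
    show "finite C" if "C \<in> ?F" for C
      using that F rcosets_subset_PowG[OF K] finite_carrier finite_subset by blast
  qed
  also have "\<dots> = (\<Sum>C\<in>?F. card K)"
    using card_rcosets_equal[OF _ K_subset] F by (intro sum.cong) auto
  finally show ?thesis using J U by (simp add: mk_def)
qed

lemma transporter_card:
  assumes J: "subgroup J G" and x: "x \<in> transporter J"
  shows "conj_set x J \<subseteq> K" "card J \<le> card K" "card J = card K \<Longrightarrow> conj_set x J = K"
proof -
  show c: "conj_set x J \<subseteq> K" using x by (auto simp: transporter_def conj_set_def)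
  have "x \<in> carrier G" using x by (simp add: transporter_def)
  then have e: "card (conj_set x J) = card J" by (rule card_conj_set[OF _ subgroup.subset[OF J]])
  show "card J \<le> card K" using card_mono[OF finite_subgroup[OF K] c] e by simp
  show "card J = card K \<Longrightarrow> conj_set x J = K" using card_subset_eq[OF finite_subgroup[OF K] c] e by simp
qed

lemma mk_coset_nonzero:
  assumes "mk (coset_gset K) J \<noteq> 0"
  obtains x where "subgroup J G" "x \<in> carrier G" "conj_set x J \<subseteq> K"
proof -
  have J: "subgroup J G" using assms by (simp add: mk_def split: if_splits)
  have "card K \<noteq> 0" using finite_subgroup[OF K] subgroup.one_closed[OF K] by auto
  then have "card (transporter J) \<noteq> 0" using mk_coset[OF J] assms by auto
  then obtain x where "x \<in> transporter J" by (metis card.empty ex_in_conv)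
  moreover from this have "x \<in> carrier G" by (simp add: transporter_def)
  ultimately show thesis using that[OF J _ transporter_card(1)[OF J]] by blast
qed

lemma one_transporter: "\<one> \<in> transporter K" using K_subset by (auto simp: transporter_def subset_iff)

lemma transporter_subgroup: "subgroup (transporter K) G"
proof (rule subgroupI)
  show "transporter K \<subseteq> carrier G" by (auto simp: transporter_def)
  show "transporter K \<noteq> {}" using one_transporter by blast
  note kc = subgroup.mem_carrier[OF K]
  fix a assume a: "a \<in> transporter K"
  then have ac: "a \<in> carrier G" by (simp add: transporter_def)
  have eq: "conj_set a K = K" using transporter_card(3)[OF K a] by simp
  have "inv a \<otimes> j \<otimes> a \<in> K" if "j \<in> K" for j
  proof -
    obtain i where i: "i \<in> K" "j = a \<otimes> i \<otimes> inv a" using eq \<open>j \<in> K\<close> by (auto simp: conj_set_def)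
    have "inv a \<otimes> j \<otimes> a = i" using ac kc[OF i(1)] unfolding i(2) by (simp add: m_assoc inv_solve_left')
    then show ?thesis using i by simp
  qed
  then show "inv a \<in> transporter K" using ac by (simp add: transporter_def)
  fix b assume b: "b \<in> transporter K"
  then have bc: "b \<in> carrier G" by (simp add: transporter_def)
  have "(a \<otimes> b) \<otimes> j \<otimes> inv (a \<otimes> b) = a \<otimes> (b \<otimes> j \<otimes> inv b) \<otimes> inv a" if "j \<in> K" for j
    using ac bc kc[OF that] by (simp add: m_assoc inv_mult_group)
  then show "a \<otimes> b \<in> transporter K" using a b by (auto simp: transporter_def)
qed

lemma K_le_transporter: "K \<subseteq> transporter K"
  using K subgroup.m_closed subgroup.m_inv_closed subgroup.mem_carrier[OF K] by (fastforce simp: transporter_def)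

end

section \<open>Congruences from orbit counting, and their converse\<close>

lemma subgroup_finite_group: "subgroup H G \<Longrightarrow> finite_group (G\<lparr>carrier := H\<rparr>)"
  using subgroup_imp_group finite_subgroup by (simp add: finite_group_def finite_group_axioms_def)

lemma subgroup_action:
  assumes X: "finite_gset G X" and H: "subgroup H G" and E: "E \<subseteq> fst X"
    and cl: "\<And>g x. g \<in> H \<Longrightarrow> x \<in> E \<Longrightarrow> snd X g x \<in> E"
  shows "group_action (G\<lparr>carrier := H\<rparr>) E (\<lambda>g. \<lambda>x\<in>E. snd X g x)"
proof -
  interpret H: finite_group "G\<lparr>carrier := H\<rparr>" by (rule subgroup_finite_group[OF H])
  have "finite_gset (G\<lparr>carrier := H\<rparr>) (E, \<lambda>g. \<lambda>x\<in>E. snd X g x)"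
    by (rule H.finite_gsetI)
      (use gset_action(1,3,4)[OF X] E cl finite_subset subgroup.mem_carrier[OF H] in \<open>auto simp: subset_iff\<close>)
  then show ?thesis by (simp add: finite_gset_def)
qed

abbreviation gen :: "'a set \<Rightarrow> 'a \<Rightarrow> 'a set" where "gen K g \<equiv> generate G (insert g K)"

lemma gen_subgroup: "subgroup K G \<Longrightarrow> g \<in> carrier G \<Longrightarrow> subgroup (gen K g) G"
  using subgroup.subset by (intro generate_is_subgroup) auto

lemma gen_incl: "insert g K \<subseteq> gen K g" by (auto intro: generate.incl)

text \<open>The Cauchy-Frobenius lemma for the normalizer of \<open>K\<close> acting on the
  \<open>K\<close>-fixed points, where \<open>g\<close> fixes exactly the points fixed by
  \<open>gen K g\<close>. Summing over the normalizer instead of its quotient by \<open>K\<close>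
  keeps everything inside \<open>G\<close>.\<close>

theorem mk_congruence:
  assumes X: "finite_gset G X" and K: "subgroup K G"
  shows "int (card (transporter K K)) dvd (\<Sum>g\<in>transporter K K. mk X (gen K g))"
proof -
  let ?N = "transporter K K" and ?E = "fixed_points K X"
  note N = transporter_subgroup[OF K] and kc = subgroup.mem_carrier[OF K]
  have Nc: "g \<in> carrier G" if "g \<in> ?N" for g using that by (simp add: transporter_def[OF K])
  have E: "?E \<subseteq> fst X" by (auto simp: fixed_points_def)
  have cl: "snd X g x \<in> ?E" if g: "g \<in> ?N" and x: "x \<in> ?E" for g x
  proof -
    have gc: "g \<in> carrier G" "inv g \<in> ?N" by (rule Nc[OF g], rule subgroup.m_inv_closed[OF N g])
    have xX: "x \<in> fst X" using x E by blast
    have "snd X k (snd X g x) = snd X g x" if k: "k \<in> K" for k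
    proof -
      have k': "inv g \<otimes> k \<otimes> g \<in> K" using gc k by (simp add: transporter_def[OF K])
      have "k \<otimes> g = g \<otimes> (inv g \<otimes> k \<otimes> g)" using gc(1) kc[OF k] by (simp add: m_assoc[symmetric])
      then have "snd X k (snd X g x) = snd X g (snd X (inv g \<otimes> k \<otimes> g) x)"
        using gset_action(4)[OF X kc[OF k] gc(1) xX] gset_action(4)[OF X gc(1) kc[OF k'] xX] by simp
      then show ?thesis using x k' by (simp add: fixed_points_def)
    qed
    then show ?thesis using gset_action(2)[OF X gc(1) xX] by (simp add: fixed_points_def)
  qed
  interpret N: group_action "G\<lparr>carrier := ?N\<rparr>" ?E "\<lambda>g. \<lambda>x\<in>?E. snd X g x"
    by (rule subgroup_action[OF X N E cl])
  have "card (orbits (G\<lparr>carrier := ?N\<rparr>) ?E (\<lambda>g. \<lambda>x\<in>?E. snd X g x)) * order (G\<lparr>carrier := ?N\<rparr>)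
      = (\<Sum>g\<in>?N. card (invariants ?E (\<lambda>g. \<lambda>x\<in>?E. snd X g x) g))"
    using N.burnside finite_subgroup[OF N] finite_fixed_points[OF X] by simp
  moreover have "int (card (invariants ?E (\<lambda>g. \<lambda>x\<in>?E. snd X g x) g)) = mk X (gen K g)" if g: "g \<in> ?N" for g
  proof -
    have gs: "subgroup (gen K g) G" by (rule gen_subgroup[OF K Nc[OF g]])
    have "invariants ?E (\<lambda>g. \<lambda>x\<in>?E. snd X g x) g = fixed_points (gen K g) X"
    proof (rule equalityI; rule subsetI)
      fix x assume x: "x \<in> invariants ?E (\<lambda>g. \<lambda>x\<in>?E. snd X g x) g"
      then have x': "x \<in> fst X" "insert g K \<subseteq> stab X x"
        using Nc[OF g] kc by (auto simp: invariants_def fixed_points_def stab_def)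
      have "gen K g \<subseteq> stab X x" by (rule generate_subgroup_incl[OF x'(2) stab_subgroup[OF X x'(1)]])
      then show "x \<in> fixed_points (gen K g) X"
        using fixed_points_iff_stab[OF subgroup.subset[OF gs], of x X] x'(1) by simp
    next
      fix x assume "x \<in> fixed_points (gen K g) X"
      then show "x \<in> invariants ?E (\<lambda>g. \<lambda>x\<in>?E. snd X g x) g"
        using gen_incl[of g K] by (auto simp: invariants_def fixed_points_def)
    qed
    then show ?thesis using gs by (simp add: mk_def)
  qed
  ultimately have "(\<Sum>g\<in>?N. mk X (gen K g)) = int (card (orbits (G\<lparr>carrier := ?N\<rparr>) ?E (\<lambda>g. \<lambda>x\<in>?E. snd X g x)) * card ?N)"
    by (simp add: order_def)
  then show ?thesis by simp
qed

text \<open>The points not fixed by \<open>H\<close> fall into orbits whose sizes are powers of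
  \<open>p\<close> other than 1.\<close>

lemma mk_p_congruence:
  assumes X: "finite_gset G X" and H: "subgroup H G" and cH: "card H = p ^ k" and p: "prime p"
  shows "int p dvd mk X {\<one>} - mk X H"
proof -
  let ?E = "fst X - fixed_points H X"
  note hc = subgroup.mem_carrier[OF H]
  have cl: "snd X g x \<in> ?E" if g: "g \<in> H" and x: "x \<in> ?E" for g x
  proof -
    have xX: "x \<in> fst X" using x by blast
    have "x \<in> fixed_points H X" if fx: "snd X g x \<in> fixed_points H X"
    proof -
      have "snd X g x = x"
        using fx gset_action(5)[OF X hc[OF g] xX] subgroup.m_inv_closed[OF H g] by (simp add: fixed_points_def)
      then show ?thesis using fx by simp
    qed
    then show ?thesis using x gset_action(2)[OF X hc[OF g] xX] by blast
  qed
  interpret A: group_action "G\<lparr>carrier := H\<rparr>" ?E "\<lambda>g. \<lambda>x\<in>?E. snd X g x"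
    by (rule subgroup_action[OF X H _ cl]) auto
  have "p dvd card orb" if orb: "orb \<in> orbits (G\<lparr>carrier := H\<rparr>) ?E (\<lambda>g. \<lambda>x\<in>?E. snd X g x)" for orb
  proof -
    obtain x where x: "x \<in> ?E" "orb = orbit (G\<lparr>carrier := H\<rparr>) (\<lambda>g. \<lambda>x\<in>?E. snd X g x) x"
      using orb by (auto simp: orbits_def)
    have "card orb * card (stabilizer (G\<lparr>carrier := H\<rparr>) (\<lambda>g. \<lambda>x\<in>?E. snd X g x) x) = p ^ k"
      using A.orbit_stabilizer_theorem[OF x(1)] cH x(2) by (simp add: order_def)
    then have "card orb dvd p ^ k" by (rule dvdI[OF sym])
    then obtain i where i: "card orb = p ^ i" using p by (auto simp: divides_primepow_nat)
    have "i \<noteq> 0"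
    proof
      assume "i = 0"
      then have "card orb = 1" using i by simp
      moreover have "x \<in> orb" using A.orbit_refl[OF x(1)] x(2) by simp
      ultimately have "orb = {x}" by (auto simp: card_1_singleton_iff)
      then have "snd X h x = x" if "h \<in> H" for h
        using x that by (auto simp: orbit_def)
      then show False using x(1) by (auto simp: fixed_points_def)
    qed
    then show ?thesis using i by simp
  qed
  then have "p dvd (\<Sum>orb\<in>orbits (G\<lparr>carrier := H\<rparr>) ?E (\<lambda>g. \<lambda>x\<in>?E. snd X g x). card orb)" by (rule dvd_sum)
  moreover have "(\<Sum>orb\<in>orbits (G\<lparr>carrier := H\<rparr>) ?E (\<lambda>g. \<lambda>x\<in>?E. snd X g x). card orb) = card ?E"
    unfolding card_eq_sum by (rule A.disjoint_sum) (simp add: gset_action(1)[OF X])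
  ultimately have "p dvd card ?E" by simp
  moreover have "int (card ?E) = mk X {\<one>} - mk X H"
  proof -
    have s: "fixed_points H X \<subseteq> fst X" by (auto simp: fixed_points_def)
    have "fixed_points {\<one>} X = fst X" using gset_action(3)[OF X] by (auto simp: fixed_points_def)
    then show ?thesis
      using H triv_subgroup card_Diff_subset[OF finite_fixed_points[OF X] s] card_mono[OF gset_action(1)[OF X] s]
      by (simp add: mk_def of_nat_diff)
  qed
  ultimately show ?thesis by (metis int_dvd_int_iff)
qed

lemma conj_set_subgroup: "x \<in> carrier G \<Longrightarrow> subgroup J G \<Longrightarrow> subgroup (conj_set x J) G"
proof -
  assume x: "x \<in> carrier G" and J: "subgroup J G"
  have "conj_set x J = x <# J #> inv x" by (auto simp: conj_set_def l_coset_def r_coset_def)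
  then show ?thesis using subgroup_conjugation_is_surj2[OF x J] by simp
qed

lemma mk_conj:
  assumes X: "finite_gset G X" and x: "x \<in> carrier G" and J: "subgroup J G"
  shows "mk X (conj_set x J) = mk X J"
proof -
  note a = gset_action[OF X] and jc = subgroup.mem_carrier[OF J]
  have "bij_betw (snd X x) (fixed_points J X) (fixed_points (conj_set x J) X)"
  proof (rule bij_betw_byWitness[of _ "snd X (inv x)"])
    show "\<forall>z\<in>fixed_points J X. snd X (inv x) (snd X x z) = z" using a(5) x by (auto simp: fixed_points_def)
    show "\<forall>z\<in>fixed_points (conj_set x J) X. snd X x (snd X (inv x) z) = z" using a(6) x by (auto simp: fixed_points_def)
    have "snd X (x \<otimes> j \<otimes> inv x) (snd X x z) = snd X x z" if z: "z \<in> fixed_points J X" and j: "j \<in> J" for z j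
    proof -
      have zX: "z \<in> fst X" "snd X j z = z" using z j by (auto simp: fixed_points_def)
      have "x \<otimes> j \<otimes> inv x \<otimes> x = x \<otimes> j" using x jc[OF j] by (simp add: m_assoc)
      then show ?thesis
        using a(4)[of "x \<otimes> j \<otimes> inv x" x z] a(4)[of x j z] x jc[OF j] zX by simp
    qed
    then show "snd X x ` fixed_points J X \<subseteq> fixed_points (conj_set x J) X"
      using a(2) x by (auto simp: fixed_points_def conj_set_def)
    have "snd X j (snd X (inv x) z) = snd X (inv x) z" if z: "z \<in> fixed_points (conj_set x J) X" and j: "j \<in> J" for z j
    proof -
      have zX: "z \<in> fst X" "snd X (x \<otimes> j \<otimes> inv x) z = z" using z j by (auto simp: fixed_points_def conj_set_def)
      have "inv x \<otimes> (x \<otimes> j \<otimes> inv x) = j \<otimes> inv x" using x jc[OF j] by (simp add: m_assoc[symmetric])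
      then show ?thesis
        using a(4)[of "inv x" "x \<otimes> j \<otimes> inv x" z] a(4)[of j "inv x" z] x jc[OF j] zX by simp
    qed
    then show "snd X (inv x) ` fixed_points (conj_set x J) X \<subseteq> fixed_points J X"
      using a(2) x by (auto simp: fixed_points_def)
  qed
  then have "card (fixed_points J X) = card (fixed_points (conj_set x J) X)" by (rule bij_betw_same_card)
  then show ?thesis using J conj_set_subgroup[OF x J] by (simp add: mk_def)
qed

text \<open>The congruences of \<open>mk_congruence\<close> characterize the image of the Burnside ring: subtract a
  multiple of \<open>G/K\<close>, where \<open>K\<close> has maximal order in the support.\<close>

theorem mark_latticeI_congruence:
  assumes outside: "\<And>J. \<not> subgroup J G \<Longrightarrow> \<phi> J = 0"
    and conj: "\<And>x J. x \<in> carrier G \<Longrightarrow> subgroup J G \<Longrightarrow> \<phi> (conj_set x J) = \<phi> J"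
    and cong: "\<And>K. subgroup K G \<Longrightarrow> int (card (transporter K K)) dvd (\<Sum>g\<in>transporter K K. \<phi> (gen K g))"
  shows "\<phi> \<in> mark_lattice"
proof -
  \<comment> \<open>Generalized for the induction to any finite family \<open>D\<close> of subgroups
    that contains the support and is closed under subconjugacy.\<close>
  have "\<phi> \<in> mark_lattice" if "finite D" "\<forall>J\<in>D. subgroup J G"
    "\<forall>J\<in>D. \<forall>J' x. subgroup J' G \<longrightarrow> x \<in> carrier G \<longrightarrow> conj_set x J' \<subseteq> J \<longrightarrow> J' \<in> D"
    "\<forall>J. J \<notin> D \<longrightarrow> \<phi> J = 0"
    "\<forall>x\<in>carrier G. \<forall>J. subgroup J G \<longrightarrow> \<phi> (conj_set x J) = \<phi> J"
    "\<forall>K. subgroup K G \<longrightarrow> int (card (transporter K K)) dvd (\<Sum>g\<in>transporter K K. \<phi> (gen K g))" for D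
    using that
  proof (induction "card D" arbitrary: D \<phi> rule: less_induct)
    case less
    note fin = less.prems(1) and sub = less.prems(2)[rule_format] and down = less.prems(3)[rule_format]
      and out = less.prems(4)[rule_format] and cj = less.prems(5)[rule_format] and cg = less.prems(6)[rule_format]
    show ?case
    proof (cases "D = {}")
      case True
      then have "\<phi> = (\<lambda>H. 0)" using out by auto
      then show ?thesis using mark_lattice_zero by simp
    next
      case False
      have "Max (card ` D) \<in> card ` D" using fin False by (intro Max_in) auto
      then obtain K where K: "K \<in> D" "card K = Max (card ` D)" by auto
      have max: "card J \<le> card K" if "J \<in> D" for J using K(2) fin that by simp
      have KG: "subgroup K G" by (rule sub[OF K(1)])
      let ?N = "transporter K K"
      let ?m = "mk (coset_gset K)"
      have finN: "finite ?N" by (rule finite_subgroup[OF transporter_subgroup[OF KG]])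
      \<comment> \<open>For \<open>g\<close> outside \<open>K\<close> the order of
        \<open>gen K g\<close> exceeds that of every member of \<open>D\<close>, so the congruence
        at \<open>K\<close> retains only the terms with \<open>g\<close> in
        \<open>K\<close>.\<close>
      have "\<phi> (gen K g) = (if g \<in> K then \<phi> K else 0)" if g: "g \<in> ?N" for g
      proof (cases "g \<in> K")
        case True
        then have "gen K g = generate G K" by (simp add: insert_absorb)
        also have "\<dots> = K" by (rule generateI[OF KG, symmetric]) auto
        finally show ?thesis using True by simp
      next
        case False
        have gc: "g \<in> carrier G" using g by (simp add: transporter_def[OF KG])
        have "K \<subset> gen K g" using False gen_incl[of g K] by blast
        then have "card K < card (gen K g)"
          by (rule psubset_card_mono[OF finite_subgroup[OF gen_subgroup[OF KG gc]]])
        then have "gen K g \<notin> D" using max by fastforce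
        then show ?thesis using False out by simp
      qed
      then have "(\<Sum>g\<in>?N. \<phi> (gen K g)) = (\<Sum>g\<in>?N. if g \<in> K then \<phi> K else 0)" by simp
      also have "\<dots> = (\<Sum>g\<in>K. \<phi> K)"
        using K_le_transporter[OF KG] finN by (subst sum.inter_restrict[symmetric]) (auto simp: Int_absorb1)
      \<comment> \<open>The order of the normalizer is the mark of \<open>G/K\<close> at
        \<open>K\<close> times \<open>card K\<close>; cancelling \<open>card K\<close> leaves
        divisibility of \<open>\<phi> K\<close> by that mark.\<close>
      finally have "?m K * int (card K) dvd \<phi> K * int (card K)"
        using cg[OF KG] mk_coset[OF KG KG] by (simp add: mult.commute)
      moreover have cK: "int (card K) \<noteq> 0"
        using finite_subgroup[OF KG] subgroup.one_closed[OF KG] by auto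
      ultimately have "?m K dvd \<phi> K" by simp
      then obtain n where n: "\<phi> K = ?m K * n" by (rule dvdE)
      define \<phi>' where "\<phi>' = (\<lambda>J. \<phi> J - n * ?m J)"
      \<comment> \<open>Subtracting \<open>n\<close> times \<open>G/K\<close> makes the function
        vanish on the whole conjugacy class of \<open>K\<close>, which can therefore leave the
        family.\<close>
      define D' where "D' = {J \<in> D. \<forall>x\<in>carrier G. conj_set x J \<noteq> K}"
      have cX: "finite_gset G (coset_gset K)" by (rule finite_gset_coset[OF KG])
      have mL: "?m \<in> mark_lattice" by (rule mark_vectors_lattice[OF mk_mark_vectors[OF cX]])
      have "conj_set \<one> K = K" using subgroup.mem_carrier[OF KG] by (force simp: conj_set_def image_iff)
      then have "K \<notin> D'" using one_closed by (auto simp: D'_def)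
      then have "card D' < card D" using K(1) fin by (intro psubset_card_mono) (auto simp: D'_def)
      moreover have "finite D'" "\<forall>J\<in>D'. subgroup J G" using fin sub by (auto simp: D'_def)
      moreover have "\<forall>J\<in>D'. \<forall>J' x. subgroup J' G \<longrightarrow> x \<in> carrier G \<longrightarrow> conj_set x J' \<subseteq> J \<longrightarrow> J' \<in> D'"
      proof (intro ballI allI impI)
        fix J J' x assume J: "J \<in> D'" and J': "subgroup J' G" and x: "x \<in> carrier G" and s: "conj_set x J' \<subseteq> J"
        have JD: "J \<in> D" and JG: "subgroup J G" using J sub by (auto simp: D'_def)
        have "J' \<in> D" by (rule down[OF JD J' x s])
        moreover have "conj_set y J' \<noteq> K" if y: "y \<in> carrier G" for y
        proof
          assume eq: "conj_set y J' = K"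
          note jc = subgroup.mem_carrier[OF J']
          have "card J \<le> card (conj_set x J')"
            using max[OF JD] card_conj_set[OF y subgroup.subset[OF J']] card_conj_set[OF x subgroup.subset[OF J']] eq by simp
          then have Jeq: "conj_set x J' = J" using card_seteq[OF finite_subgroup[OF JG] s] by simp
          have "(y \<otimes> inv x) \<otimes> (x \<otimes> j \<otimes> inv x) \<otimes> inv (y \<otimes> inv x) = y \<otimes> j \<otimes> inv y" if "j \<in> J'" for j
          proof -
            have "inv x \<otimes> (x \<otimes> (j \<otimes> (inv x \<otimes> (x \<otimes> inv y)))) = j \<otimes> inv y"
              using x y jc[OF that] by (simp add: m_assoc[symmetric])
            then show ?thesis using x y jc[OF that] by (simp add: m_assoc inv_mult_group)
          qed
          then have "conj_set (y \<otimes> inv x) J = conj_set y J'"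
            unfolding Jeq[symmetric] by (auto simp: conj_set_def image_image)
          then show False using J eq x y by (auto simp: D'_def)
        qed
        ultimately show "J' \<in> D'" by (simp add: D'_def)
      qed
      moreover have "\<forall>J. J \<notin> D' \<longrightarrow> \<phi>' J = 0"
      proof (intro allI impI)
        fix J assume J: "J \<notin> D'"
        show "\<phi>' J = 0"
        proof (cases "J \<in> D")
          case True
          then obtain x where x: "x \<in> carrier G" "conj_set x J = K" using J by (auto simp: D'_def)
          then show ?thesis
            using cj[OF x(1) sub[OF True]] mk_conj[OF cX x(1) sub[OF True]] n
            by (simp add: \<phi>'_def mult.commute[of n])
        next
          case False
          have "?m J = 0"
          proof (rule ccontr)
            assume "?m J \<noteq> 0"
            then show False using mk_coset_nonzero[OF KG] down[OF K(1)] False by metis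
          qed
          then show ?thesis using out[OF False] by (simp add: \<phi>'_def)
        qed
      qed
      moreover have "\<forall>x\<in>carrier G. \<forall>J. subgroup J G \<longrightarrow> \<phi>' (conj_set x J) = \<phi>' J"
        using cj mk_conj[OF cX] by (simp add: \<phi>'_def)
      moreover have "\<forall>K. subgroup K G \<longrightarrow> int (card (transporter K K)) dvd (\<Sum>g\<in>transporter K K. \<phi>' (gen K g))"
        using cg mk_congruence[OF cX] by (simp add: \<phi>'_def sum_subtractf sum_distrib_left[symmetric])
      ultimately have "\<phi>' \<in> mark_lattice" using less.hyps[of D' \<phi>'] by blast
      then have "(\<lambda>J. \<phi>' J + n * ?m J) \<in> mark_lattice" by (rule mark_lattice_add[OF _ mark_lattice_smult[OF mL]])
      then show ?thesis by (simp add: \<phi>'_def)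
    qed
  qed
  moreover have "finite {J. subgroup J G}"
    by (rule finite_subset[of _ "Pow (carrier G)"]) (use finite_carrier subgroup.subset in auto)
  ultimately show ?thesis using assms by blast
qed

end

section \<open>A Burnside ring element supported on the Sylow subgroups\<close>

text \<open>Group the elements by the cyclic subgroup they generate; each such subgroup has
  \<open>totient d\<close> generators.\<close>

lemma (in group) card_elements_of_order:
  assumes fin: "finite (carrier G)" and d: "d > 1"
  shows "totient d dvd card {x \<in> carrier G. ord x = d}"
proof -
  let ?T = "{x \<in> carrier G. ord x = d}"
  have cls: "card {x \<in> ?T. generate G {x} = generate G {a}} = totient d" if a: "a \<in> ?T" for a
  proof -
    have ac: "a \<in> carrier G" "ord a = d" using a by auto
    have genfin: "finite (generate G {a})" using fin generate_incl[of "{a}"] ac(1) finite_subset by blast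
    have "{x \<in> ?T. generate G {x} = generate G {a}} = (\<lambda>k. a [^] k) ` totatives d"
    proof (rule equalityI; rule subsetI)
      fix x assume x: "x \<in> {x \<in> ?T. generate G {x} = generate G {a}}"
      then have "x \<in> generate G {a}" using generate.incl[of x "{x}" G] by blast
      then have "x \<in> {a [^] k | k. k \<in> {0..ord a - 1}}"
        unfolding generate_pow_on_finite_carrier[OF fin ac(1)] ord_elems[OF fin ac(1)] .
      then obtain k where k: "x = a [^] k" "k \<le> d - 1" using ac(2) by auto
      have "ord (a [^] k) = ord a" using x k ac by simp
      then have "coprime k d" using pow_ord_eq_ord_iff[OF fin ac(1)] ac(2) by simp
      moreover have "k \<noteq> 0" using \<open>coprime k d\<close> d by (cases "k = 0") auto
      ultimately have "k \<in> totatives d" using k(2) d by (auto simp: in_totatives_iff)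
      then show "x \<in> (\<lambda>k. a [^] k) ` totatives d" using k(1) by blast
    next
      fix x assume "x \<in> (\<lambda>k. a [^] k) ` totatives d"
      then obtain k where k: "x = a [^] k" "coprime k d" by (auto simp: in_totatives_iff)
      have xc: "x \<in> carrier G" using k ac by simp
      have o: "ord x = d" using pow_ord_eq_ord_iff[OF fin ac(1), of k] k ac(2) by simp
      have "x \<in> generate G {a}"
        using generate_pow_on_finite_carrier[OF fin ac(1)] k(1) by blast
      then have "generate G {x} \<subseteq> generate G {a}"
        using generate_subgroup_incl[of "{x}" "generate G {a}"] generate_is_subgroup[of "{a}"] ac(1) by simp
      moreover have "card (generate G {x}) = card (generate G {a})"
        using generate_pow_card[OF xc] generate_pow_card[OF ac(1)] o ac(2) by simp
      ultimately have "generate G {x} = generate G {a}" using card_subset_eq[OF genfin] by simp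
      then show "x \<in> {x \<in> ?T. generate G {x} = generate G {a}}" using xc o by simp
    qed
    moreover have "inj_on (\<lambda>k. a [^] k) (totatives d)"
      by (rule inj_on_subset[OF ord_inj'[OF ac(1)]]) (auto simp: in_totatives_iff ac(2))
    ultimately show ?thesis by (simp add: card_image totient_def)
  qed
  have "card ?T = (\<Sum>C\<in>(\<lambda>x. generate G {x}) ` ?T. card {x \<in> ?T. generate G {x} = C})"
    unfolding card_eq_sum by (rule sum.image_gen) (use fin in simp)
  also have "totient d dvd \<dots>"
    by (rule dvd_sum) (use cls in auto)
  finally show ?thesis .
qed

context finite_group
begin

text \<open>Modulo \<open>K\<close>, the group \<open>gen K g\<close> becomes the cyclic group
  generated by the coset of \<open>g\<close>.\<close>

lemma card_gen_coset:
  assumes K: "subgroup K G" and g: "g \<in> transporter K K"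
  shows "card (gen K g) = card K * group.ord (G\<lparr>carrier := transporter K K\<rparr> Mod K) (K #> g)"
    and "K \<lhd> G\<lparr>carrier := transporter K K\<rparr>"
proof -
  let ?N = "transporter K K"
  let ?NG = "G\<lparr>carrier := ?N\<rparr>"
  note N = transporter_subgroup[OF K]
  interpret N: group ?NG by (rule subgroup_imp_group[OF N])
  have tr: "x \<in> ?N \<longleftrightarrow> x \<in> carrier G \<and> (\<forall>j\<in>K. x \<otimes> j \<otimes> inv x \<in> K)" for x
    by (simp add: transporter_def[OF K])
  have KN: "subgroup K ?NG" by (rule subgroup_incl[OF K N K_le_transporter[OF K]])
  show norm: "K \<lhd> ?NG"
    unfolding N.normal_inv_iff using KN tr m_inv_consistent[OF N] by auto
  interpret K: normal K ?NG by (rule norm)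
  let ?W = "?NG Mod K"
  interpret W: group ?W by (rule K.factorgroup_is_group)
  interpret \<pi>: group_hom ?NG ?W "\<lambda>x. K #> x"
    using K.r_coset_hom_Mod by (intro group_hom.intro group_hom_axioms.intro N.is_group W.is_group)
      (simp add: r_coset_def)
  have sub: "insert g K \<subseteq> ?N" using g K_le_transporter[OF K] by simp
  have gc: "g \<in> carrier G" using g tr by blast
  have "(\<lambda>x. K #> x) ` gen K g = generate ?W ((\<lambda>x. K #> x) ` insert g K)"
    using \<pi>.generate_img[of "insert g K"] sub generate_consistent[OF sub N] by simp
  also have "(\<lambda>x. K #> x) ` insert g K = {K #> g, \<one>\<^bsub>?W\<^esub>}"
    using coset_join2[OF _ K] subgroup.mem_carrier[OF K] subgroup.one_closed[OF K] by (auto simp: image_iff)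
  also have "generate ?W {K #> g, \<one>\<^bsub>?W\<^esub>} = generate ?W {K #> g}"
  proof
    have gW: "K #> g \<in> carrier ?W" using \<pi>.hom_closed g by simp
    then show "generate ?W {K #> g, \<one>\<^bsub>?W\<^esub>} \<subseteq> generate ?W {K #> g}"
    proof (intro W.generate_subgroup_incl[OF _ W.generate_is_subgroup])
      have "K #> g \<in> generate ?W {K #> g}" by (rule generate.incl) simp
      moreover have "\<one>\<^bsub>?W\<^esub> \<in> generate ?W {K #> g}" by (rule generate.one)
      ultimately show "{K #> g, \<one>\<^bsub>?W\<^esub>} \<subseteq> generate ?W {K #> g}" by blast
    qed (use gW in blast)
    show "generate ?W {K #> g} \<subseteq> generate ?W {K #> g, \<one>\<^bsub>?W\<^esub>}" by (rule W.mono_generate) auto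
  qed
  finally have img: "(\<lambda>x. K #> x) ` gen K g = generate ?W {K #> g}" .
  have Hs: "subgroup (gen K g) G" by (rule gen_subgroup[OF K gc])
  interpret H: group "G\<lparr>carrier := gen K g\<rparr>" by (rule subgroup_imp_group[OF Hs])
  have KH: "subgroup K (G\<lparr>carrier := gen K g\<rparr>)" using subgroup_incl[OF K Hs] gen_incl[of g K] by simp
  have "rcosets\<^bsub>G\<lparr>carrier := gen K g\<rparr>\<^esub> K = (\<lambda>x. K #> x) ` gen K g"
    by (auto simp: RCOSETS_def r_coset_def)
  then have "card ((\<lambda>x. K #> x) ` gen K g) * card K = card (gen K g)"
    using H.lagrange[OF KH] by (simp add: order_def)
  then show "card (gen K g) = card K * group.ord ?W (K #> g)"
    using W.generate_pow_card[of "K #> g"] \<pi>.hom_closed g by (simp add: img mult.commute)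
qed

text \<open>With \<open>card K = p ^ k\<close>, the elements counted fill the cosets of order
  \<open>p ^ (n - k)\<close> in the normalizer modulo \<open>K\<close>. For \<open>k < n\<close> the
  number of these cosets is a multiple of \<open>totient (p ^ (n - k))\<close>, hence of
  \<open>p ^ (n - k - 1)\<close>, and each contributes \<open>p ^ k\<close> elements.\<close>

lemma card_cyclic_extensions:
  assumes K: "subgroup K G" and p: "prime p"
  shows "p ^ (n - 1) dvd card {g \<in> transporter K K. card (gen K g) = p ^ n}"
proof (cases "{g \<in> transporter K K. card (gen K g) = p ^ n} = {}")
  case True
  show ?thesis unfolding True by simp
next
  case False
  let ?T = "{g \<in> transporter K K. card (gen K g) = p ^ n}"
  let ?N = "transporter K K"
  let ?NG = "G\<lparr>carrier := ?N\<rparr>"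
  let ?W = "?NG Mod K"
  note N = transporter_subgroup[OF K]
  obtain g0 where g0: "g0 \<in> ?N" "card (gen K g0) = p ^ n" using False by auto
  have "card K dvd p ^ n" using card_gen_coset(1)[OF K g0(1)] g0(2) by simp
  then obtain k where k: "k \<le> n" "card K = p ^ k" using p by (auto simp: divides_primepow_nat)
  interpret N: group ?NG by (rule subgroup_imp_group[OF N])
  have norm: "K \<lhd> ?NG" by (rule card_gen_coset(2)[OF K g0(1)])
  interpret K: normal K ?NG by (rule norm)
  interpret W: group ?W by (rule K.factorgroup_is_group)
  have Wc: "carrier ?W = (\<lambda>x. K #> x) ` ?N" by (auto simp: carrier_FactGroup r_coset_def)
  have finW: "finite (carrier ?W)" using Wc finite_subgroup[OF N] by simp
  let ?S = "{x \<in> carrier ?W. W.ord x = p ^ (n - k)}"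
  have p0: "p ^ k > 0" using p by (simp add: prime_gt_0_nat)
  have split: "p ^ n = p ^ k * p ^ (n - k)" using k(1) by (simp add: power_add[symmetric])
  have T: "?T = {g \<in> ?N. W.ord (K #> g) = p ^ (n - k)}"
    using card_gen_coset(1)[OF K] k p0 unfolding split by auto
  have Nc: "x \<in> carrier G" if "x \<in> ?N" for x using that by (simp add: transporter_def[OF K])
  have U: "\<Union> ?S = ?T"
  proof (rule equalityI; rule subsetI)
    fix x assume "x \<in> \<Union> ?S"
    then obtain y where y: "y \<in> ?N" "x \<in> K #> y" "W.ord (K #> y) = p ^ (n - k)" using Wc by auto
    have "K #> x = K #> y" using repr_independence[OF y(2) Nc[OF y(1)] K] by simp
    moreover have "x \<in> ?N"
      using y subgroup.m_closed[OF N] K_le_transporter[OF K] by (auto simp: r_coset_def)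
    ultimately show "x \<in> ?T" using y(3) T by simp
  next
    fix x assume "x \<in> ?T"
    then have "x \<in> ?N" "W.ord (K #> x) = p ^ (n - k)" using T by auto
    then show "x \<in> \<Union> ?S" using Wc rcos_self[OF Nc K, of x] by auto
  qed
  have Wr: "C \<in> rcosets K" if "C \<in> carrier ?W" for C using that Wc Nc by (auto simp: RCOSETS_def)
  have "card (\<Union> ?S) = (\<Sum>C\<in>?S. card C)"
  proof (rule card_Union_disjoint)
    show "pairwise disjnt ?S" using rcos_disjoint[OF K] Wr by (auto simp: pairwise_def disjnt_def)
    show "finite C" if "C \<in> ?S" for C
      using that Wr subgroup.rcosets_carrier[OF K is_group] finite_carrier finite_subset by blast
  qed
  also have "\<dots> = (\<Sum>C\<in>?S. card K)"
  proof (rule sum.cong[OF refl])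
    fix C assume "C \<in> ?S"
    then have "C \<in> rcosets K" using Wr by blast
    then show "card C = card K" using card_rcosets_equal[OF _ subgroup.subset[OF K]] by simp
  qed
  finally have cT: "card ?T = card ?S * p ^ k" using U k(2) by simp
  show ?thesis
  proof (cases "n = k")
    \<comment> \<open>Here the cosets have order 1, which the totient count excludes, but the factor
      \<open>p ^ k\<close> alone suffices.\<close>
    case True
    then have "p ^ (n - 1) dvd p ^ k" by (intro le_imp_power_dvd) simp
    then show ?thesis unfolding cT by simp
  next
    case False
    then obtain j where j: "n - k = Suc j" using k(1) by (metis diff_is_0_eq le_antisym not0_implies_Suc)
    have "p ^ j dvd totient (p ^ Suc j)" unfolding totient_prime_power_Suc[OF p] by simp
    moreover have "p ^ Suc j > 1" using p by (metis one_less_power prime_gt_1_nat zero_less_Suc)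
    then have "totient (p ^ Suc j) dvd card ?S"
      unfolding j by (rule W.card_elements_of_order[OF finW])
    ultimately have "p ^ j dvd card ?S" by (rule dvd_trans)
    then have "p ^ j * p ^ k dvd card ?T" unfolding cT by (rule mult_dvd_mono) simp
    moreover have "n - 1 = j + k" using j k(1) by simp
    ultimately show ?thesis by (simp add: power_add)
  qed
qed

text \<open>This is the origin of the constant \<open>c * p\<close>: the order of each normalizer
  divides \<open>order G = (c * p) * p ^ (n - 1)\<close>, and the count of cyclic extensions
  supplies the factor \<open>p ^ (n - 1)\<close>.\<close>

lemma sylow_indicator:
  assumes p: "prime p" and ord: "order G = p ^ n * c" and n: "n \<ge> 1"
  shows "(\<lambda>J. if subgroup J G \<and> card J = p ^ n then int (c * p) else 0) \<in> mark_lattice"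
    (is "?\<phi> \<in> _")
proof (rule mark_latticeI_congruence)
  show "?\<phi> (conj_set x J) = ?\<phi> J" if "x \<in> carrier G" "subgroup J G" for x J
    using conj_set_subgroup[OF that] card_conj_set[OF that(1) subgroup.subset[OF that(2)]] that(2) by simp
  fix K assume K: "subgroup K G"
  let ?N = "transporter K K"
  let ?T = "{g \<in> ?N. card (gen K g) = p ^ n}"
  have Nc: "x \<in> carrier G" if "x \<in> ?N" for x using that by (simp add: transporter_def[OF K])
  have finN: "finite ?N" by (rule finite_subgroup[OF transporter_subgroup[OF K]])
  have "(\<Sum>g\<in>?N. ?\<phi> (gen K g)) = (\<Sum>g\<in>?N. if card (gen K g) = p ^ n then int (c * p) else 0)"
    using gen_subgroup[OF K] Nc by (intro sum.cong) auto
  also have "\<dots> = int (c * p * card ?T)"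
    using finN by (simp add: sum.If_cases Int_def)
  finally have sum: "(\<Sum>g\<in>?N. ?\<phi> (gen K g)) = int (c * p * card ?T)" .
  have "card ?N dvd order G" using lagrange[OF transporter_subgroup[OF K]] by (metis dvd_triv_right)
  also have "order G = c * p * p ^ (n - 1)" using ord n by (cases n) (simp_all add: algebra_simps)
  also have "c * p * p ^ (n - 1) dvd c * p * card ?T"
    by (rule mult_dvd_mono[OF dvd_refl card_cyclic_extensions[OF K p]])
  finally show "int (card ?N) dvd (\<Sum>g\<in>?N. ?\<phi> (gen K g))" unfolding sum by (simp only: int_dvd_int_iff)
qed simp

section \<open>Extensions of mark modules\<close>

lemma lattice_p_congruence:
  assumes u: "u \<in> mark_lattice" and H: "subgroup H G" "card H = p ^ k" and p: "prime p"
  shows "int p dvd u {\<one>} - u H"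
proof -
  obtain v w where vw: "v \<in> mark_vectors" "w \<in> mark_vectors" "\<And>H. u H = v H - w H"
    using mark_latticeE[OF u] by blast
  have *: "int p dvd v {\<one>} - v H" if "v \<in> mark_vectors" for v
    using that mk_p_congruence[OF _ H p] by (auto simp: mark_vectors_def)
  have "int p dvd (v {\<one>} - v H) - (w {\<one>} - w H)" by (rule dvd_diff[OF *[OF vw(1)] *[OF vw(2)]])
  then show ?thesis by (simp add: vw(3) algebra_simps)
qed

lemma lattice_conj:
  assumes u: "u \<in> mark_lattice" and "x \<in> carrier G" "subgroup J G"
  shows "u (conj_set x J) = u J"
proof -
  obtain v w where vw: "v \<in> mark_vectors" "w \<in> mark_vectors" "\<And>H. u H = v H - w H"
    using mark_latticeE[OF u] by blast
  have *: "v (conj_set x J) = v J" if "v \<in> mark_vectors" for v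
    using that mk_conj[OF _ assms(2,3)] by (auto simp: mark_vectors_def)
  show ?thesis by (simp add: vw(3) *[OF vw(1)] *[OF vw(2)])
qed

text \<open>Sylow conjugacy through marks: \<open>G/P\<close> has \<open>c\<close> points with
  \<open>c\<close> prime to \<open>p\<close>, so the \<open>p\<close>-group \<open>J\<close> fixes
  one of them and is conjugate to \<open>P\<close>.\<close>

lemma lattice_sylow_eq:
  assumes u: "u \<in> mark_lattice" and p: "prime p" and ord: "order G = p ^ n * c" "\<not> p dvd c"
    and P: "subgroup P G" "card P = p ^ n" and J: "subgroup J G" "card J = p ^ n"
  shows "u J = u P"
proof -
  have cX: "finite_gset G (coset_gset P)" by (rule finite_gset_coset[OF P(1)])
  have "transporter P {\<one>} = carrier G"
    using subgroup.one_closed[OF P(1)] by (auto simp: transporter_def[OF P(1)])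
  then have "mk (coset_gset P) {\<one>} * int (p ^ n) = int (p ^ n * c)"
    using mk_coset[OF P(1) triv_subgroup] P(2) ord(1) by (simp add: order_def)
  then have "mk (coset_gset P) {\<one>} = int c" using p by (auto simp: prime_gt_0_nat)
  then have "mk (coset_gset P) J \<noteq> 0"
    using mk_p_congruence[OF cX J p] ord(2) by (auto simp: int_dvd_int_iff)
  then obtain x where x: "x \<in> carrier G" "conj_set x J \<subseteq> P" using mk_coset_nonzero[OF P(1)] by metis
  have "card (conj_set x J) = card P" using card_conj_set[OF x(1) subgroup.subset[OF J(1)]] J P by simp
  then have "conj_set x J = P" using card_subset_eq[OF finite_subgroup[OF P(1)] x(2)] by simp
  then show ?thesis using lattice_conj[OF u x(1) J(1)] by simp
qed

lemma mark_module_module: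
  assumes P: "subgroup P G"
  shows "module A (mark_module P)"
proof (rule moduleI)
  show "cring A" by (rule burnside_cring)
  have simps: "carrier (mark_module P) = UNIV" "add (mark_module P) = (+)" "zero (mark_module P) = 0"
    "\<And>a n. a \<odot>\<^bsub>mark_module P\<^esub> n = mark P a * n" by (simp_all add: mark_module_def)
  show "abelian_group (mark_module P)"
    by (rule abelian_groupI) (auto simp: simps intro: exI[of _ "- _"])
qed (auto simp: mark_module_def burnside_carrier burnside_add burnside_mult burnside_one mark_gc
      mark_lattice_add mark_lattice_mult mark_lattice_one P unit_marks_def distrib_right distrib_left)

text \<open>One explicit resolution shows that the choice inside \<open>Ext\<close> picks a genuine
  one, about which nothing else is known.\<close>

lemma Ext_unfold:
  fixes B :: "nat \<Rightarrow> ('r, 'm) generator set"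
  assumes "free_resolution R M B d \<epsilon>"
  obtains B' :: "nat \<Rightarrow> ('r, 'm) generator set" and d' \<epsilon>' where "free_resolution R M B' d' \<epsilon>'"
    "\<And>N l. Ext R M N l = Hom_cohomology R B' d' N l"
proof -
  let ?Q = "\<lambda>(B :: nat \<Rightarrow> ('r, 'm) generator set, d). \<exists>\<epsilon>. free_resolution R M B d \<epsilon>"
  obtain B' d' where Bd: "(SOME Bd. ?Q Bd) = (B', d')" by (cases "SOME Bd. ?Q Bd")
  have "?Q (SOME Bd. ?Q Bd)" using assms by (intro someI[of ?Q "(B, d)"]) auto
  then obtain \<epsilon>' where "free_resolution R M B' d' \<epsilon>'" using Bd by auto
  moreover have "Ext R M N l = Hom_cohomology R B' d' N l" for N l
    unfolding Ext_def Bd by simp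
  ultimately show thesis by (rule that)
qed

theorem Ext_rank_power:
  assumes p: "prime p" and ord: "order G = p ^ n * c" "\<not> p dvd c" and n: "n \<ge> 2"
    and P: "subgroup P G" "card P = p ^ n" and l: "l \<ge> 1"
  shows "2 ^ l \<le> group_rank (Ext A (mark_module P) (mark_module P) (2 * l))"
proof -
  interpret R: cring A by (rule burnside_cring)
  have p1: "p > 1" by (rule prime_gt_1_nat[OF p])
  \<comment> \<open>The augmentation ideal of the mark at \<open>P\<close>, as a lattice of
    functions.\<close>
  define U where "U = {u \<in> mark_lattice. u P = 0}"
  have finX: "finite {H. subgroup H G}"
    by (rule finite_subset[of _ "Pow (carrier G)"]) (use finite_carrier subgroup.subset in auto)
  have U1: "\<forall>u\<in>U. \<forall>H. H \<notin> {H. subgroup H G} \<longrightarrow> u H = 0" using mark_lattice_outside by (auto simp: U_def)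
  have U0: "(\<lambda>H. 0) \<in> U" using mark_lattice_zero by (simp add: U_def)
  have U2: "U \<noteq> {}" using U0 by blast
  have U3: "\<forall>u\<in>U. \<forall>v\<in>U. (\<lambda>H. u H - v H) \<in> U" using mark_lattice_diff by (simp add: U_def)
  obtain m :: nat and e and co :: "('a set \<Rightarrow> int) \<Rightarrow> nat \<Rightarrow> int" where
    e: "\<And>i. i < m \<Longrightarrow> e i \<in> U" and ex: "\<And>u H. u \<in> U \<Longrightarrow> u H = (\<Sum>i<m. co u i * e i H)"
    and co_add: "\<And>u v i. u \<in> U \<Longrightarrow> v \<in> U \<Longrightarrow> i < m \<Longrightarrow> co (\<lambda>H. u H + v H) i = co u i + co v i"
    and co_e: "\<And>i j. i < m \<Longrightarrow> j < m \<Longrightarrow> co (e i) j = (if i = j then 1 else 0)"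
    using int_lattice_basis[OF finX U1 U2 U3] by blast
  define um where "um = (\<lambda>a H. if subgroup H G then mark H a else 0)"
  have um: "um (gc u) = u" if "u \<in> mark_lattice" for u
    using mark_gc[OF that] mark_lattice_outside[OF that] by (auto simp: um_def fun_eq_iff)
  \<comment> \<open>Projection onto \<open>U\<close> along the unit; followed by the coordinates on
    \<open>U\<close> it gives the \<open>co\<close> of the bar construction.\<close>
  define aug_part where "aug_part = (\<lambda>u H. u H - u P * unit_marks H)"
  have augU: "aug_part u \<in> U" if "u \<in> mark_lattice" for u
    using mark_lattice_diff[OF that mark_lattice_smult[OF mark_lattice_one]] P
    by (simp add: aug_part_def U_def unit_marks_def)
  have aug_id: "aug_part u = u" if "u \<in> U" for u using that by (simp add: aug_part_def U_def)
  define co' where "co' = (\<lambda>a. co (aug_part (um a)))"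
  have co'gc: "co' (gc u) = co (aug_part u)" if "u \<in> mark_lattice" for u using um[OF that] by (simp add: co'_def)
  \<comment> \<open>\<open>Elem\<close> takes an integer here, the carrier type of the mark module,
    so words are numbered by \<open>list_encode\<close>.\<close>
  define enc where "enc = (\<lambda>xs :: nat list. Elem (int (list_encode xs)) :: ((('a, nat) gset set \<times> ('a, nat) gset set) set, int) generator)"
  have co0: "co (\<lambda>H. 0) i = 0" if "i < m" for i using co_add[OF U0 U0 that] by simp
  interpret bar A "mark_module P" "mark P" m "\<lambda>i. gc (e i)" co' enc
  proof (intro bar.intro integral_cochains.intro integral_cochains_axioms.intro bar_axioms.intro)
    show "cring A" by (rule burnside_cring)
    show "module A (mark_module P)" by (rule mark_module_module[OF P(1)])
    show "carrier (mark_module P) = UNIV" by (simp add: mark_module_def)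
    show "add (mark_module P) = (+)" by (simp add: mark_module_def)
    show "\<zero>\<^bsub>mark_module P\<^esub> = 0" by (simp add: mark_module_def)
    show "a \<odot>\<^bsub>mark_module P\<^esub> n = mark P a * n" for a n by (simp add: mark_module_def)
    show "mark P (a \<oplus>\<^bsub>A\<^esub> b) = mark P a + mark P b" "mark P (a \<otimes>\<^bsub>A\<^esub> b) = mark P a * mark P b"
      if "a \<in> carrier A" "b \<in> carrier A" for a b
      using that by (auto simp: burnside_carrier burnside_add burnside_mult mark_gc mark_lattice_add mark_lattice_mult P)
    show "mark P \<one>\<^bsub>A\<^esub> = 1" by (simp add: burnside_one mark_gc mark_lattice_one P unit_marks_def)
    show "gc (e i) \<in> carrier A" "mark P (gc (e i)) = 0" if "i < m" for i
      using e[OF that] by (auto simp: U_def burnside_carrier mark_gc P)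
    show "co' (a \<oplus>\<^bsub>A\<^esub> b) i = co' a i + co' b i" if ab: "a \<in> carrier A" "b \<in> carrier A" and i: "i < m" for a b i
    proof -
      obtain u v where uv: "u \<in> mark_lattice" "a = gc u" "v \<in> mark_lattice" "b = gc v"
        using ab by (auto simp: burnside_carrier)
      have "aug_part (\<lambda>H. u H + v H) = (\<lambda>H. aug_part u H + aug_part v H)" by (simp add: aug_part_def fun_eq_iff algebra_simps)
      then show ?thesis
        using co_add[OF augU[OF uv(1)] augU[OF uv(3)] i] uv by (simp add: burnside_add co'gc mark_lattice_add)
    qed
    have "aug_part unit_marks = (\<lambda>H. 0)" using P by (simp add: aug_part_def unit_marks_def fun_eq_iff)
    then show "co' \<one>\<^bsub>A\<^esub> i = 0" if "i < m" for i
      using co0[OF that] by (simp add: burnside_one co'gc mark_lattice_one)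
    show "co' (gc (e i)) j = (if i = j then 1 else 0)" if "i < m" "j < m" for i j
    proof -
      have "co' (gc (e i)) = co (e i)" using co'gc[of "e i"] e[OF that(1)] aug_id by (simp add: U_def)
      then show ?thesis using co_e[OF that] by simp
    qed
    show "a = add_pow A (mark P a) \<one>\<^bsub>A\<^esub> \<oplus>\<^bsub>A\<^esub> finsum A (\<lambda>i. add_pow A (co' a i) (gc (e i))) {..<m}"
      if aA: "a \<in> carrier A" for a
    proof -
      obtain u where u: "u \<in> mark_lattice" "a = gc u" using aA by (auto simp: burnside_carrier)
      have eL: "e i \<in> mark_lattice" if "i < m" for i using e[OF that] by (simp add: U_def)
      have sL: "(\<lambda>H. co' a i * e i H) \<in> mark_lattice" if "i \<in> {..<m}" for i
        using eL that by (intro mark_lattice_smult) auto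
      have "finsum A (\<lambda>i. add_pow A (co' a i) (gc (e i))) {..<m} = finsum A (\<lambda>i. gc (\<lambda>H. co' a i * e i H)) {..<m}"
        using eL sL by (intro R.finsum_cong') (auto simp: burnside_add_pow burnside_carrier)
      also have "\<dots> = gc (\<lambda>H. \<Sum>i<m. co' a i * e i H)" by (rule burnside_finsum(1)[OF sL]) auto
      also have "(\<lambda>H. \<Sum>i<m. co' a i * e i H) = aug_part u"
        using ex[OF augU[OF u(1)]] u by (simp add: co'gc fun_eq_iff)
      finally have "finsum A (\<lambda>i. add_pow A (co' a i) (gc (e i))) {..<m} = gc (aug_part u)" .
      moreover have "add_pow A (mark P a) \<one>\<^bsub>A\<^esub> = gc (\<lambda>H. u P * unit_marks H)"
        using u by (simp add: burnside_one burnside_add_pow mark_lattice_one mark_gc P)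
      moreover have "aug_part u \<in> mark_lattice" using augU[OF u(1)] by (simp add: U_def)
      ultimately show ?thesis
        using u mark_lattice_smult[OF mark_lattice_one] by (simp add: burnside_add) (simp add: aug_part_def)
    qed
    show "inj enc" by (auto simp: inj_def enc_def list_encode_eq)
  qed
  define f where "f = (\<lambda>J. int (c * p) * unit_marks J - (if subgroup J G \<and> card J = p ^ n then int (c * p) else 0))"
  have fL: "f \<in> mark_lattice"
    unfolding f_def using n
    by (intro mark_lattice_diff mark_lattice_smult mark_lattice_one sylow_indicator[OF p ord(1)]) simp
  have fval: "f J = (if card J = p ^ n then 0 else int (c * p))" if "subgroup J G" for J
    using that by (simp add: f_def unit_marks_def)
  have fP: "f P = 0" using fval P by simp
  obtain n' where n': "n = Suc (Suc n')" using n by (metis add_2_eq_Suc le_Suc_ex)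
  \<comment> \<open>Sylow's theorem for the exponent 1: the cofactor of \<open>p\<close> in the
    group order is \<open>p ^ (n - 1) * c\<close>.\<close>
  obtain C where C: "subgroup C G" "card C = p"
    using sylow_thm[of p G 1 "p ^ Suc n' * c"] p ord(1) n' finite_carrier is_group by (auto simp: algebra_simps)
  \<comment> \<open>As \<open>n \<ge> 2\<close>, the group \<open>C\<close> is too small to be a
    Sylow subgroup, so \<open>f\<close> has the same value at \<open>C\<close> and at the trivial
    subgroup.\<close>
  have "p < p ^ n" using power_strict_increasing[of 1 n p] n p1 by simp
  then have fC: "f C = int (c * p)" and f1: "f {\<one>} = int (c * p)"
    using fval[OF C(1)] fval[OF triv_subgroup] C(2) p1 by auto
  \<comment> \<open>Off the Sylow \<open>p\<close>-subgroups \<open>f\<close> equals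
    \<open>c * p\<close>; at them, all being conjugate to \<open>P\<close>, elements of
    \<open>U\<close> vanish.\<close>
  have f_mult: "(\<lambda>H. f H * u H) = (\<lambda>H. int (c * p) * u H)" if u: "u \<in> U" for u
  proof
    fix H show "f H * u H = int (c * p) * u H"
    proof (cases "subgroup H G")
      case True
      have uL: "u \<in> mark_lattice" "u P = 0" using u by (auto simp: U_def)
      show ?thesis using fval[OF True] lattice_sylow_eq[OF uL(1) p ord P True] uL(2) by auto
    next
      case False
      then show ?thesis using u mark_lattice_outside by (auto simp: U_def)
    qed
  qed
  have congP: "int p dvd u {\<one>} - u P" and congC: "int p dvd u {\<one>} - u C" if "u \<in> mark_lattice" for u
    using lattice_p_congruence[OF that P p] lattice_p_congruence[OF that C(1), of p 1] C(2) p by auto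
  let ?Q = "\<lambda>v. \<forall>u\<in>mark_lattice. int p ^ v dvd u C - u {\<one>}"
  \<comment> \<open>The regular G-set has mark \<open>order G\<close> at the trivial subgroup and 0
    at \<open>C\<close>, which bounds the exponents and makes \<open>Greatest\<close>
    meaningful.\<close>
  have bound: "v \<le> order G" if "?Q v" for v
  proof -
    let ?X = "coset_gset {\<one>}"
    have XL: "mk ?X \<in> mark_lattice"
      by (rule mark_vectors_lattice[OF mk_mark_vectors[OF finite_gset_coset[OF triv_subgroup]]])
    have "transporter {\<one>} {\<one>} = carrier G" by (auto simp: transporter_def[OF triv_subgroup])
    then have X1: "mk ?X {\<one>} = int (order G)" using mk_coset[OF triv_subgroup triv_subgroup] by (simp add: order_def)
    have "mk ?X C = 0"
    proof (rule ccontr)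
      assume "mk ?X C \<noteq> 0"
      then obtain x where "x \<in> carrier G" "conj_set x C \<subseteq> {\<one>}" using mk_coset_nonzero[OF triv_subgroup] by metis
      then have "card C \<le> 1"
        using card_conj_set[OF _ subgroup.subset[OF C(1)], of x] card_mono[of "{\<one>}" "conj_set x C"] by simp
      then show False using C(2) p1 by simp
    qed
    then have "int p ^ v dvd int (order G)" using that XL X1 by (metis diff_0 dvd_minus_iff)
    then have "p ^ v dvd order G" by (metis int_dvd_int_iff of_nat_power)
    then have "p ^ v \<le> order G" using finite_carrier by (intro dvd_imp_le) (simp_all add: order_gt_0_iff_finite)
    moreover have "v < p ^ v" using p1 by (simp add: power_gt_expt)
    ultimately show ?thesis by simp
  qed
  define v where "v = Greatest ?Q"
  have Q0: "?Q 0" by simp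
  have Qv: "?Q v" unfolding v_def by (rule GreatestI_nat[of ?Q 0 "order G"]) (use bound in auto)
  have "\<not> ?Q (Suc v)" using Greatest_le_nat[of ?Q "Suc v" "order G"] bound unfolding v_def by fastforce
  then obtain u2 where u2: "u2 \<in> mark_lattice" "\<not> int p ^ Suc v dvd u2 C - u2 {\<one>}" by blast
  \<comment> \<open>Projecting \<open>u2\<close> to \<open>U\<close> does not change the difference
    of the marks at \<open>C\<close> and at the trivial subgroup, so \<open>z\<close> lies in the
    ideal and its difference is still not divisible by \<open>p ^ Suc v\<close>.\<close>
  define z where "z = aug_part u2"
  have zU: "z \<in> U" using augU[OF u2(1)] by (simp add: z_def)
  have zC: "z C - z {\<one>} = u2 C - u2 {\<one>}"
    unfolding z_def aug_part_def unit_marks_def using C(1) triv_subgroup by simp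
  define g where "g = (\<lambda>(i :: bool) a. if i then (mark C a - mark {\<one>} a) div int p ^ v else (mark {\<one>} a - mark P a) div int p)"
  have gT: "g True (gc u) * int p ^ v = u C - u {\<one>}" and gF: "g False (gc u) * int p = u {\<one>} - u P"
    if "u \<in> mark_lattice" for u
    using Qv congP[OF that] that C(1) triv_subgroup P(1) by (simp_all add: g_def mark_gc)
  have pv: "int p ^ v \<noteq> 0" "int p \<noteq> 0" using p1 by auto
  \<comment> \<open>As \<open>g False\<close> is \<open>c\<close> and \<open>g True\<close> is 0 at
    \<open>f\<close>, this multiple of \<open>f\<close> cancels \<open>g False\<close> on
    \<open>b True\<close> while \<open>g True\<close> keeps the value \<open>c\<close> times that at
    \<open>z\<close>. The matrix of the values \<open>g i\<close> at \<open>b j\<close> becomes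
    diagonal.\<close>
  define b where "b = (\<lambda>i :: bool. if i then (\<lambda>H. int c * z H - g False (gc z) * f H) else f)"
  have fU: "f \<in> U" using fL fP by (simp add: U_def)
  have zL: "z \<in> mark_lattice" "z P = 0" using zU by (auto simp: U_def)
  have bU: "b i \<in> U" for i
    using mark_lattice_diff[OF mark_lattice_smult[OF zL(1)] mark_lattice_smult[OF fL]] fU fP zL(2)
    by (simp add: b_def U_def)
  have bL: "b i \<in> mark_lattice" "b i P = 0" for i using bU[of i] by (auto simp: U_def)
  have "2 ^ l \<le> group_rank (Hom_cohomology A B d (mark_module P) (2 * l))" if res: "free_resolution A (mark_module P) B d \<epsilon>"
    for B :: "nat \<Rightarrow> ((('a, nat) gset set \<times> ('a, nat) gset set) set, int) generator set" and d \<epsilon>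
  proof (rule Hom_cohomology_rank_power[where p = "int p" and q = "int c" and g = g and f = "gc f" and b = "\<lambda>i. gc (b i)", OF _ _ _ _ _ _ _ _ _ _ res l])
    show "prime (int p)" "\<not> int p dvd int c" using p ord(2) by (simp_all add: int_dvd_int_iff)
    show "g i (x \<oplus>\<^bsub>A\<^esub> y) = g i x + g i y" if xyA: "x \<in> carrier A" "y \<in> carrier A" for i x y
    proof -
      obtain s t where st: "s \<in> mark_lattice" "x = gc s" "t \<in> mark_lattice" "y = gc t"
        using xyA by (auto simp: burnside_carrier)
      have stL: "(\<lambda>H. s H + t H) \<in> mark_lattice" by (rule mark_lattice_add[OF st(1,3)])
      have "g True (gc (\<lambda>H. s H + t H)) * int p ^ v = (g True (gc s) + g True (gc t)) * int p ^ v"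
        by (simp add: gT[OF stL] gT[OF st(1)] gT[OF st(3)] distrib_right)
      moreover have "g False (gc (\<lambda>H. s H + t H)) * int p = (g False (gc s) + g False (gc t)) * int p"
        by (simp add: gF[OF stL] gF[OF st(1)] gF[OF st(3)] distrib_right)
      ultimately show ?thesis using p1 st by (cases i) (auto simp: burnside_add)
    qed
    show "int p dvd g i (x \<otimes>\<^bsub>A\<^esub> y)"
      if xy: "x \<in> carrier A" "y \<in> carrier A" "mark P x = 0" "mark P y = 0" for i x y
    proof -
      obtain s t where st: "s \<in> mark_lattice" "x = gc s" "t \<in> mark_lattice" "y = gc t"
        using xy(1,2) by (auto simp: burnside_carrier)
      have sP: "s P = 0" "t P = 0" using xy(3,4) st by (simp_all add: mark_gc P)
      have stL: "(\<lambda>H. s H * t H) \<in> mark_lattice" by (rule mark_lattice_mult[OF st(1,3)])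
      obtain s1 t1 where s1: "s {\<one>} = int p * s1" and t1: "t {\<one>} = int p * t1"
        using congP[OF st(1)] congP[OF st(3)] sP by (auto elim!: dvdE)
      have "int p dvd t C" using dvd_diff[OF dvd_triv_left[of "int p" t1] congC[OF st(3)]] t1 by simp
      then obtain tC where tC: "t C = int p * tC" by (auto elim!: dvdE)
      \<comment> \<open>The splitting leaves in each summand a difference divisible by
        \<open>p ^ v\<close> and a further factor, \<open>t C\<close> or \<open>s {\<one>}\<close>,
        divisible by \<open>p\<close>.\<close>
      have "g True (gc (\<lambda>H. s H * t H)) * int p ^ v = (s C - s {\<one>}) * t C + s {\<one>} * (t C - t {\<one>})"
        unfolding gT[OF stL] by (simp add: algebra_simps)
      also have "\<dots> = (g True (gc s) * int p ^ v) * t C + s {\<one>} * (g True (gc t) * int p ^ v)"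
        by (simp only: gT[OF st(1)] gT[OF st(3)])
      also have "\<dots> = (int p * (g True (gc s) * tC + s1 * g True (gc t))) * int p ^ v"
        by (simp add: s1 tC algebra_simps)
      finally have "g True (gc (\<lambda>H. s H * t H)) = int p * (g True (gc s) * tC + s1 * g True (gc t))"
        using p1 by auto
      moreover have "g False (gc (\<lambda>H. s H * t H)) * int p = (int p * (s1 * t1)) * int p"
        unfolding gF[OF stL] by (simp add: sP s1 t1 algebra_simps)
      then have "g False (gc (\<lambda>H. s H * t H)) = int p * (s1 * t1)" using p1 by auto
      ultimately show ?thesis using st by (cases i) (simp_all add: burnside_mult)
    qed
    show "gc f \<in> carrier A" "mark P (gc f) = 0" using fL fP by (simp_all add: burnside_carrier mark_gc P)
    show "gc (b i) \<in> carrier A" "mark P (gc (b i)) = 0" for i using bL by (simp_all add: burnside_carrier mark_gc P)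
    show "gc f \<otimes>\<^bsub>A\<^esub> gc (b i) = gc (b i) \<otimes>\<^bsub>A\<^esub> \<iota> (int c * int p)" for i
      unfolding \<iota>_def burnside_one burnside_add_pow[OF mark_lattice_one]
        burnside_mult[OF fL bL(1)] burnside_mult[OF bL(1) mark_lattice_smult[OF mark_lattice_one]]
        f_mult[OF bU] of_nat_mult
    proof (rule arg_cong[where f = gc], rule ext)
      fix H
      show "int c * int p * b i H = b i H * (int c * int p * unit_marks H)"
        using fun_cong[OF unit_marks_mult[OF bL(1)[of i]], of H] by (auto simp: algebra_simps)
    qed
    have gFf: "g False (gc f) = int c"
      using gF[OF fL] p1 by (auto simp: f1 fP)
    have gTf: "g True (gc f) = 0" using gT[OF fL] p1 by (auto simp: f1 fC)
    have gTb: "g True (gc (b True)) = int c * g True (gc z)"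
    proof -
      have "g True (gc (b True)) * int p ^ v = (int c * g True (gc z)) * int p ^ v"
        unfolding gT[OF bL(1)[of True]] mult.assoc[of "int c"] gT[OF zL(1)]
        by (simp add: b_def fC f1 algebra_simps)
      then show ?thesis using p1 by auto
    qed
    have gFb: "g False (gc (b True)) = 0"
    proof -
      have "g False (gc (b True)) * int p = 0"
        unfolding gF[OF bL(1)[of True]] bL(2)[of True]
        using gF[OF zL(1)] zL(2) by (simp add: b_def f1 algebra_simps)
      then show ?thesis using p1 by auto
    qed
    have "\<not> int p dvd g True (gc z)"
    proof
      assume "int p dvd g True (gc z)"
      then have "int p * int p ^ v dvd g True (gc z) * int p ^ v" by (rule mult_dvd_mono) simp
      then show False using u2(2) gT[OF zL(1)] zC by simp
    qed
    then have "\<not> int p dvd int c * g True (gc z)"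
      using p ord(2) by (simp add: prime_dvd_mult_iff int_dvd_int_iff)
    moreover have "b False = f" by (simp add: b_def)
    ultimately show "int p dvd g i (gc (b j)) \<longleftrightarrow> i \<noteq> j" for i j
      using ord(2) gFf gTf gTb gFb by (cases i; cases j) (simp_all add: int_dvd_int_iff)
  qed
  then show ?thesis using Ext_unfold[OF bar_resolution] by metis
qed

end

theorem theorem23:
  fixes G :: "('g, 'k) monoid_scheme"
  assumes "group G" and "finite (carrier G)" and "\<not> squarefree (order G)"
  shows "\<exists>H J. subgroup H G \<and> subgroup J G \<and>
    (\<forall>C :: int. \<exists>l\<ge>1.
       int (group_rank (Ext (burnside_ring G) (mark_module H) (mark_module J) l)) > C)"
proof -
  interpret finite_group G using assms by (simp add: finite_group_def finite_group_axioms_def)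
  have o0: "order G \<noteq> 0" using assms(2) order_gt_0_iff_finite by simp
  obtain x where x: "x ^ 2 dvd order G" "\<not> x dvd 1" using assms(3) by (auto simp: squarefree_def)
  then obtain p where p: "prime p" "p dvd x" using prime_factor_nat[of x] by auto
  have pp: "p ^ 2 dvd order G" using p(2) x(1) by (meson dvd_power_same dvd_trans)
  \<comment> \<open>The full multiplicity is taken so that \<open>p\<close> does not divide the
    cofactor \<open>c\<close>, which acts as the unit \<open>q\<close> in the pairing.\<close>
  define n where "n = multiplicity p (order G)"
  have n: "n \<ge> 2" unfolding n_def using pp o0 p(1) by (intro multiplicity_geI) auto
  obtain c where c: "order G = p ^ n * c" "\<not> p dvd c"
    using multiplicity_decompose'[OF o0, of p] p(1) not_prime_unit unfolding n_def by metis
  obtain P where P: "subgroup P G" "card P = p ^ n"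
    using sylow_thm[OF p(1) assms(1) c(1) assms(2)] by blast
  have "\<exists>l\<ge>1. int (group_rank (Ext A (mark_module P) (mark_module P) l)) > C" for C :: int
  proof -
    define k where "k = Suc (nat C)"
    have "C < int (2 ^ k)"
    proof -
      have "k < 2 ^ k" by simp
      then show ?thesis unfolding k_def by linarith
    qed
    also have "\<dots> \<le> int (group_rank (Ext A (mark_module P) (mark_module P) (2 * k)))"
      using Ext_rank_power[OF p(1) c n P, of k] by (simp only: of_nat_le_iff) (simp add: k_def)
    finally show ?thesis by (intro exI[of _ "2 * k"]) (simp add: k_def)
  qed
  then show ?thesis using P(1) by blast
qed

end
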